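(* Let $\Delta$ be a pure vertex decomposable simplicial complex, let $v$ be a shedding vertex of $\Delta$, and let $I_\Delta\subseteq R$ be the Stanley–Reisner ideal of $\Delta$. Then $$\operatorname{reg}(R/I_\Delta)=\max\{\operatorname{reg}(R/I_{\Delta_1}),\ \operatorname{reg}(R/I_{\Delta_2})+1\},$$ where $\Delta_1=\mathrm{del}_\Delta(v)$ is the deletion of $v$ and $\Delta_2=\mathrm{lk}_\Delta(v)$ is the link of $v$.
   Context: $\mathbb{K}$ is an algebraically closed field of characteristic $0$; $R$ is the standard graded polynomial ring over $\mathbb{K}$ with one variable for each element of the vertex set of $\Delta$. For a complex $\Gamma$ on (a subset of) this vertex set, $I_\Gamma\subseteq R$ is generated by the squarefree monomials corresponding to non-faces of $\Gamma$; in particular $I_{\Delta_1}$ and $I_{\Delta_2}$ contain the variable corresponding to $v$. Here $\mathrm{del}_\Delta(v)=\{F\in\Delta : v\notin F\}$ and $\mathrm{lk}_\Delta(v)=\{F\in\Delta : v\notin F,\ F\cup\{v\}\in\Delta\}$. A pure simplicial complex $\Delta$ is vertex decomposable if it is empty (including $\{\emptyset\}$) or a simplex, or it has a vertex $v$ such that $\mathrm{del}_\Delta(v)$ and $\mathrm{lk}_\Delta(v)$ are pure and vertex decomposable and $\dim\mathrm{del}_\Delta(v)=\dim\Delta=\dim\mathrm{lk}_\Delta(v)+1$ (so no facet of $\mathrm{lk}_\Delta(v)$ is a facet of $\mathrm{del}_\Delta(v)$). Such a vertex $v$ is called a shedding vertex. $\operatorname{reg}$ denotes Castelnuovo–Mumford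 regularity. *)

theory Defs
  imports
    "HOL-Library.Poly_Mapping"
    "HOL-Library.Extended_Real"
    "HOL-Computational_Algebra.Polynomial"
    "Jordan_Normal_Form.Matrix"
begin

section \<open>Simplicial complexes\<close>

text \<open>
  The finite type \<open>'v\<close> is the ambient vertex set. Deletions and links of a complex live on
  subsets of it, so a complex need not contain every singleton.
\<close>

definition simplicial_complex :: "'v::finite set set \<Rightarrow> bool" where
  "simplicial_complex \<Delta> \<longleftrightarrow> (\<forall>F\<in>\<Delta>. \<forall>G. G \<subseteq> F \<longrightarrow> G \<in> \<Delta>)"

definition facets :: "'v::finite set set \<Rightarrow> 'v set set" where
  "facets \<Delta> = {F \<in> \<Delta>. \<forall>G\<in>\<Delta>. F \<subseteq> G \<longrightarrow> G = F}"

definition pure :: "'v::finite set set \<Rightarrow> bool" where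
  "pure \<Delta> \<longleftrightarrow> (\<forall>F\<in>facets \<Delta>. \<forall>G\<in>facets \<Delta>. card F = card G)"

text \<open>
  The dimension of \<open>{{}}\<close> is \<open>- 1\<close>. The value for \<open>{}\<close> is unspecified; below, dimensions are only
  taken of nonempty complexes, because a deletion or link of a vertex \<open>v\<close> with \<open>{v} \<in> \<Delta>\<close>
  contains the empty face.
\<close>

definition complex_dim :: "'v::finite set set \<Rightarrow> int" where
  "complex_dim \<Delta> = int (Max (card ` \<Delta>)) - 1"

definition deletion :: "'v::finite set set \<Rightarrow> 'v \<Rightarrow> 'v set set" where
  "deletion \<Delta> v = {F \<in> \<Delta>. v \<notin> F}"

definition link :: "'v::finite set set \<Rightarrow> 'v \<Rightarrow> 'v set set" where
  "link \<Delta> v = {F \<in> \<Delta>. v \<notin> F \<and> insert v F \<in> \<Delta>}"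

inductive vertex_decomposable :: "'v::finite set set \<Rightarrow> bool"
  and shedding_vertex :: "'v set set \<Rightarrow> 'v \<Rightarrow> bool" where
  empty: "vertex_decomposable {}"
| simplex: "vertex_decomposable (Pow F)"
| shed: "\<lbrakk>simplicial_complex \<Delta>; pure \<Delta>; shedding_vertex \<Delta> v\<rbrakk> \<Longrightarrow> vertex_decomposable \<Delta>"
| shedding: "\<lbrakk>{v} \<in> \<Delta>;
    pure (deletion \<Delta> v); vertex_decomposable (deletion \<Delta> v);
    pure (link \<Delta> v); vertex_decomposable (link \<Delta> v);
    complex_dim (deletion \<Delta> v) = complex_dim \<Delta>;
    complex_dim \<Delta> = complex_dim (link \<Delta> v) + 1\<rbrakk> \<Longrightarrow> shedding_vertex \<Delta> v"


section \<open>The polynomial ring and Stanley--Reisner ideals\<close>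

text \<open>
  A monomial is an exponent vector \<open>'v \<Rightarrow>\<^sub>0 nat\<close>; multiplication of finitely supported maps is
  convolution, so the type below is the polynomial ring with one variable per element of \<open>'v\<close>.
\<close>

type_synonym ('v, 'k) mpolynomial = "('v \<Rightarrow>\<^sub>0 nat) \<Rightarrow>\<^sub>0 'k"

definition variable :: "'v \<Rightarrow> ('v, 'k::comm_ring_1) mpolynomial" where
  "variable v = Poly_Mapping.single (Poly_Mapping.single v 1) 1"

definition monomial_degree :: "('v \<Rightarrow>\<^sub>0 nat) \<Rightarrow> nat" where
  "monomial_degree m = (\<Sum>v\<in>Poly_Mapping.keys m. Poly_Mapping.lookup m v)"

text \<open>Degrees are integers, so the only homogeneous polynomial of negative degree is \<open>0\<close>.\<close>

definition homogeneous :: "int \<Rightarrow> ('v, 'k::comm_ring_1) mpolynomial \<Rightarrow> bool" where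
  "homogeneous n p \<longleftrightarrow> (\<forall>m\<in>Poly_Mapping.keys p. int (monomial_degree m) = n)"

definition ideal_generated :: "'a::comm_ring_1 set \<Rightarrow> 'a set" where
  "ideal_generated S = Modules.module.span (*) S"

definition irrelevant_ideal :: "('v, 'k::comm_ring_1) mpolynomial set" where
  "irrelevant_ideal = ideal_generated (range variable)"

definition stanley_reisner_ideal :: "'v::finite set set \<Rightarrow> ('v, 'k::comm_ring_1) mpolynomial set"
  where "stanley_reisner_ideal \<Delta> = ideal_generated {(\<Prod>v\<in>F. variable v) | F. F \<notin> \<Delta>}"


section \<open>Castelnuovo--Mumford regularity of \<open>R / I\<close>\<close>

text \<open>
  A graded free resolution \<open>\<dots> \<rightarrow> F\<^sub>2 \<rightarrow> F\<^sub>1 \<rightarrow> F\<^sub>0 \<rightarrow> R / I \<rightarrow> 0\<close> with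
  \<open>F\<^sub>i = \<Oplus>\<^sub>k R (- a i ! k)\<close>. The augmentation sends the \<open>k\<close>-th basis vector of \<open>F\<^sub>0\<close> to the class
  of \<open>f $ k\<close>, and \<open>D i\<close> is the matrix of \<open>F\<^bsub>i+1\<^esub> \<rightarrow> F\<^sub>i\<close>. An entry \<open>(l, k)\<close> of \<open>D i\<close> is
  homogeneous of degree \<open>a (Suc i) ! k - a i ! l\<close>, so that all maps preserve degrees.
\<close>

definition graded_free_resolution ::
  "('v, 'k::comm_ring_1) mpolynomial set \<Rightarrow> (nat \<Rightarrow> int list) \<Rightarrow>
    ('v, 'k) mpolynomial vec \<Rightarrow> (nat \<Rightarrow> ('v, 'k) mpolynomial mat) \<Rightarrow> bool" where
  "graded_free_resolution I a f D \<longleftrightarrow>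
    f \<in> carrier_vec (length (a 0)) \<and>
    (\<forall>k < length (a 0). homogeneous (a 0 ! k) (f $ k)) \<and>
    (\<forall>i. D i \<in> carrier_mat (length (a i)) (length (a (Suc i)))) \<and>
    (\<forall>i. \<forall>l < length (a i). \<forall>k < length (a (Suc i)).
        homogeneous (a (Suc i) ! k - a i ! l) (D i $$ (l, k))) \<and>
    (\<forall>p. \<exists>x \<in> carrier_vec (length (a 0)). p - f \<bullet> x \<in> I) \<and>
    {x \<in> carrier_vec (length (a 0)). f \<bullet> x \<in> I} =
      (*\<^sub>v) (D 0) ` carrier_vec (length (a 1)) \<and>
    (\<forall>i. {x \<in> carrier_vec (length (a (Suc i))). D i *\<^sub>v x = 0\<^sub>v (length (a i))} =
      (*\<^sub>v) (D (Suc i)) ` carrier_vec (length (a (Suc (Suc i)))))"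

definition minimal_graded_free_resolution ::
  "('v, 'k::comm_ring_1) mpolynomial set \<Rightarrow> (nat \<Rightarrow> int list) \<Rightarrow>
    ('v, 'k) mpolynomial vec \<Rightarrow> (nat \<Rightarrow> ('v, 'k) mpolynomial mat) \<Rightarrow> bool" where
  "minimal_graded_free_resolution I a f D \<longleftrightarrow>
    graded_free_resolution I a f D \<and>
    (\<forall>i. \<forall>l < length (a i). \<forall>k < length (a (Suc i)). D i $$ (l, k) \<in> irrelevant_ideal)"

text \<open>
  \<open>regularity_quotient I\<close> is \<open>reg (R / I) = max {j - i | \<beta>\<^bsub>i,j\<^esub> (R / I) \<noteq> 0}\<close> for a homogeneous ideal
  \<open>I\<close>, where the graded Betti number \<open>\<beta>\<^bsub>i,j\<^esub>\<close> counts the generators of degree \<open>j\<close> in step \<open>i\<close> of a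
  minimal graded free resolution. Over a field such a resolution exists and is unique up to isomorphism,
  so ranging over all of them does not change the set. The value is extended real so that
  the regularity of the zero module is \<open>-\<infinity>\<close>.
\<close>

definition regularity_quotient :: "('v, 'k::comm_ring_1) mpolynomial set \<Rightarrow> ereal" where
  "regularity_quotient I =
    Sup {ereal (real_of_int (j - int i)) | i j.
      \<exists>a f D. minimal_graded_free_resolution I a f D \<and> j \<in> set (a i)}"

end

theory Submission
  imports Defs "HOL-Library.Function_Algebras"
begin

text \<open>The variable \<open>x = x\<^sub>v\<close> gives a short exact sequence relating the three quotients. Write
  \<open>\<Delta>\<^sub>1\<close> for the deletion, \<open>\<Delta>\<^sub>2\<close> for the link, and let \<open>I\<^sub>1 \<subseteq> I\<^sub>2\<close> be the ideals of \<open>R\<close> generated by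
  the nonfaces of \<open>\<Delta>\<^sub>1\<close> and \<open>\<Delta>\<^sub>2\<close> that do not contain \<open>v\<close>. Then \<open>I\<^sub>\<Delta> = x I\<^sub>2 + I\<^sub>1\<close>, and
  \<open>0 \<rightarrow> R/I\<^sub>1(-1) \<rightarrow> R/I\<^sub>2(-1) \<oplus> R/I\<^sub>1 \<rightarrow> R/I\<^sub>\<Delta> \<rightarrow> 0\<close>
  is exact because \<open>x\<close> is a nonzerodivisor modulo \<open>I\<^sub>1\<close>. A mapping cone turns free resolutions of
  the two ideals into one of \<open>I\<^sub>\<Delta>\<close> (\<open>cone_resolution\<close>). Its \<open>i\<close>-th step is
  \<open>C\<^sub>i(-1) \<oplus> B\<^sub>i \<oplus> B\<^bsub>i-1\<^esub>(-1)\<close>, which yields the upper bound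
  \<open>reg (R/I\<^sub>\<Delta>) \<le> max {reg (R/I\<^sub>1), reg (R/I\<^sub>2) + 1}\<close> for every complex. In general the cone is not
  minimal, and cancellation may destroy equality.

  Equality holds here because the extremal generators sit in the last step. Vertex decomposable
  complexes are Cohen--Macaulay, so the regularity of such a quotient is attained at the end of its
  resolution. This is captured by \<open>has_extremal_resolution I c r\<close>: there is a graded free resolution
  of length \<open>c\<close>, minimal or not, with all generators of step \<open>i\<close> in degrees at most \<open>r + i\<close>, and
  with a generator of degree exactly \<open>r + c\<close> in step \<open>c\<close>. Making a resolution minimal cancels pairs
  of generators of the same degree in adjacent steps. The partner of the extremal generator would lie
  in step \<open>c - 1\<close> with degree \<open>r + c > r + (c - 1)\<close>, or in the empty step \<open>c + 1\<close>, so there is none. Hence the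
  generator survives and \<open>reg (R/I) = r\<close> (\<open>regularity_quotient_extremal\<close>).

  The property passes to the cone because the resolution for the link is one step longer than the
  one for the deletion: \<open>C\<^sub>c(-1)\<close> and \<open>B\<^bsub>c-1\<^esub>(-1)\<close> both lie in the last step, and
  whichever is extremal remains so. As lengths are codimensions, this is the dimension condition on
  a shedding vertex. Induction over the vertex decomposition
  (\<open>extremal_of_vertex_decomposable\<close>) then provides all the required resolutions.

  That the value does not depend on the minimal resolution is the usual comparison argument: lifts of
  the identity in both directions compose to a map homotopic to the identity, hence equal to it modulo
  the irrelevant ideal, so the degrees of a minimal resolution occur in every other one
  (\<open>minimal_degrees_subset\<close>).\<close>

section \<open>Homogeneous polynomials\<close>

lemma monomial_degree_UNIV: "monomial_degree (m :: 'v::finite \<Rightarrow>\<^sub>0 nat) = (\<Sum>v\<in>UNIV. Poly_Mapping.lookup m v)"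
  unfolding monomial_degree_def
  by (rule sum.mono_neutral_left) (auto simp: in_keys_iff)

lemma monomial_degree_add:
  "monomial_degree (m + n :: 'v::finite \<Rightarrow>\<^sub>0 nat) = monomial_degree m + monomial_degree n"
  by (simp add: monomial_degree_UNIV lookup_add sum.distrib)

lemma monomial_degree_single: "monomial_degree (Poly_Mapping.single v n) = n"
  by (cases "n = 0") (auto simp: monomial_degree_def)

lemma monomial_degree_eq_0_iff: "monomial_degree m = 0 \<longleftrightarrow> m = 0"
proof
  assume "monomial_degree m = 0"
  hence "\<forall>v\<in>Poly_Mapping.keys m. Poly_Mapping.lookup m v = 0"
    unfolding monomial_degree_def by (simp add: sum_eq_0_iff)
  thus "m = 0" by (intro poly_mapping_eqI) (metis in_keys_iff lookup_zero)
qed (simp add: monomial_degree_def)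

lemma homogeneous_0 [simp]: "homogeneous d 0"
  by (simp add: homogeneous_def)

lemma homogeneous_1 [simp]: "homogeneous 0 1"
  by (simp add: homogeneous_def monomial_degree_def)

lemma homogeneous_add: "homogeneous d p \<Longrightarrow> homogeneous d q \<Longrightarrow> homogeneous d (p + q)"
  unfolding homogeneous_def using Poly_Mapping.keys_add[of p q] by blast

lemma homogeneous_uminus: "homogeneous d p \<Longrightarrow> homogeneous d (- p)"
  unfolding homogeneous_def by (simp add: in_keys_iff)

lemma homogeneous_diff: "homogeneous d p \<Longrightarrow> homogeneous d q \<Longrightarrow> homogeneous d (p - q)"
  using homogeneous_add[of d p "- q"] homogeneous_uminus[of d q] by simp

lemma homogeneous_mult:
  fixes p q :: "('v::finite, 'k::comm_ring_1) mpolynomial"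
  assumes "homogeneous d p" and "homogeneous d' q"
  shows "homogeneous (d + d') (p * q)"
  unfolding homogeneous_def
proof
  fix m assume "m \<in> Poly_Mapping.keys (p * q)"
  then obtain a b where "a \<in> Poly_Mapping.keys p" "b \<in> Poly_Mapping.keys q" "m = a + b"
    using keys_mult[of p q] by blast
  thus "int (monomial_degree m) = d + d'"
    using assms by (simp add: homogeneous_def monomial_degree_add)
qed

lemma homogeneous_variable: "homogeneous 1 (variable v)"
  by (simp add: homogeneous_def variable_def monomial_degree_single)

abbreviation const_coeff :: "('v, 'k::comm_ring_1) mpolynomial \<Rightarrow> 'k" where
  "const_coeff p \<equiv> Poly_Mapping.lookup p 0"

text \<open>Evaluation at the origin is multiplicative.\<close>

lemma const_coeff_mult_nonzero:
  fixes p q :: "('v::finite, 'k::comm_ring_1) mpolynomial"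
  assumes "const_coeff (p * q) \<noteq> 0"
  shows "const_coeff p \<noteq> 0 \<and> const_coeff q \<noteq> 0"
proof -
  have "0 \<in> Poly_Mapping.keys (p * q)" using assms by (simp add: in_keys_iff)
  then obtain a b where ab: "a \<in> Poly_Mapping.keys p" "b \<in> Poly_Mapping.keys q" "0 = a + b"
    using keys_mult[of p q] by blast
  have "monomial_degree a + monomial_degree b = 0"
    by (metis ab(3) monomial_degree_add monomial_degree_eq_0_iff)
  thus ?thesis using ab by (auto simp: monomial_degree_eq_0_iff in_keys_iff)
qed

lemma homogeneous_const_coeff:
  assumes "homogeneous d p" and "const_coeff p \<noteq> 0"
  shows "d = 0" and "p = Poly_Mapping.single 0 (const_coeff p)"
proof -
  have "0 \<in> Poly_Mapping.keys p" using assms(2) by (simp add: in_keys_iff)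
  thus d: "d = 0" using assms(1) by (auto simp: homogeneous_def monomial_degree_def)
  have "m = 0" if "Poly_Mapping.lookup p m \<noteq> 0" for m
    using that assms(1) d by (auto simp: homogeneous_def in_keys_iff monomial_degree_eq_0_iff)
  thus "p = Poly_Mapping.single 0 (const_coeff p)"
    by (intro poly_mapping_eqI) (metis lookup_single_eq lookup_single_not_eq)
qed

text \<open>Over a field, a homogeneous polynomial outside the irrelevant ideal is a nonzero constant. This
  is what makes it possible to eliminate such an entry from a resolution.\<close>

lemma homogeneous_unit:
  fixes p :: "('v, 'k::field) mpolynomial"
  assumes "homogeneous d p" and "const_coeff p \<noteq> 0"
  obtains u where "homogeneous 0 u" and "u * p = 1"
proof
  let ?u = "Poly_Mapping.single 0 (inverse (const_coeff p)) :: ('v, 'k) mpolynomial"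
  show "homogeneous 0 ?u" by (auto simp: homogeneous_def monomial_degree_def)
  have "?u * p = ?u * Poly_Mapping.single 0 (const_coeff p)"
    using homogeneous_const_coeff(2)[OF assms] by simp
  also have "\<dots> = 1" using assms(2) by (simp add: mult_single)
  finally show "?u * p = 1" .
qed

lemma poly_mapping_sum_single: "p = (\<Sum>m\<in>Poly_Mapping.keys p. Poly_Mapping.single m (Poly_Mapping.lookup p m))"
proof (rule poly_mapping_eqI)
  fix n
  have "Poly_Mapping.lookup (\<Sum>m\<in>Poly_Mapping.keys p. Poly_Mapping.single m (Poly_Mapping.lookup p m)) n
     = (\<Sum>m\<in>Poly_Mapping.keys p. if m = n then Poly_Mapping.lookup p n else 0)"
    unfolding lookup_sum by (rule sum.cong) (auto simp: lookup_single when_def)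
  thus "Poly_Mapping.lookup p n = Poly_Mapping.lookup (\<Sum>m\<in>Poly_Mapping.keys p. Poly_Mapping.single m (Poly_Mapping.lookup p m)) n"
    by (simp add: sum.delta in_keys_iff)
qed

lemma module_mult: "Modules.module ((*) :: 'a::comm_ring_1 \<Rightarrow> 'a \<Rightarrow> 'a)"
  by unfold_locales (simp_all add: algebra_simps)

interpretation ring_module: Modules.module "(*) :: 'a::comm_ring_1 \<Rightarrow> 'a \<Rightarrow> 'a"
  by (rule module_mult)

text \<open>A polynomial is a combination of its monomials, so membership in an ideal may be checked on
  them (a sufficient condition in general, and a necessary one for monomial ideals).\<close>

lemma in_subspace_by_terms:
  assumes "ring_module.subspace I"
    and "\<And>m. m \<in> Poly_Mapping.keys p \<Longrightarrow> Poly_Mapping.single m 1 \<in> I"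
  shows "(p :: ('v, 'k::comm_ring_1) mpolynomial) \<in> I"
proof -
  have "Poly_Mapping.single m (Poly_Mapping.lookup p m) \<in> I" if "m \<in> Poly_Mapping.keys p" for m
  proof -
    have "Poly_Mapping.single 0 (Poly_Mapping.lookup p m) * Poly_Mapping.single m 1 \<in> I"
      using assms that by (metis ring_module.subspace_scale)
    thus ?thesis by (simp add: mult_single)
  qed
  hence "(\<Sum>m\<in>Poly_Mapping.keys p. Poly_Mapping.single m (Poly_Mapping.lookup p m)) \<in> I"
    by (intro ring_module.subspace_sum[OF assms(1)])
  thus ?thesis using poly_mapping_sum_single[of p] by simp
qed

lemma irrelevant_ideal_iff:
  "(p :: ('v::finite, 'k::comm_ring_1) mpolynomial) \<in> irrelevant_ideal \<longleftrightarrow> const_coeff p = 0"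
proof
  have sub: "ring_module.subspace {p :: ('v, 'k) mpolynomial. const_coeff p = 0}"
    by (rule ring_module.subspaceI) (auto simp: lookup_add dest: const_coeff_mult_nonzero)
  have "range variable \<subseteq> {p :: ('v, 'k) mpolynomial. const_coeff p = 0}"
    by (auto simp: variable_def lookup_single when_def)
       (metis lookup_single_eq lookup_zero Suc_neq_Zero)
  hence "irrelevant_ideal \<subseteq> {p :: ('v, 'k) mpolynomial. const_coeff p = 0}"
    unfolding irrelevant_ideal_def ideal_generated_def
    using ring_module.span_minimal[OF _ sub] by blast
  thus "const_coeff p = 0" if "p \<in> irrelevant_ideal" using that by blast
next
  assume p: "const_coeff p = 0"
  show "p \<in> irrelevant_ideal"
    unfolding irrelevant_ideal_def ideal_generated_def
  proof (rule in_subspace_by_terms)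
    fix m assume "m \<in> Poly_Mapping.keys p"
    with p have "m \<noteq> 0" by (auto simp: in_keys_iff)
    then obtain v where v: "Poly_Mapping.lookup m v \<noteq> 0"
      by (metis lookup_zero poly_mapping_eqI)
    have "m = (m - Poly_Mapping.single v 1) + Poly_Mapping.single v 1"
      using v by (intro poly_mapping_eqI) (auto simp: lookup_add lookup_minus lookup_single when_def)
    hence "Poly_Mapping.single m 1 = Poly_Mapping.single (m - Poly_Mapping.single v 1) 1 * (variable v :: ('v, 'k) mpolynomial)"
      by (metis mult_1 mult_single variable_def)
    thus "Poly_Mapping.single m 1 \<in> ring_module.span (range variable :: ('v, 'k) mpolynomial set)"
      by (metis ring_module.span_base ring_module.span_scale rangeI)
  qed (rule ring_module.subspace_span)
qed

definition component :: "int \<Rightarrow> ('v, 'k::comm_ring_1) mpolynomial \<Rightarrow> ('v, 'k) mpolynomial" where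
  "component d p = Poly_Mapping.Abs_poly_mapping (\<lambda>m. Poly_Mapping.lookup p m when int (monomial_degree m) = d)"

lemma lookup_component:
  "Poly_Mapping.lookup (component d p) m = (Poly_Mapping.lookup p m when int (monomial_degree m) = d)"
proof -
  have "finite {m. (Poly_Mapping.lookup p m when int (monomial_degree m) = d) \<noteq> 0}"
    by (rule finite_subset[OF _ finite_lookup[of p]]) auto
  thus ?thesis by (simp add: component_def)
qed

lemma keys_component: "Poly_Mapping.keys (component d p) = {m \<in> Poly_Mapping.keys p. int (monomial_degree m) = d}"
  by (auto simp: in_keys_iff lookup_component)

lemma homogeneous_component [simp]: "homogeneous d (component d p)"
  by (simp add: homogeneous_def keys_component)

lemma component_0 [simp]: "component d 0 = 0"
  by (rule poly_mapping_eqI) (simp add: lookup_component)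

lemma component_add: "component d (p + q) = component d p + component d q"
  by (rule poly_mapping_eqI) (simp add: lookup_component lookup_add when_def)

lemma component_diff: "component d (p - q) = component d p - component d q"
  by (rule poly_mapping_eqI) (simp add: lookup_component lookup_minus when_def)

lemma component_sum: "component d (\<Sum>k\<in>A. f k) = (\<Sum>k\<in>A. component d (f k))"
  by (induction A rule: infinite_finite_induct) (auto simp: component_add)

lemma component_homogeneous: "homogeneous d' p \<Longrightarrow> component d p = (if d = d' then p else 0)"
  by (rule poly_mapping_eqI) (auto simp: lookup_component homogeneous_def when_def in_keys_iff)

text \<open>Multiplication by a homogeneous element shifts degrees; this is the reason why graded maps commute
  with taking homogeneous components.\<close>

lemma component_mult:
  fixes p q :: "('v::finite, 'k::comm_ring_1) mpolynomial"
  assumes q: "homogeneous s q"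
  shows "component d (p * q) = component (d - s) p * q"
proof -
  let ?t = "\<lambda>m. Poly_Mapping.single m (Poly_Mapping.lookup p m)"
  have 1: "component d (?t m * q) = component (d - s) (?t m) * q" for m
  proof -
    have h: "homogeneous (int (monomial_degree m)) (?t m)"
      by (simp add: homogeneous_def)
    show ?thesis
      using component_homogeneous[OF h, of "d - s"] component_homogeneous[OF homogeneous_mult[OF h q], of d]
      by auto
  qed
  have "component d ((\<Sum>m\<in>Poly_Mapping.keys p. ?t m) * q) = component (d - s) (\<Sum>m\<in>Poly_Mapping.keys p. ?t m) * q"
    by (simp add: sum_distrib_right component_sum 1)
  thus ?thesis using poly_mapping_sum_single[of p] by simp
qed

section \<open>Graded linear maps between free modules\<close>

text \<open>The free module on a finite subset \<open>B\<close> of a type of labels consists of the functions that vanish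
  outside \<open>B\<close>. Linear maps are defined on all functions, so that composing, restricting and extending
  them needs no bookkeeping of ranks, and deleting a basis element merely shrinks \<open>B\<close>.\<close>

definition free_module :: "'b set \<Rightarrow> ('b \<Rightarrow> 'r::zero) set" where
  "free_module B = {x. \<forall>l. l \<notin> B \<longrightarrow> x l = 0}"

definition scale :: "'r \<Rightarrow> ('b \<Rightarrow> 'r) \<Rightarrow> 'b \<Rightarrow> 'r::comm_ring_1" where
  "scale c x = (\<lambda>l. c * x l)"

definition basis_vector :: "'b \<Rightarrow> 'b \<Rightarrow> 'r::comm_ring_1" where
  "basis_vector k = (\<lambda>l. if l = k then 1 else 0)"

definition linear_map :: "(('b \<Rightarrow> 'r::comm_ring_1) \<Rightarrow> ('c \<Rightarrow> 'r)) \<Rightarrow> bool" where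
  "linear_map L \<longleftrightarrow> (\<forall>x y. L (x + y) = L x + L y) \<and> (\<forall>c x. L (scale c x) = scale c (L x))"

definition extend_map :: "'b set \<Rightarrow> ('b \<Rightarrow> 'c \<Rightarrow> 'r) \<Rightarrow> ('b \<Rightarrow> 'r) \<Rightarrow> 'c \<Rightarrow> 'r::comm_ring_1" where
  "extend_map B M x = (\<Sum>k\<in>B. scale (x k) (M k))"

lemma scale_apply [simp]: "scale c x l = c * x l"
  by (simp add: scale_def)

lemma sum_fun_apply: "(\<Sum>k\<in>A. f k) l = (\<Sum>k\<in>A. f k l)"
  by (induction A rule: infinite_finite_induct) auto

lemma linear_map_add: "linear_map L \<Longrightarrow> L (x + y) = L x + L y"
  and linear_map_scale: "linear_map L \<Longrightarrow> L (scale c x) = scale c (L x)"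
  by (auto simp: linear_map_def)

lemma linear_map_0: "linear_map L \<Longrightarrow> L 0 = 0"
proof -
  have "scale 0 (0 :: 'a \<Rightarrow> 'b) = 0" "scale 0 (L 0) = 0" by (rule ext, simp)+
  thus "linear_map L \<Longrightarrow> L 0 = 0" by (metis linear_map_scale)
qed

lemma linear_map_uminus: "linear_map L \<Longrightarrow> L (- x) = - L x"
proof -
  have "- x = scale (- 1) x" "- L x = scale (- 1) (L x)" by (rule ext, simp)+
  thus "linear_map L \<Longrightarrow> L (- x) = - L x" by (metis linear_map_scale)
qed

lemma linear_map_diff: "linear_map L \<Longrightarrow> L (x - y) = L x - L y"
  using linear_map_add[of L x "- y"] linear_map_uminus[of L y] by (metis add_uminus_conv_diff)

lemma linear_map_sum: "linear_map L \<Longrightarrow> L (\<Sum>k\<in>A. f k) = (\<Sum>k\<in>A. L (f k))"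
  by (induction A rule: infinite_finite_induct)
     (simp_all add: linear_map_0[of L] linear_map_add[of L])

lemma free_module_0 [simp]: "0 \<in> free_module B"
  and free_module_add: "x \<in> free_module B \<Longrightarrow> y \<in> free_module B \<Longrightarrow> x + y \<in> free_module B"
  and free_module_diff: "x \<in> free_module B \<Longrightarrow> y \<in> free_module B \<Longrightarrow> x - y \<in> free_module B"
  and free_module_uminus: "x \<in> free_module B \<Longrightarrow> - x \<in> free_module B"
  for x y :: "'b \<Rightarrow> 'r::ab_group_add"
  by (auto simp: free_module_def)

lemma free_module_scale: "x \<in> free_module B \<Longrightarrow> scale c x \<in> free_module B"
  by (auto simp: free_module_def)

lemma free_module_sum: "(\<And>k. k \<in> A \<Longrightarrow> f k \<in> free_module B) \<Longrightarrow> (\<Sum>k\<in>A. f k) \<in> free_module B"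
  for f :: "'a \<Rightarrow> 'b \<Rightarrow> 'r::ab_group_add"
  by (induction A rule: infinite_finite_induct) (auto intro: free_module_add)

lemma basis_vector_in: "k \<in> B \<Longrightarrow> basis_vector k \<in> free_module B"
  by (auto simp: free_module_def basis_vector_def)

lemma free_module_mono: "B \<subseteq> C \<Longrightarrow> free_module B \<subseteq> free_module C"
  by (auto simp: free_module_def)

lemma free_module_expand:
  assumes "finite B" and "x \<in> free_module B"
  shows "x = (\<Sum>k\<in>B. scale (x k) (basis_vector k))"
proof
  fix l
  have "(\<Sum>k\<in>B. scale (x k) (basis_vector k)) l = (\<Sum>k\<in>B. if k = l then x l else 0)"
    unfolding sum_fun_apply by (rule sum.cong) (auto simp: basis_vector_def)
  thus "x l = (\<Sum>k\<in>B. scale (x k) (basis_vector k)) l"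
    using assms by (auto simp: sum.delta free_module_def)
qed

lemma linear_map_expand:
  assumes "linear_map L" and "finite B" and "x \<in> free_module B"
  shows "L x = (\<Sum>k\<in>B. scale (x k) (L (basis_vector k)))"
proof -
  have "L x = L (\<Sum>k\<in>B. scale (x k) (basis_vector k))"
    using free_module_expand[OF assms(2,3)] by simp
  thus ?thesis by (simp add: linear_map_sum[OF assms(1)] linear_map_scale[OF assms(1)])
qed

lemma linear_mapI:
  assumes "\<And>x y l. L (x + y) l = L x l + L y l" and "\<And>c x l. L (scale c x) l = c * L x l"
  shows "linear_map L"
proof -
  have "L (x + y) = L x + L y" for x y by (rule ext) (simp add: assms(1))
  moreover have "L (scale c x) = scale c (L x)" for c x by (rule ext) (simp add: assms(2))
  ultimately show ?thesis by (simp add: linear_map_def)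
qed

lemma extend_map_apply: "extend_map B M x l = (\<Sum>k\<in>B. x k * M k l)"
  by (simp only: extend_map_def sum_fun_apply scale_apply)

lemma linear_map_extend_map: "linear_map (extend_map B M)"
proof (rule linear_mapI)
  fix x y :: "'a \<Rightarrow> 'b" and c l
  show "extend_map B M (x + y) l = extend_map B M x l + extend_map B M y l"
    by (simp only: extend_map_apply plus_fun_apply distrib_right sum.distrib)
  show "extend_map B M (scale c x) l = c * extend_map B M x l"
    by (simp only: extend_map_apply scale_apply sum_distrib_left mult.assoc)
qed

lemma extend_map_unit:
  assumes "finite B" "k \<in> B"
  shows "extend_map B M (basis_vector k) = M k"
proof
  fix l
  have "extend_map B M (basis_vector k) l = (\<Sum>j\<in>B. if j = k then M k l else 0)"
    unfolding extend_map_def sum_fun_apply by (rule sum.cong) (auto simp: basis_vector_def)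
  thus "extend_map B M (basis_vector k) l = M k l" using assms by (simp add: sum.delta)
qed

lemma linear_map_id: "linear_map (\<lambda>x. x)"
  by (simp add: linear_map_def)

lemma linear_map_zero: "linear_map (\<lambda>x. 0)"
  by (rule linear_mapI) simp_all

lemma linear_map_comp: "linear_map L \<Longrightarrow> linear_map M \<Longrightarrow> linear_map (\<lambda>x. L (M x))"
  by (simp add: linear_map_def)

lemma linear_map_minus: "linear_map L \<Longrightarrow> linear_map M \<Longrightarrow> linear_map (\<lambda>x. L x - M x)"
  by (rule linear_mapI) (simp_all add: linear_map_def right_diff_distrib)

lemma linear_map_plus: "linear_map L \<Longrightarrow> linear_map M \<Longrightarrow> linear_map (\<lambda>x. L x + M x)"
  by (rule linear_mapI) (simp_all add: linear_map_def distrib_left)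

lemma linear_map_scaled: "linear_map L \<Longrightarrow> linear_map (\<lambda>x. scale c (L x))"
  by (rule linear_mapI) (simp_all add: linear_map_def distrib_left mult.left_commute)

text \<open>With \<open>e l\<close> as the degree of the basis element \<open>l\<close>, a vector of degree \<open>d\<close> has its \<open>l\<close>-th
  coordinate in degree \<open>d - e l\<close>.\<close>

definition homogeneous_vector :: "('b \<Rightarrow> int) \<Rightarrow> int \<Rightarrow> ('b \<Rightarrow> ('v, 'k::comm_ring_1) mpolynomial) \<Rightarrow> bool" where
  "homogeneous_vector e d x \<longleftrightarrow> (\<forall>l. homogeneous (d - e l) (x l))"

definition vector_component :: "('b \<Rightarrow> int) \<Rightarrow> int \<Rightarrow> ('b \<Rightarrow> ('v, 'k::comm_ring_1) mpolynomial) \<Rightarrow> 'b \<Rightarrow> ('v, 'k) mpolynomial" where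
  "vector_component e d x = (\<lambda>l. component (d - e l) (x l))"

definition graded_map :: "'b set \<Rightarrow> ('b \<Rightarrow> int) \<Rightarrow> 'c set \<Rightarrow> ('c \<Rightarrow> int) \<Rightarrow>
    (('b \<Rightarrow> ('v, 'k::comm_ring_1) mpolynomial) \<Rightarrow> ('c \<Rightarrow> ('v, 'k) mpolynomial)) \<Rightarrow> bool" where
  "graded_map B e C e' L \<longleftrightarrow> linear_map L \<and> (\<forall>x\<in>free_module B. L x \<in> free_module C) \<and>
     (\<forall>d. \<forall>x\<in>free_module B. homogeneous_vector e d x \<longrightarrow> homogeneous_vector e' d (L x))"

definition graded_submodule :: "('b \<Rightarrow> int) \<Rightarrow> ('b \<Rightarrow> ('v, 'k::comm_ring_1) mpolynomial) set \<Rightarrow> bool" where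
  "graded_submodule e N \<longleftrightarrow> 0 \<in> N \<and> (\<forall>x\<in>N. \<forall>y\<in>N. x + y \<in> N) \<and> (\<forall>c. \<forall>x\<in>N. scale c x \<in> N) \<and>
     (\<forall>d. \<forall>x\<in>N. vector_component e d x \<in> N)"

lemma graded_mapD:
  assumes "graded_map B e C e' L"
  shows "linear_map L" "x \<in> free_module B \<Longrightarrow> L x \<in> free_module C"
    "x \<in> free_module B \<Longrightarrow> homogeneous_vector e d x \<Longrightarrow> homogeneous_vector e' d (L x)"
  using assms by (auto simp: graded_map_def)

lemma graded_submodule_0: "graded_submodule e N \<Longrightarrow> 0 \<in> N"
  and graded_submodule_add: "graded_submodule e N \<Longrightarrow> x \<in> N \<Longrightarrow> y \<in> N \<Longrightarrow> x + y \<in> N"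
  and graded_submodule_scale: "graded_submodule e N \<Longrightarrow> x \<in> N \<Longrightarrow> scale c x \<in> N"
  and graded_submodule_vector_component: "graded_submodule e N \<Longrightarrow> x \<in> N \<Longrightarrow> vector_component e d x \<in> N"
  by (auto simp: graded_submodule_def)

lemma graded_submodule_uminus: "graded_submodule e N \<Longrightarrow> x \<in> N \<Longrightarrow> - x \<in> N"
proof -
  assume N: "graded_submodule e N" "x \<in> N"
  have "- x = scale (- 1) x" by (auto simp: fun_eq_iff)
  thus "- x \<in> N" using N graded_submodule_scale by metis
qed

lemma graded_submodule_diff: "graded_submodule e N \<Longrightarrow> x \<in> N \<Longrightarrow> y \<in> N \<Longrightarrow> x - y \<in> N"
  using graded_submodule_add[of e N x "- y"] graded_submodule_uminus[of e N y] by simp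

lemma graded_submodule_sum:
  "graded_submodule e N \<Longrightarrow> (\<And>k. k \<in> A \<Longrightarrow> f k \<in> N) \<Longrightarrow> (\<Sum>k\<in>A. f k) \<in> N"
  by (induction A rule: infinite_finite_induct) (auto intro: graded_submodule_add graded_submodule_0)

lemma graded_submodule_zero: "graded_submodule e {0}"
  by (auto simp: graded_submodule_def vector_component_def fun_eq_iff)

lemma homogeneous_vector_unit: "homogeneous_vector e (e k) (basis_vector k)"
  by (auto simp: homogeneous_vector_def basis_vector_def)

lemma homogeneous_vector_vector_component: "homogeneous_vector e d (vector_component e d x)"
  by (simp add: homogeneous_vector_def vector_component_def)

lemma vector_component_homogeneous_vector: "homogeneous_vector e d x \<Longrightarrow> vector_component e d x = x"
  unfolding homogeneous_vector_def vector_component_def by (rule ext) (metis component_homogeneous)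

lemma vector_component_diff: "vector_component e d (x - y) = vector_component e d x - vector_component e d y"
  by (auto simp: vector_component_def fun_eq_iff component_diff)

lemma free_module_vector_component: "x \<in> free_module B \<Longrightarrow> vector_component e d x \<in> free_module B"
  by (auto simp: free_module_def vector_component_def)

lemma homogeneous_vector_0 [simp]: "homogeneous_vector e d 0"
  by (simp add: homogeneous_vector_def)

lemma homogeneous_vector_add: "homogeneous_vector e d x \<Longrightarrow> homogeneous_vector e d y \<Longrightarrow> homogeneous_vector e d (x + y)"
  and homogeneous_vector_diff: "homogeneous_vector e d x \<Longrightarrow> homogeneous_vector e d y \<Longrightarrow> homogeneous_vector e d (x - y)"
  and homogeneous_vector_uminus: "homogeneous_vector e d x \<Longrightarrow> homogeneous_vector e d (- x)"
  by (auto simp: homogeneous_vector_def intro: homogeneous_add homogeneous_diff homogeneous_uminus)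

lemma homogeneous_vector_scale:
  fixes x :: "'b \<Rightarrow> ('v::finite, 'k::comm_ring_1) mpolynomial"
  assumes "homogeneous d c" and "homogeneous_vector e d' x" and "d'' = d + d'"
  shows "homogeneous_vector e d'' (scale c x)"
  using assms unfolding homogeneous_vector_def scale_def
  by (metis add_diff_eq homogeneous_mult)

lemma homogeneous_vector_sum: "(\<And>k. k \<in> A \<Longrightarrow> homogeneous_vector e d (f k)) \<Longrightarrow> homogeneous_vector e d (\<Sum>k\<in>A. f k)"
  by (induction A rule: infinite_finite_induct) (auto intro: homogeneous_vector_add)

lemma graded_map_extend_map:
  fixes M :: "'b \<Rightarrow> 'c \<Rightarrow> ('v::finite, 'k::comm_ring_1) mpolynomial"
  assumes "\<And>k. k \<in> B \<Longrightarrow> M k \<in> free_module C" and "\<And>k. k \<in> B \<Longrightarrow> homogeneous_vector e' (e k) (M k)"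
  shows "graded_map B e C e' (extend_map B M)"
  unfolding graded_map_def
proof (intro conjI allI ballI impI)
  fix x :: "'b \<Rightarrow> ('v, 'k) mpolynomial" and d
  show "extend_map B M x \<in> free_module C"
    unfolding extend_map_def by (intro free_module_sum free_module_scale assms)
  show "homogeneous_vector e' d (extend_map B M x)" if "homogeneous_vector e d x"
    unfolding extend_map_def
  proof (rule homogeneous_vector_sum)
    fix k assume "k \<in> B"
    show "homogeneous_vector e' d (scale (x k) (M k))"
      by (rule homogeneous_vector_scale[of "d - e k" _ _ "e k"]) (use that assms(2)[OF \<open>k \<in> B\<close>] in \<open>auto simp: homogeneous_vector_def\<close>)
  qed
qed (rule linear_map_extend_map)

lemma graded_map_comp:
  "graded_map B e C e' L \<Longrightarrow> graded_map C e' E e'' M \<Longrightarrow> graded_map B e E e'' (\<lambda>x. M (L x))"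
  by (auto simp: graded_map_def linear_map_comp)

lemma graded_map_minus:
  "graded_map B e C e' L \<Longrightarrow> graded_map B e C e' M \<Longrightarrow> graded_map B e C e' (\<lambda>x. L x - M x)"
  by (auto simp: graded_map_def linear_map_minus free_module_diff homogeneous_vector_diff)

lemma graded_map_id: "graded_map B e B e (\<lambda>x. x)"
  by (auto simp: graded_map_def linear_map_id)

lemma graded_map_zero: "graded_map B e C e' (\<lambda>x. 0)"
  by (auto simp: graded_map_def linear_map_zero)

lemma graded_map_vector_component:
  fixes L :: "('b \<Rightarrow> ('v::finite, 'k::comm_ring_1) mpolynomial) \<Rightarrow> ('c \<Rightarrow> ('v, 'k) mpolynomial)"
  assumes L: "graded_map B e C e' L" and B: "finite B" and x: "x \<in> free_module B"
  shows "L (vector_component e d x) = vector_component e' d (L x)"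
proof
  fix l
  have h: "homogeneous (e k - e' l) (L (basis_vector k) l)" if "k \<in> B" for k
    using graded_mapD(3)[OF L basis_vector_in[OF that] homogeneous_vector_unit[of e k]] by (simp add: homogeneous_vector_def)
  have 1: "L (vector_component e d x) = (\<Sum>k\<in>B. scale (vector_component e d x k) (L (basis_vector k)))"
    by (rule linear_map_expand[OF graded_mapD(1)[OF L] B free_module_vector_component[OF x]])
  have 2: "L x = (\<Sum>k\<in>B. scale (x k) (L (basis_vector k)))"
    by (rule linear_map_expand[OF graded_mapD(1)[OF L] B x])
  show "L (vector_component e d x) l = vector_component e' d (L x) l"
    unfolding 1 unfolding 2 vector_component_def
    by (simp add: sum_fun_apply component_sum component_mult[OF h] cong: sum.cong)
qed

section \<open>Resolutions and their comparison\<close>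

text \<open>A resolution of a module \<open>M = F\<^sub>0 / N\<close> is treated as a sequence \<open>\<dots> \<rightarrow> F\<^sub>2 \<rightarrow> F\<^sub>1 \<rightarrow> F\<^sub>0\<close> that is exact up to
  the submodule \<open>N\<close> at stage \<open>0\<close>: every vector of \<open>F\<^sub>0\<close> counts as a cycle, and vectors of \<open>N\<close> count as
  zero there. In this way the augmentation obeys the same rules as the other maps, and the steps of the
  usual resolution of \<open>R / I\<close> are the stages from \<open>1\<close> on, with \<open>F\<^sub>0 = R\<close> and \<open>N = I\<close>. The submodule
  below is the one counting as zero at stage \<open>i\<close>.\<close>

definition null_vectors :: "('b \<Rightarrow> 'r::zero) set \<Rightarrow> nat \<Rightarrow> ('b \<Rightarrow> 'r) set" where
  "null_vectors N i = (if i = 0 then N else {0})"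

definition cycles :: "(nat \<Rightarrow> 'b set) \<Rightarrow> ('b \<Rightarrow> 'r::zero) set \<Rightarrow> (nat \<Rightarrow> ('b \<Rightarrow> 'r) \<Rightarrow> 'b \<Rightarrow> 'r) \<Rightarrow> nat \<Rightarrow> ('b \<Rightarrow> 'r) set" where
  "cycles B N D i = {y \<in> free_module (B i). \<forall>j. i = Suc j \<longrightarrow> D j y \<in> null_vectors N j}"

definition resolution :: "(nat \<Rightarrow> 'b set) \<Rightarrow> (nat \<Rightarrow> 'b \<Rightarrow> int) \<Rightarrow> ('b \<Rightarrow> ('v, 'k::comm_ring_1) mpolynomial) set \<Rightarrow>
    (nat \<Rightarrow> ('b \<Rightarrow> ('v, 'k) mpolynomial) \<Rightarrow> 'b \<Rightarrow> ('v, 'k) mpolynomial) \<Rightarrow> bool" where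
  "resolution B e N D \<longleftrightarrow> (\<forall>i. finite (B i)) \<and> graded_submodule (e 0) N \<and>
     (\<forall>i. graded_map (B (Suc i)) (e (Suc i)) (B i) (e i) (D i)) \<and>
     (\<forall>i. \<forall>x\<in>free_module (B (Suc i)). D i x \<in> cycles B N D i) \<and>
     (\<forall>i. \<forall>y\<in>cycles B N D i. \<exists>x\<in>free_module (B (Suc i)). y - D i x \<in> null_vectors N i)"

lemma resolutionD:
  assumes "resolution B e N D"
  shows "finite (B i)" "graded_submodule (e 0) N"
    "graded_map (B (Suc i)) (e (Suc i)) (B i) (e i) (D i)"
    "x \<in> free_module (B (Suc i)) \<Longrightarrow> D i x \<in> cycles B N D i"
    "y \<in> cycles B N D i \<Longrightarrow> \<exists>x\<in>free_module (B (Suc i)). y - D i x \<in> null_vectors N i"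
  using assms by (auto simp: resolution_def)

lemma graded_submodule_null_vectors: "resolution B e N D \<Longrightarrow> graded_submodule (e i) (null_vectors N i)"
  by (auto simp: null_vectors_def graded_submodule_zero resolutionD(2))

text \<open>Free modules are projective, in the graded sense: choose a preimage of each basis element and
  replace it by its component of the right degree.\<close>

lemma lift_graded_map:
  fixes g :: "('a \<Rightarrow> ('v::finite, 'k::comm_ring_1) mpolynomial) \<Rightarrow> ('b \<Rightarrow> ('v, 'k) mpolynomial)"
  assumes res: "resolution B e N D" and P: "finite P" and g: "graded_map P p (B i) (e i) g"
    and cyc: "\<And>x. x \<in> free_module P \<Longrightarrow> g x \<in> cycles B N D i"
  shows "\<exists>h. graded_map P p (B (Suc i)) (e (Suc i)) h \<and> (\<forall>x\<in>free_module P. g x - D i (h x) \<in> null_vectors N i)"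
proof -
  note sub = graded_submodule_null_vectors[OF res, of i]
  note D = resolutionD(3)[OF res, of i]
  have "\<exists>y. y \<in> free_module (B (Suc i)) \<and> homogeneous_vector (e (Suc i)) (p k) y \<and> g (basis_vector k) - D i y \<in> null_vectors N i"
    if k: "k \<in> P" for k
  proof -
    obtain x where x: "x \<in> free_module (B (Suc i))" "g (basis_vector k) - D i x \<in> null_vectors N i"
      using resolutionD(5)[OF res cyc[OF basis_vector_in[OF k]]] by blast
    have "homogeneous_vector (e i) (p k) (g (basis_vector k))"
      by (rule graded_mapD(3)[OF g basis_vector_in[OF k] homogeneous_vector_unit])
    hence "vector_component (e i) (p k) (g (basis_vector k) - D i x) = g (basis_vector k) - D i (vector_component (e (Suc i)) (p k) x)"
      by (simp add: vector_component_diff vector_component_homogeneous_vector graded_map_vector_component[OF D resolutionD(1)[OF res] x(1)])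
    thus ?thesis
      using graded_submodule_vector_component[OF sub x(2), of "p k"] free_module_vector_component[OF x(1)] homogeneous_vector_vector_component by metis
  qed
  then obtain M where M: "\<And>k. k \<in> P \<Longrightarrow> M k \<in> free_module (B (Suc i))"
    "\<And>k. k \<in> P \<Longrightarrow> homogeneous_vector (e (Suc i)) (p k) (M k)"
    "\<And>k. k \<in> P \<Longrightarrow> g (basis_vector k) - D i (M k) \<in> null_vectors N i"
    by metis
  let ?h = "extend_map P M"
  have h: "graded_map P p (B (Suc i)) (e (Suc i)) ?h"
    using M by (intro graded_map_extend_map)
  have "g x - D i (?h x) \<in> null_vectors N i" if x: "x \<in> free_module P" for x
  proof -
    have lin: "linear_map (\<lambda>x. g x - D i (?h x))"
      by (rule linear_map_minus[OF graded_mapD(1)[OF g] linear_map_comp[OF graded_mapD(1)[OF D] linear_map_extend_map]])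
    show ?thesis
      unfolding linear_map_expand[OF lin P x]
      by (intro graded_submodule_sum[OF sub] graded_submodule_scale[OF sub])
         (simp add: extend_map_unit[OF P] M)
  qed
  with h show ?thesis by blast
qed

text \<open>A map of the presented modules lifts to a chain map. The invariants of the construction are that
  the map built so far preserves cycles and vectors counting as zero, which is what the next lift
  requires.\<close>

lemma comparison_map:
  fixes D :: "nat \<Rightarrow> ('b \<Rightarrow> ('v::finite, 'k::comm_ring_1) mpolynomial) \<Rightarrow> 'b \<Rightarrow> ('v, 'k) mpolynomial"
    and D' :: "nat \<Rightarrow> ('c \<Rightarrow> ('v, 'k) mpolynomial) \<Rightarrow> 'c \<Rightarrow> ('v, 'k) mpolynomial"
  assumes res: "resolution B e N D" and res': "resolution B' e' N' D'"
    and f: "graded_map (B 0) (e 0) (B' 0) (e' 0) f" "f ` N \<subseteq> N'"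
  shows "\<exists>\<phi>. \<phi> 0 = f \<and> (\<forall>i. graded_map (B i) (e i) (B' i) (e' i) (\<phi> i)) \<and>
    (\<forall>i. \<forall>x\<in>free_module (B (Suc i)). \<phi> i (D i x) - D' i (\<phi> (Suc i) x) \<in> null_vectors N' i)"
proof -
  define P where "P i \<phi> \<longleftrightarrow> graded_map (B i) (e i) (B' i) (e' i) \<phi> \<and> \<phi> ` null_vectors N i \<subseteq> null_vectors N' i \<and>
    \<phi> ` cycles B N D i \<subseteq> cycles B' N' D' i \<and> (i = 0 \<longrightarrow> \<phi> = f)" for i and \<phi> :: "('b \<Rightarrow> ('v, 'k) mpolynomial) \<Rightarrow> 'c \<Rightarrow> ('v, 'k) mpolynomial"
  define Q where "Q i \<phi> \<psi> \<longleftrightarrow> (\<forall>x\<in>free_module (B (Suc i)). \<phi> (D i x) - D' i (\<psi> x) \<in> null_vectors N' i)"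
    for i :: nat and \<phi> \<psi> :: "('b \<Rightarrow> ('v, 'k) mpolynomial) \<Rightarrow> 'c \<Rightarrow> ('v, 'k) mpolynomial"
  have P0: "P 0 f"
    using f by (auto simp: P_def null_vectors_def cycles_def graded_map_def)
  have step: "\<exists>\<psi>. P (Suc i) \<psi> \<and> Q i \<phi> \<psi>" if "P i \<phi>" for i \<phi>
  proof -
    from that have \<phi>: "graded_map (B i) (e i) (B' i) (e' i) \<phi>" "\<phi> ` null_vectors N i \<subseteq> null_vectors N' i"
      "\<phi> ` cycles B N D i \<subseteq> cycles B' N' D' i"
      by (auto simp: P_def)
    obtain \<psi> where \<psi>: "graded_map (B (Suc i)) (e (Suc i)) (B' (Suc i)) (e' (Suc i)) \<psi>"
      "\<And>x. x \<in> free_module (B (Suc i)) \<Longrightarrow> \<phi> (D i x) - D' i (\<psi> x) \<in> null_vectors N' i"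
      using lift_graded_map[OF res' resolutionD(1)[OF res] graded_map_comp[OF resolutionD(3)[OF res] \<phi>(1)]]
        resolutionD(4)[OF res] \<phi>(3) by blast
    have "\<psi> y \<in> cycles B' N' D' (Suc i)" if y: "y \<in> cycles B N D (Suc i)" for y
    proof -
      have y': "y \<in> free_module (B (Suc i))" "D i y \<in> null_vectors N i" using y by (auto simp: cycles_def)
      have "\<phi> (D i y) - (\<phi> (D i y) - D' i (\<psi> y)) \<in> null_vectors N' i"
        using y' \<phi>(2) \<psi>(2) by (blast intro: graded_submodule_diff[OF graded_submodule_null_vectors[OF res']])
      thus ?thesis using graded_mapD(2)[OF \<psi>(1) y'(1)] by (simp add: cycles_def)
    qed
    moreover have "\<psi> ` null_vectors N (Suc i) \<subseteq> null_vectors N' (Suc i)"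
      using linear_map_0[OF graded_mapD(1)[OF \<psi>(1)]] by (auto simp: null_vectors_def)
    ultimately show ?thesis using \<psi> by (auto simp: P_def Q_def)
  qed
  obtain \<phi> where \<phi>: "\<forall>i. P i (\<phi> i) \<and> Q i (\<phi> i) (\<phi> (Suc i))"
    using dependent_nat_choice[of P Q] P0 step by metis
  show ?thesis
    by (rule exI[of _ \<phi>]) (use \<phi> in \<open>simp add: P_def Q_def\<close>)
qed

text \<open>A chain map that lifts the identity is homotopic to the identity. The homotopy starts with \<open>0\<close>,
  since \<open>\<theta> 0\<close> is the identity on the nose.\<close>

lemma null_homotopy:
  fixes D :: "nat \<Rightarrow> ('b \<Rightarrow> ('v::finite, 'k::comm_ring_1) mpolynomial) \<Rightarrow> 'b \<Rightarrow> ('v, 'k) mpolynomial"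
  assumes res: "resolution B e N D"
    and \<theta>: "\<And>i. graded_map (B i) (e i) (B i) (e i) (\<theta> i)" "\<And>x. x \<in> free_module (B 0) \<Longrightarrow> \<theta> 0 x = x"
    and comm: "\<And>i x. x \<in> free_module (B (Suc i)) \<Longrightarrow> \<theta> i (D i x) - D i (\<theta> (Suc i) x) \<in> null_vectors N i"
  shows "\<exists>h. h 0 = (\<lambda>x. 0) \<and> (\<forall>i. graded_map (B i) (e i) (B (Suc i)) (e (Suc i)) (h i)) \<and>
    (\<forall>i. \<forall>x\<in>free_module (B (Suc i)). x - \<theta> (Suc i) x - h i (D i x) = D (Suc i) (h (Suc i) x))"
proof -
  define P where "P i h \<longleftrightarrow> graded_map (B i) (e i) (B (Suc i)) (e (Suc i)) h \<and> (i = 0 \<longrightarrow> h = (\<lambda>x. 0)) \<and>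
     (\<forall>x\<in>free_module (B (Suc i)). D i (x - \<theta> (Suc i) x - h (D i x)) \<in> null_vectors N i)"
    for i and h :: "('b \<Rightarrow> ('v, 'k) mpolynomial) \<Rightarrow> 'b \<Rightarrow> ('v, 'k) mpolynomial"
  define Q where "Q i h h' \<longleftrightarrow> (\<forall>x\<in>free_module (B (Suc i)). x - \<theta> (Suc i) x - h (D i x) = D (Suc i) (h' x))"
    for i and h h' :: "('b \<Rightarrow> ('v, 'k) mpolynomial) \<Rightarrow> 'b \<Rightarrow> ('v, 'k) mpolynomial"
  have lin: "linear_map (D i)" "linear_map (\<theta> i)" for i
    using resolutionD(3)[OF res] \<theta>(1) by (auto simp: graded_map_def)
  have Dfv: "D i x \<in> free_module (B i)" if "x \<in> free_module (B (Suc i))" for i x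
    using resolutionD(3)[OF res] that by (auto simp: graded_map_def)
  have "D 0 x - D 0 (\<theta> (Suc 0) x) \<in> N" if "x \<in> free_module (B (Suc 0))" for x
    using comm[OF that] \<theta>(2)[OF Dfv[OF that]] by (simp add: null_vectors_def)
  hence P0: "P 0 (\<lambda>x. 0)"
    by (auto simp: P_def graded_map_zero null_vectors_def linear_map_diff[OF lin(1)] linear_map_0[OF lin(1)])
  have step: "\<exists>h'. P (Suc i) h' \<and> Q i h h'" if "P i h" for i h
  proof -
    from that have h: "graded_map (B i) (e i) (B (Suc i)) (e (Suc i)) h" "i = 0 \<Longrightarrow> h = (\<lambda>x. 0)"
      "\<And>x. x \<in> free_module (B (Suc i)) \<Longrightarrow> D i (x - \<theta> (Suc i) x - h (D i x)) \<in> null_vectors N i"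
      by (auto simp: P_def)
    have g: "graded_map (B (Suc i)) (e (Suc i)) (B (Suc i)) (e (Suc i)) (\<lambda>x. x - \<theta> (Suc i) x - h (D i x))"
      by (rule graded_map_minus[OF graded_map_minus[OF graded_map_id \<theta>(1)] graded_map_comp[OF resolutionD(3)[OF res] h(1)]])
    have cyc: "x - \<theta> (Suc i) x - h (D i x) \<in> cycles B N D (Suc i)" if "x \<in> free_module (B (Suc i))" for x
      using h(3)[OF that] graded_mapD(2)[OF g that] by (simp add: cycles_def)
    obtain h' where h': "graded_map (B (Suc i)) (e (Suc i)) (B (Suc (Suc i))) (e (Suc (Suc i))) h'"
      "\<And>x. x \<in> free_module (B (Suc i)) \<Longrightarrow> x - \<theta> (Suc i) x - h (D i x) - D (Suc i) (h' x) \<in> null_vectors N (Suc i)"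
      using lift_graded_map[OF res resolutionD(1)[OF res] g cyc] by blast
    hence Q: "Q i h h'" by (auto simp: Q_def null_vectors_def)
    have "D (Suc i) (x - \<theta> (Suc (Suc i)) x - h' (D (Suc i) x)) \<in> null_vectors N (Suc i)"
      if x: "x \<in> free_module (B (Suc (Suc i)))" for x
    proof -
      let ?y = "D (Suc i) x"
      have y: "?y \<in> free_module (B (Suc i))" "D i ?y \<in> null_vectors N i"
        using resolutionD(4)[OF res x] by (auto simp: cycles_def)
      have "h (D i ?y) = 0"
        using h(2) y(2) linear_map_0[OF graded_mapD(1)[OF h(1)]] by (cases i) (auto simp: null_vectors_def)
      hence "D (Suc i) (h' ?y) = ?y - \<theta> (Suc i) ?y"
        using Q y(1) by (auto simp: Q_def)
      thus ?thesis using comm[OF x] by (simp add: linear_map_diff[OF lin(1)])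
    qed
    with h'(1) have "P (Suc i) h'" by (simp add: P_def)
    with Q show ?thesis by blast
  qed
  obtain h where h: "\<forall>i. P i (h i) \<and> Q i (h i) (h (Suc i))"
    using dependent_nat_choice[of P Q] P0 step by metis
  show ?thesis
    by (rule exI[of _ h]) (use h in \<open>simp add: P_def Q_def\<close>)
qed

text \<open>The entries of the map from stage \<open>1\<close> to stage \<open>0\<close> are exempt: that map is the augmentation.\<close>

definition minimal_complex :: "(nat \<Rightarrow> 'b set) \<Rightarrow> (nat \<Rightarrow> ('b \<Rightarrow> ('v, 'k::comm_ring_1) mpolynomial) \<Rightarrow> 'b \<Rightarrow> ('v, 'k) mpolynomial) \<Rightarrow> bool" where
  "minimal_complex B D \<longleftrightarrow> (\<forall>i. \<forall>k\<in>B (Suc (Suc i)). \<forall>l\<in>B (Suc i). const_coeff (D (Suc i) (basis_vector k) l) = 0)"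

text \<open>Hence a linear map preserves the vectors with all coordinates in the irrelevant ideal, and
  all values of a map with entries in that ideal are such vectors.\<close>

lemma const_coeff_linear_map:
  fixes L :: "('b \<Rightarrow> ('v::finite, 'k::comm_ring_1) mpolynomial) \<Rightarrow> 'c \<Rightarrow> ('v, 'k) mpolynomial"
  assumes "linear_map L" "finite B" "x \<in> free_module B" "const_coeff (L x m) \<noteq> 0"
  shows "\<exists>k\<in>B. const_coeff (x k) \<noteq> 0 \<and> const_coeff (L (basis_vector k) m) \<noteq> 0"
proof -
  have "const_coeff (L x m) = (\<Sum>k\<in>B. const_coeff (x k * L (basis_vector k) m))"
    using linear_map_expand[OF assms(1-3)] by (simp add: sum_fun_apply lookup_sum)
  with assms(4) obtain k where "k \<in> B" "const_coeff (x k * L (basis_vector k) m) \<noteq> 0"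
    by (metis (no_types, lifting) sum.neutral)
  thus ?thesis using const_coeff_mult_nonzero by blast
qed

text \<open>Let \<open>\<phi>\<close> and \<open>\<psi>\<close> lift \<open>f\<close> and \<open>g\<close>. The homotopy formula shows that \<open>\<psi> \<circ> \<phi>\<close> is the identity modulo the
  irrelevant ideal, because the maps of the minimal resolution above the augmentation vanish modulo that ideal. So the
  diagonal entry of \<open>\<psi> \<circ> \<phi>\<close> at \<open>k\<close> has constant coefficient \<open>1\<close>, and some \<open>l\<close> contributes to it
  through entries with nonzero constant coefficient; a homogeneous entry of this kind has degree \<open>0\<close>.\<close>

theorem minimal_degrees_subset:
  fixes D :: "nat \<Rightarrow> ('b \<Rightarrow> ('v::finite, 'k::comm_ring_1) mpolynomial) \<Rightarrow> 'b \<Rightarrow> ('v, 'k) mpolynomial"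
    and D' :: "nat \<Rightarrow> ('c \<Rightarrow> ('v, 'k) mpolynomial) \<Rightarrow> 'c \<Rightarrow> ('v, 'k) mpolynomial"
  assumes res: "resolution B e N D" and min: "minimal_complex B D" and res': "resolution B' e' N' D'"
    and f: "graded_map (B 0) (e 0) (B' 0) (e' 0) f" "f ` N \<subseteq> N'"
    and g: "graded_map (B' 0) (e' 0) (B 0) (e 0) g" "g ` N' \<subseteq> N"
    and gf: "\<And>x. x \<in> free_module (B 0) \<Longrightarrow> g (f x) = x"
    and k: "k \<in> B (Suc i)"
  shows "\<exists>l\<in>B' (Suc i). e' (Suc i) l = e (Suc i) k"
proof -
  obtain \<phi> where \<phi>: "\<phi> 0 = f" "\<And>i. graded_map (B i) (e i) (B' i) (e' i) (\<phi> i)"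
    "\<And>i x. x \<in> free_module (B (Suc i)) \<Longrightarrow> \<phi> i (D i x) - D' i (\<phi> (Suc i) x) \<in> null_vectors N' i"
    using comparison_map[OF res res' f] by blast
  obtain \<psi> where \<psi>: "\<psi> 0 = g" "\<And>i. graded_map (B' i) (e' i) (B i) (e i) (\<psi> i)"
    "\<And>i x. x \<in> free_module (B' (Suc i)) \<Longrightarrow> \<psi> i (D' i x) - D i (\<psi> (Suc i) x) \<in> null_vectors N i"
    using comparison_map[OF res' res g] by blast
  define \<theta> where "\<theta> i x = \<psi> i (\<phi> i x)" for i x
  have \<theta>: "graded_map (B i) (e i) (B i) (e i) (\<theta> i)" for i
    unfolding \<theta>_def by (rule graded_map_comp[OF \<phi>(2) \<psi>(2)])
  have comm: "\<theta> i (D i x) - D i (\<theta> (Suc i) x) \<in> null_vectors N i" if x: "x \<in> free_module (B (Suc i))" for i x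
  proof -
    have "\<psi> i (\<phi> i (D i x) - D' i (\<phi> (Suc i) x)) \<in> null_vectors N i"
    proof (cases i)
      case 0
      thus ?thesis using \<phi>(3)[OF x] g(2) \<psi>(1) by (auto simp: null_vectors_def)
    next
      case (Suc j)
      hence "\<phi> i (D i x) - D' i (\<phi> (Suc i) x) = 0" using \<phi>(3)[OF x] by (simp add: null_vectors_def)
      thus ?thesis using linear_map_0[OF graded_mapD(1)[OF \<psi>(2)[of i]]] Suc
        by (simp only: null_vectors_def) simp
    qed
    moreover have "\<psi> i (D' i (\<phi> (Suc i) x)) - D i (\<psi> (Suc i) (\<phi> (Suc i) x)) \<in> null_vectors N i"
      by (rule \<psi>(3)[OF graded_mapD(2)[OF \<phi>(2) x]])
    ultimately have "\<psi> i (\<phi> i (D i x) - D' i (\<phi> (Suc i) x)) +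
      (\<psi> i (D' i (\<phi> (Suc i) x)) - D i (\<psi> (Suc i) (\<phi> (Suc i) x))) \<in> null_vectors N i"
      by (rule graded_submodule_add[OF graded_submodule_null_vectors[OF res]])
    thus ?thesis by (simp only: \<theta>_def linear_map_diff[OF graded_mapD(1)[OF \<psi>(2)]]) simp
  qed
  have \<theta>0: "\<theta> 0 x = x" if "x \<in> free_module (B 0)" for x
    using gf[OF that] by (simp add: \<theta>_def \<phi>(1) \<psi>(1))
  obtain h where h: "h 0 = (\<lambda>x. 0)" "\<And>i. graded_map (B i) (e i) (B (Suc i)) (e (Suc i)) (h i)"
    "\<And>i x. x \<in> free_module (B (Suc i)) \<Longrightarrow> x - \<theta> (Suc i) x - h i (D i x) = D (Suc i) (h (Suc i) x)"
    using null_homotopy[OF res \<theta> \<theta>0 comm] by blast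
  have lin: "linear_map (D i)" for i by (rule graded_mapD(1)[OF resolutionD(3)[OF res]])
  let ?u = "basis_vector k :: 'b \<Rightarrow> ('v, 'k) mpolynomial"
  have u: "?u \<in> free_module (B (Suc i))" by (rule basis_vector_in[OF k])
  \<comment> \<open>Both error terms of the homotopy formula vanish modulo the irrelevant ideal. For \<open>i = 0\<close> the second
    one involves the augmentation, which may have unit entries, but \<open>h 0 = 0\<close>.\<close>
  have 1: "const_coeff (D (Suc i) (h (Suc i) ?u) k) = 0"
  proof (rule ccontr)
    assume a: "const_coeff (D (Suc i) (h (Suc i) ?u) k) \<noteq> 0"
    have "h (Suc i) ?u \<in> free_module (B (Suc (Suc i)))"
      by (rule graded_mapD(2)[OF h(2) u])
    then obtain m where "m \<in> B (Suc (Suc i))" "const_coeff (D (Suc i) (basis_vector m) k) \<noteq> 0"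
      using const_coeff_linear_map[of "D (Suc i)" "B (Suc (Suc i))" "h (Suc i) ?u" k] a lin
        resolutionD(1)[OF res] by blast
    thus False using min k unfolding minimal_complex_def by blast
  qed
  have 2: "const_coeff (h i (D i ?u) k) = 0"
  proof (rule ccontr)
    assume a: "const_coeff (h i (D i ?u) k) \<noteq> 0"
    have "D i ?u \<in> free_module (B i)"
      by (rule graded_mapD(2)[OF resolutionD(3)[OF res] u])
    then obtain m where m: "m \<in> B i" "const_coeff (D i ?u m) \<noteq> 0"
      using const_coeff_linear_map[of "h i" "B i" "D i ?u" k] a graded_mapD(1)[OF h(2)[of i]]
        resolutionD(1)[OF res] by blast
    have "i \<noteq> 0" using a h(1) by (cases "i = 0") simp_all
    then obtain j where "i = Suc j" by (cases i) simp_all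
    thus False using min k m unfolding minimal_complex_def by blast
  qed
  have "(?u - \<theta> (Suc i) ?u - h i (D i ?u)) k = D (Suc i) (h (Suc i) ?u) k"
    by (simp only: h(3)[OF u])
  hence "?u k - \<theta> (Suc i) ?u k - h i (D i ?u) k = D (Suc i) (h (Suc i) ?u) k"
    by (simp only: minus_apply)
  hence "const_coeff (?u k) - const_coeff (\<theta> (Suc i) ?u k) - const_coeff (h i (D i ?u) k)
      = const_coeff (D (Suc i) (h (Suc i) ?u) k)"
    by (simp only: lookup_minus [symmetric])
  moreover have "const_coeff (?u k) = 1" by (simp add: basis_vector_def)
  ultimately have "const_coeff (\<psi> (Suc i) (\<phi> (Suc i) ?u) k) \<noteq> 0"
    using 1 2 by (simp only: \<theta>_def) simp
  moreover have "\<phi> (Suc i) ?u \<in> free_module (B' (Suc i))"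
    by (rule graded_mapD(2)[OF \<phi>(2) u])
  ultimately obtain l where l: "l \<in> B' (Suc i)" "const_coeff (\<phi> (Suc i) ?u l) \<noteq> 0"
    using const_coeff_linear_map[of "\<psi> (Suc i)" "B' (Suc i)" "\<phi> (Suc i) ?u" k]
      graded_mapD(1)[OF \<psi>(2)[of "Suc i"]] resolutionD(1)[OF res'] by blast
  have "homogeneous_vector (e (Suc i)) (e (Suc i) k) ?u" by (rule homogeneous_vector_unit)
  hence "homogeneous_vector (e' (Suc i)) (e (Suc i) k) (\<phi> (Suc i) ?u)"
    by (rule graded_mapD(3)[OF \<phi>(2) u])
  hence "homogeneous (e (Suc i) k - e' (Suc i) l) (\<phi> (Suc i) ?u l)"
    by (simp only: homogeneous_vector_def)
  hence "e (Suc i) k - e' (Suc i) l = 0"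
    using l(2) by (rule homogeneous_const_coeff(1))
  hence "e' (Suc i) l = e (Suc i) k" by simp
  with l(1) show ?thesis by (rule bexI[rotated])
qed

section \<open>Cancellation and the existence of minimal resolutions\<close>

lemma cycles_0: "cycles B N D 0 = free_module (B 0)"
  by (simp add: cycles_def)

lemma cycles_Suc: "cycles B N D (Suc i) = {y \<in> free_module (B (Suc i)). D i y \<in> null_vectors N i}"
  by (simp add: cycles_def)

lemma null_vectors_Suc: "null_vectors N (Suc i) = {0}"
  by (simp add: null_vectors_def)

lemma cycles_subset: "cycles B N D i \<subseteq> free_module (B i)"
  by (auto simp: cycles_def)

lemma linear_map_coordinate: "linear_map (\<lambda>y. scale (c * y l) w)"
proof (rule linear_mapI)
  fix x y and d m
  show "scale (c * (x + y) l) w m = scale (c * x l) w m + scale (c * y l) w m"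
    by (simp only: scale_apply plus_fun_apply distrib_left distrib_right)
  show "scale (c * scale d x l) w m = d * scale (c * x l) w m"
    by (simp only: scale_apply ac_simps)
qed

text \<open>If \<open>w = D e\<^sub>k\<close> has a unit at coordinate \<open>l\<close>, then \<open>e\<^sub>k\<close> and \<open>w\<close> span a trivial subcomplex, and the
  quotient by it is again a resolution. Modulo \<open>w\<close> the basis element \<open>l\<close> is a combination of the others,
  so the quotient is free on the remaining basis: the projection \<open>P\<close> modulo \<open>w\<close> kills the coordinate
  \<open>l\<close>, and the projection \<open>Q\<close> modulo \<open>e\<^sub>k\<close> forgets the coordinate \<open>k\<close>.\<close>

lemma cancel_unit_entry:
  fixes D :: "nat \<Rightarrow> ('b \<Rightarrow> ('v::finite, 'k::field) mpolynomial) \<Rightarrow> 'b \<Rightarrow> ('v, 'k) mpolynomial"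
  assumes res: "resolution B e N D" and k: "k \<in> B (Suc (Suc i))" and l: "l \<in> B (Suc i)"
    and nz: "const_coeff (D (Suc i) (basis_vector k) l) \<noteq> 0"
  shows "e (Suc (Suc i)) k = e (Suc i) l" and
    "\<exists>D'. resolution (B(Suc i := B (Suc i) - {l}, Suc (Suc i) := B (Suc (Suc i)) - {k})) e N D'"
proof -
  let ?e = "basis_vector k :: 'b \<Rightarrow> ('v, 'k) mpolynomial"
  define w where "w = D (Suc i) ?e"
  have gr: "graded_map (B (Suc m)) (e (Suc m)) (B m) (e m) (D m)" for m
    by (rule resolutionD(3)[OF res])
  have lin: "linear_map (D m)" for m by (rule graded_mapD(1)[OF gr])
  have Dfv: "D m x \<in> free_module (B m)" if "x \<in> free_module (B (Suc m))" for m x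
    by (rule graded_mapD(2)[OF gr that])
  have Dcyc: "D m x \<in> cycles B N D m" if "x \<in> free_module (B (Suc m))" for m x
    by (rule resolutionD(4)[OF res that])
  have DD: "D m (D (Suc m) x) \<in> null_vectors N m" if "x \<in> free_module (B (Suc (Suc m)))" for m x
    using Dcyc[OF that] by (simp add: cycles_Suc)
  note sub = graded_submodule_null_vectors[OF res, of i]
  have e_fv: "?e \<in> free_module (B (Suc (Suc i)))" by (rule basis_vector_in[OF k])
  have w_fv: "w \<in> free_module (B (Suc i))" unfolding w_def by (rule Dfv[OF e_fv])
  have Dw: "D i w \<in> null_vectors N i" unfolding w_def by (rule DD[OF e_fv])
  have w_h: "homogeneous_vector (e (Suc i)) (e (Suc (Suc i)) k) w"
    unfolding w_def by (rule graded_mapD(3)[OF gr e_fv homogeneous_vector_unit])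
  hence wl: "homogeneous (e (Suc (Suc i)) k - e (Suc i) l) (w l)" by (simp add: homogeneous_vector_def)
  have nz': "const_coeff (w l) \<noteq> 0" using nz by (simp add: w_def)
  show deg: "e (Suc (Suc i)) k = e (Suc i) l"
    using homogeneous_const_coeff(1)[OF wl nz'] by simp
  obtain u where u: "homogeneous 0 u" "u * w l = 1" by (rule homogeneous_unit[OF wl nz'])

  define P where "P = (\<lambda>y :: 'b \<Rightarrow> ('v, 'k) mpolynomial. y - scale (u * y l) w)"
  define Q where "Q = (\<lambda>x :: 'b \<Rightarrow> ('v, 'k) mpolynomial. x - scale (x k) ?e)"
  have P_lin: "linear_map P"
    unfolding P_def by (rule linear_map_minus[OF linear_map_id linear_map_coordinate])
  have Q_lin: "linear_map Q"
    using linear_map_minus[OF linear_map_id linear_map_coordinate[of 1]] by (simp add: Q_def)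
  have P_l: "P y l = 0" for y
  proof -
    have "P y l = y l - y l * (u * w l)" by (simp add: P_def)
    thus ?thesis by (simp add: u(2))
  qed
  have P_w: "P w = 0"
    by (rule ext) (simp add: P_def u(2))
  have P_id: "P y = y" if "y l = 0" for y
    by (rule ext) (simp add: P_def that)
  have Q_k: "Q x k = 0" for x
    by (simp add: Q_def basis_vector_def)
  have Q_e: "Q ?e = 0"
    by (rule ext) (simp add: Q_def basis_vector_def)
  have Q_id: "Q x = x" if "x k = 0" for x
    by (rule ext) (simp add: Q_def that)
  have fv_l: "y \<in> free_module (B (Suc i) - {l}) \<longleftrightarrow> y \<in> free_module (B (Suc i)) \<and> y l = 0" for y :: "'b \<Rightarrow> ('v, 'k) mpolynomial"
    using l by (auto simp: free_module_def)
  have fv_k: "y \<in> free_module (B (Suc (Suc i)) - {k}) \<longleftrightarrow> y \<in> free_module (B (Suc (Suc i))) \<and> y k = 0" for y :: "'b \<Rightarrow> ('v, 'k) mpolynomial"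
    using k by (auto simp: free_module_def)
  have P_fv: "P y \<in> free_module (B (Suc i) - {l})" if "y \<in> free_module (B (Suc i))" for y
    unfolding fv_l using P_l free_module_diff[OF that free_module_scale[OF w_fv]] by (simp add: P_def)
  have Q_fv: "Q y \<in> free_module (B (Suc (Suc i)) - {k})" if "y \<in> free_module (B (Suc (Suc i)))" for y
    unfolding fv_k using Q_k free_module_diff[OF that free_module_scale[OF e_fv]] by (simp add: Q_def)
  have P_gr: "graded_map (B (Suc i)) (e (Suc i)) (B (Suc i) - {l}) (e (Suc i)) P"
    unfolding graded_map_def
  proof (intro conjI ballI allI impI)
    fix d and y :: "'b \<Rightarrow> ('v, 'k) mpolynomial"
    assume h: "homogeneous_vector (e (Suc i)) d y"
    hence "homogeneous (d - e (Suc i) l) (y l)" by (simp add: homogeneous_vector_def)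
    from homogeneous_mult[OF u(1) this]
    have "homogeneous_vector (e (Suc i)) d (scale (u * y l) w)"
      by (rule homogeneous_vector_scale[OF _ w_h]) (simp add: deg)
    thus "homogeneous_vector (e (Suc i)) d (P y)" unfolding P_def by (rule homogeneous_vector_diff[OF h])
  qed (fact P_lin P_fv)+
  have Q_gr: "graded_map (B (Suc (Suc i))) (e (Suc (Suc i))) (B (Suc (Suc i)) - {k}) (e (Suc (Suc i))) Q"
    unfolding graded_map_def
  proof (intro conjI ballI allI impI)
    fix d and y :: "'b \<Rightarrow> ('v, 'k) mpolynomial"
    assume h: "homogeneous_vector (e (Suc (Suc i))) d y"
    hence "homogeneous (d - e (Suc (Suc i)) k) (y k)" by (simp add: homogeneous_vector_def)
    hence "homogeneous_vector (e (Suc (Suc i))) d (scale (y k) ?e)"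
      by (rule homogeneous_vector_scale[OF _ homogeneous_vector_unit]) simp
    thus "homogeneous_vector (e (Suc (Suc i))) d (Q y)" unfolding Q_def by (rule homogeneous_vector_diff[OF h])
  qed (fact Q_lin Q_fv)+
  have DP: "D i y - D i (P y) \<in> null_vectors N i" for y
  proof -
    have "D i y - D i (P y) = scale (u * y l) (D i w)"
      unfolding P_def linear_map_diff[OF lin] linear_map_scale[OF lin] by simp
    thus ?thesis using graded_submodule_scale[OF sub Dw] by simp
  qed
  have DR: "P (D (Suc i) (Q x)) = P (D (Suc i) x)" for x
    unfolding Q_def linear_map_diff[OF lin] linear_map_scale[OF lin] linear_map_diff[OF P_lin]
      linear_map_scale[OF P_lin] w_def[symmetric] P_w by (rule ext) simp

  define B' where "B' = B(Suc i := B (Suc i) - {l}, Suc (Suc i) := B (Suc (Suc i)) - {k})"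
  define D' where "D' = D(Suc i := (\<lambda>x. P (D (Suc i) x)), Suc (Suc i) := (\<lambda>x. Q (D (Suc (Suc i)) x)))"
  have B': "B' (Suc i) = B (Suc i) - {l}" "B' (Suc (Suc i)) = B (Suc (Suc i)) - {k}"
    "m \<noteq> Suc i \<Longrightarrow> m \<noteq> Suc (Suc i) \<Longrightarrow> B' m = B m" for m
    by (simp_all add: B'_def)
  have D': "D' (Suc i) x = P (D (Suc i) x)" "D' (Suc (Suc i)) x = Q (D (Suc (Suc i)) x)"
    "m \<noteq> Suc i \<Longrightarrow> m \<noteq> Suc (Suc i) \<Longrightarrow> D' m = D m" for m x
    by (simp_all add: D'_def)
  have B'_sub: "B' m \<subseteq> B m" for m by (auto simp: B'_def)
  have B'_fv: "x \<in> free_module (B' m) \<Longrightarrow> x \<in> free_module (B m)" for m and x :: "'b \<Rightarrow> ('v, 'k) mpolynomial"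
    using free_module_mono[OF B'_sub] by blast
  have restrict: "graded_map (B' (Suc m)) (e (Suc m)) C f L" if "graded_map (B (Suc m)) (e (Suc m)) C f L"
    for m and C :: "'b set" and f and L :: "('b \<Rightarrow> ('v, 'k) mpolynomial) \<Rightarrow> 'b \<Rightarrow> ('v, 'k) mpolynomial"
    using that B'_fv unfolding graded_map_def by blast
  \<comment> \<open>Only stages \<open>i + 1\<close> and \<open>i + 2\<close> have new cycles. At stage \<open>i + 3\<close> the new differential has the same
    kernel as the old one: a boundary that is a multiple of \<open>e\<^sub>k\<close> is zero, since its image under \<open>D\<close> is the
    same multiple of \<open>w\<close>.\<close>
  have cyc_other: "cycles B' N D' m = cycles B N D m" if "m \<noteq> Suc i" "m \<noteq> Suc (Suc i)" "m \<noteq> Suc (Suc (Suc i))" for m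
    using that by (cases m) (auto simp: cycles_0 cycles_Suc B' D')
  have cyc1: "cycles B' N D' (Suc i) = {y \<in> free_module (B (Suc i)). y l = 0 \<and> D i y \<in> null_vectors N i}"
    by (auto simp: cycles_Suc B' D' fv_l)
  have cyc2: "cycles B' N D' (Suc (Suc i)) = {y \<in> free_module (B (Suc (Suc i))). y k = 0 \<and> P (D (Suc i) y) = 0}"
    by (auto simp: cycles_Suc B' D' fv_k null_vectors_Suc)
  have cyc3: "cycles B' N D' (Suc (Suc (Suc i))) = cycles B N D (Suc (Suc (Suc i)))"
  proof -
    have "Q (D (Suc (Suc i)) y) = 0 \<longleftrightarrow> D (Suc (Suc i)) y = 0" if y: "y \<in> free_module (B (Suc (Suc (Suc i))))" for y
    proof
      assume "Q (D (Suc (Suc i)) y) = 0"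
      hence eq: "D (Suc (Suc i)) y = scale (D (Suc (Suc i)) y k) ?e" by (simp add: Q_def)
      have "0 = D (Suc i) (D (Suc (Suc i)) y)" using DD[OF y] by (simp add: null_vectors_Suc)
      also have "\<dots> = scale (D (Suc (Suc i)) y k) w"
        unfolding w_def by (subst eq) (rule linear_map_scale[OF lin])
      finally have "D (Suc (Suc i)) y k * w l = 0" by (metis scale_apply zero_fun_apply)
      hence "D (Suc (Suc i)) y k * (u * w l) = 0" by (metis mult.left_commute mult_zero_right)
      hence "D (Suc (Suc i)) y k = 0" by (simp add: u(2))
      thus "D (Suc (Suc i)) y = 0" by (subst eq) (rule ext, simp)
    qed (simp add: linear_map_0[OF Q_lin])
    thus ?thesis by (auto simp: cycles_Suc B' D' null_vectors_Suc)
  qed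
  have "resolution B' e N D'"
    unfolding resolution_def
  proof (intro conjI allI ballI)
    fix m
    show "finite (B' m)" by (rule finite_subset[OF B'_sub resolutionD(1)[OF res]])
    show "graded_map (B' (Suc m)) (e (Suc m)) (B' m) (e m) (D' m)"
    proof -
      consider "m = Suc i" | "m = Suc (Suc i)" | "m \<noteq> Suc i" "m \<noteq> Suc (Suc i)" by blast
      thus ?thesis
      proof cases
        case 1
        show ?thesis unfolding 1 B'(1) D'_def
          using restrict[OF graded_map_comp[OF gr P_gr]] by simp
      next
        case 2
        show ?thesis unfolding 2 B'(2) D'_def
          using restrict[OF graded_map_comp[OF gr Q_gr]] by simp
      next
        case 3
        thus ?thesis using restrict[OF gr[of m]] by (simp add: B' D')
      qed
    qed
    show "D' m x \<in> cycles B' N D' m" if x: "x \<in> free_module (B' (Suc m))" for x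
    proof -
      note x' = B'_fv[OF x]
      consider "m = Suc i" | "m = Suc (Suc i)" | "m = Suc (Suc (Suc i))"
        | "m \<noteq> Suc i" "m \<noteq> Suc (Suc i)" "m \<noteq> Suc (Suc (Suc i))" by blast
      thus ?thesis
      proof cases
        case 1
        let ?y = "D (Suc i) x"
        have y: "?y \<in> free_module (B (Suc i))" "D i ?y \<in> null_vectors N i"
          using Dcyc[OF x'] 1 by (auto simp: cycles_Suc)
        have "D i ?y - (D i ?y - D i (P ?y)) \<in> null_vectors N i"
          by (rule graded_submodule_diff[OF sub y(2) DP])
        thus ?thesis using P_fv[OF y(1)] unfolding 1 cyc1 D' by (simp add: fv_l)
      next
        case 2
        let ?y = "D (Suc (Suc i)) x"
        have y: "?y \<in> free_module (B (Suc (Suc i)))" "D (Suc i) ?y = 0"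
          using Dcyc[OF x'] 2 by (auto simp: cycles_Suc null_vectors_Suc)
        show ?thesis using Q_fv[OF y(1)] unfolding 2 cyc2 D'
          by (simp add: fv_k DR y(2) linear_map_0[OF P_lin])
      next
        case 3
        thus ?thesis using Dcyc[OF x'] cyc3 by (simp add: D')
      next
        case 4
        thus ?thesis using Dcyc[OF x'] by (simp add: D' cyc_other)
      qed
    qed
    show "\<exists>x\<in>free_module (B' (Suc m)). y - D' m x \<in> null_vectors N m" if y: "y \<in> cycles B' N D' m" for y
    proof -
      have ex: "\<exists>x\<in>free_module (B (Suc m)). y - D m x \<in> null_vectors N m" if "y \<in> cycles B N D m" for m y
        by (rule resolutionD(5)[OF res that])
      consider "m = i" | "m = Suc i" | "m = Suc (Suc i)" | "m = Suc (Suc (Suc i))"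
        | "m \<noteq> i" "m \<noteq> Suc i" "m \<noteq> Suc (Suc i)" "m \<noteq> Suc (Suc (Suc i))" by blast
      thus ?thesis
      proof cases
        case 1
        hence "y \<in> cycles B N D i" using y cyc_other[of i] by simp
        then obtain x where x: "x \<in> free_module (B (Suc i))" "y - D i x \<in> null_vectors N i" using ex by blast
        have "y - D i (P x) = (y - D i x) + (D i x - D i (P x))" by simp
        also have "\<dots> \<in> null_vectors N i" by (rule graded_submodule_add[OF sub x(2) DP])
        finally have "y - D' m (P x) \<in> null_vectors N m" unfolding 1 by (simp add: D')
        moreover have "P x \<in> free_module (B' (Suc m))" unfolding 1 B' by (rule P_fv[OF x(1)])
        ultimately show ?thesis by blast
      next
        case 2
        hence y': "y \<in> cycles B N D (Suc i)" "y l = 0" using y cyc1 by (auto simp: cycles_Suc)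
        then obtain x where x: "x \<in> free_module (B (Suc (Suc i)))" "y = D (Suc i) x"
          using ex[of y "Suc i"] by (auto simp: null_vectors_Suc)
        have "y - D' m (Q x) \<in> null_vectors N m"
          unfolding 2 D' DR x(2)[symmetric] P_id[of y, OF y'(2)] by (simp add: null_vectors_Suc)
        moreover have "Q x \<in> free_module (B' (Suc m))" unfolding 2 B' by (rule Q_fv[OF x(1)])
        ultimately show ?thesis by blast
      next
        case 3
        hence y': "y \<in> free_module (B (Suc (Suc i)))" "y k = 0" "P (D (Suc i) y) = 0" using y cyc2 by auto
        \<comment> \<open>A new cycle maps to a multiple of \<open>w\<close> and becomes an old cycle after subtracting that multiple of
          \<open>e\<^sub>k\<close>, which the projection forgets.\<close>
        define c where "c = u * D (Suc i) y l"
        have "D (Suc i) y = scale c w" using y'(3) by (simp add: P_def c_def)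
        hence "D (Suc i) (y - scale c ?e) = 0"
          unfolding linear_map_diff[OF lin] linear_map_scale[OF lin] w_def by simp
        moreover have "y - scale c ?e \<in> free_module (B (Suc (Suc i)))"
          by (rule free_module_diff[OF y'(1) free_module_scale[OF e_fv]])
        ultimately have "y - scale c ?e \<in> cycles B N D (Suc (Suc i))"
          by (simp add: cycles_Suc null_vectors_Suc)
        then obtain x where x: "x \<in> free_module (B (Suc (Suc (Suc i))))" "y - scale c ?e = D (Suc (Suc i)) x"
          using ex[of _ "Suc (Suc i)"] by (auto simp: null_vectors_Suc)
        have "Q (D (Suc (Suc i)) x) = Q y - scale c (Q ?e)"
          unfolding x(2)[symmetric] linear_map_diff[OF Q_lin] linear_map_scale[OF Q_lin] ..
        also have "\<dots> = y" unfolding Q_e Q_id[of y, OF y'(2)] by (rule ext) simp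
        finally have "y - D' m x \<in> null_vectors N m" unfolding 3 D' by (simp add: null_vectors_Suc)
        moreover have "x \<in> free_module (B' (Suc m))" using x(1) unfolding 3 by (simp add: B')
        ultimately show ?thesis by blast
      next
        case 4
        hence "y \<in> cycles B N D m" using y cyc3 by simp
        thus ?thesis using ex[of y m] 4 by (simp add: B' D')
      next
        case 5
        hence "y \<in> cycles B N D m" using y cyc_other by simp
        thus ?thesis using ex[of y m] 5 by (simp add: B' D')
      qed
    qed
  qed (rule resolutionD(2)[OF res])
  thus "\<exists>D'. resolution (B(Suc i := B (Suc i) - {l}, Suc (Suc i) := B (Suc (Suc i)) - {k})) e N D'"
    unfolding B'_def by blast
qed

text \<open>Repeated cancellation ends because the total rank drops. Each cancelled basis element disappears
  together with one of the same degree in an adjacent stage, and stage \<open>0\<close> is never touched.\<close>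

theorem minimal_resolution_exists:
  fixes D :: "nat \<Rightarrow> ('b \<Rightarrow> ('v::finite, 'k::field) mpolynomial) \<Rightarrow> 'b \<Rightarrow> ('v, 'k) mpolynomial"
  assumes "resolution B e N D" and "\<And>i. i > n \<Longrightarrow> B i = {}"
  shows "\<exists>B' D'. resolution B' e N D' \<and> minimal_complex B' D' \<and> B' 0 = B 0 \<and> (\<forall>i. B' i \<subseteq> B i) \<and>
    (\<forall>i. \<forall>k\<in>B i - B' i. \<exists>j>0. (j = Suc i \<or> i = Suc j) \<and> (\<exists>l\<in>B j. e j l = e i k))"
  using assms
proof (induction "\<Sum>i\<le>n. card (B i)" arbitrary: B D rule: less_induct)
  case less
  note res = less.prems(1)
  have fin: "finite (B i)" for i by (rule resolutionD(1)[OF res])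
  show ?case
  proof (cases "minimal_complex B D")
    case True
    thus ?thesis using res by (intro exI[of _ B] exI[of _ D]) auto
  next
    case False
    then obtain i k l where k: "k \<in> B (Suc (Suc i))" and l: "l \<in> B (Suc i)"
      and nz: "const_coeff (D (Suc i) (basis_vector k) l) \<noteq> 0"
      unfolding minimal_complex_def by blast
    define B1 where "B1 = B(Suc i := B (Suc i) - {l}, Suc (Suc i) := B (Suc (Suc i)) - {k})"
    note deg = cancel_unit_entry(1)[OF res k l nz]
    obtain D1 where res1: "resolution B1 e N D1"
      using cancel_unit_entry(2)[OF res k l nz] unfolding B1_def by blast
    have sub: "B1 j \<subseteq> B j" for j by (auto simp: B1_def)
    have le: "i < n" using k less.prems(2)[of "Suc (Suc i)"] by (cases "Suc (Suc i) > n") auto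
    have "(\<Sum>j\<le>n. card (B1 j)) < (\<Sum>j\<le>n. card (B j))"
    proof (rule sum_strict_mono_ex1)
      show "\<forall>j\<in>{..n}. card (B1 j) \<le> card (B j)" using sub fin card_mono by blast
      have "card (B1 (Suc i)) < card (B (Suc i))"
        using card_Diff1_less[OF fin l] by (simp add: B1_def)
      thus "\<exists>j\<in>{..n}. card (B1 j) < card (B j)" using le by (intro bexI[of _ "Suc i"]) auto
    qed simp
    moreover have "B1 j = {}" if "j > n" for j using less.prems(2)[OF that] sub by blast
    ultimately obtain B' D' where IH: "resolution B' e N D'" "minimal_complex B' D'" "B' 0 = B1 0" "\<forall>j. B' j \<subseteq> B1 j"
      "\<forall>j. \<forall>m\<in>B1 j - B' j. \<exists>j'>0. (j' = Suc j \<or> j = Suc j') \<and> (\<exists>l\<in>B1 j'. e j' l = e j m)"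
      using less.hyps[OF _ res1] by blast
    have "\<exists>j'>0. (j' = Suc j \<or> j = Suc j') \<and> (\<exists>l\<in>B j'. e j' l = e j m)" if m: "m \<in> B j - B' j" for j m
    proof (cases "m \<in> B1 j")
      case True
      thus ?thesis using IH(5) m sub by blast
    next
      case False
      with m have "j = Suc i \<and> m = l \<or> j = Suc (Suc i) \<and> m = k" by (auto simp: B1_def split: if_splits)
      thus ?thesis using k l deg by (metis zero_less_Suc)
    qed
    moreover have "B' 0 = B 0" using IH(3) by (simp add: B1_def)
    ultimately show ?thesis using IH(1,2,4) sub by (intro exI[of _ B'] exI[of _ D']) blast
  qed
qed

section \<open>Resolutions given by matrices\<close>

lemma graded_map_iff:
  fixes L :: "('b \<Rightarrow> ('v::finite, 'k::comm_ring_1) mpolynomial) \<Rightarrow> 'c \<Rightarrow> ('v, 'k) mpolynomial"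
  assumes lin: "linear_map L" and fv: "\<And>x. x \<in> free_module B \<Longrightarrow> L x \<in> free_module C" and fin: "finite B"
  shows "graded_map B e C e' L \<longleftrightarrow> (\<forall>k\<in>B. \<forall>l\<in>C. homogeneous (e k - e' l) (L (basis_vector k) l))"
proof
  assume L: "graded_map B e C e' L"
  have "homogeneous_vector e' (e k) (L (basis_vector k))" if "k \<in> B" for k
    by (rule graded_mapD(3)[OF L basis_vector_in[OF that] homogeneous_vector_unit])
  thus "\<forall>k\<in>B. \<forall>l\<in>C. homogeneous (e k - e' l) (L (basis_vector k) l)" by (simp add: homogeneous_vector_def)
next
  assume h: "\<forall>k\<in>B. \<forall>l\<in>C. homogeneous (e k - e' l) (L (basis_vector k) l)"
  have h': "homogeneous_vector e' (e k) (L (basis_vector k))" if k: "k \<in> B" for k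
    unfolding homogeneous_vector_def
  proof
    fix l
    have "l \<notin> C \<Longrightarrow> L (basis_vector k) l = 0"
      using fv[OF basis_vector_in[OF k]] by (simp add: free_module_def)
    thus "homogeneous (e k - e' l) (L (basis_vector k) l)" using h k by (cases "l \<in> C") auto
  qed
  have "homogeneous_vector e' d (L x)" if x: "x \<in> free_module B" "homogeneous_vector e d x" for d x
    unfolding linear_map_expand[OF lin fin x(1)]
  proof (rule homogeneous_vector_sum)
    fix k assume k: "k \<in> B"
    have "homogeneous (d - e k) (x k)" using x(2) by (simp add: homogeneous_vector_def)
    thus "homogeneous_vector e' d (scale (x k) (L (basis_vector k)))" by (rule homogeneous_vector_scale[OF _ h'[OF k]]) simp
  qed
  with lin fv show "graded_map B e C e' L" by (auto simp: graded_map_def)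
qed

text \<open>The form in which exactness is stated by matrices: kernels equal images.\<close>

lemma resolution_iff:
  assumes fin: "\<And>i. finite (B i)" and N: "graded_submodule (e 0) N"
    and fv: "\<And>i x. x \<in> free_module (B (Suc i)) \<Longrightarrow> D i x \<in> free_module (B i)"
  shows "resolution B e N D \<longleftrightarrow>
    (\<forall>i. graded_map (B (Suc i)) (e (Suc i)) (B i) (e i) (D i)) \<and>
    (\<forall>y\<in>free_module (B 0). \<exists>x\<in>free_module (B (Suc 0)). y - D 0 x \<in> N) \<and>
    (\<forall>i. \<forall>y\<in>free_module (B (Suc i)). D i y \<in> null_vectors N i \<longleftrightarrow> (\<exists>x\<in>free_module (B (Suc (Suc i))). y = D (Suc i) x))"
    (is "_ \<longleftrightarrow> ?G \<and> ?S \<and> ?E")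
proof
  assume res: "resolution B e N D"
  have "?S" using resolutionD(5)[OF res, of _ 0] by (simp add: cycles_0 null_vectors_def)
  moreover have "D i y \<in> null_vectors N i \<longleftrightarrow> (\<exists>x\<in>free_module (B (Suc (Suc i))). y = D (Suc i) x)"
    if y: "y \<in> free_module (B (Suc i))" for i y
  proof
    assume "D i y \<in> null_vectors N i"
    hence "y \<in> cycles B N D (Suc i)" using y by (simp add: cycles_Suc)
    from resolutionD(5)[OF res this] show "\<exists>x\<in>free_module (B (Suc (Suc i))). y = D (Suc i) x"
      by (auto simp: null_vectors_Suc)
  next
    assume "\<exists>x\<in>free_module (B (Suc (Suc i))). y = D (Suc i) x"
    then obtain x where "x \<in> free_module (B (Suc (Suc i)))" "y = D (Suc i) x" by blast
    thus "D i y \<in> null_vectors N i" using resolutionD(4)[OF res, of x "Suc i"] by (simp add: cycles_Suc)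
  qed
  ultimately show "?G \<and> ?S \<and> ?E" using resolutionD(3)[OF res] by blast
next
  assume A: "?G \<and> ?S \<and> ?E"
  show "resolution B e N D"
    unfolding resolution_def
  proof (intro conjI allI ballI)
    fix i
    show "graded_map (B (Suc i)) (e (Suc i)) (B i) (e i) (D i)" using A by blast
    show "D i x \<in> cycles B N D i" if x: "x \<in> free_module (B (Suc i))" for x
      using A x fv[OF x] by (cases i) (auto simp: cycles_0 cycles_Suc)
    show "\<exists>x\<in>free_module (B (Suc i)). y - D i x \<in> null_vectors N i" if y: "y \<in> cycles B N D i" for y
    proof (cases i)
      case 0
      thus ?thesis using A y by (simp add: cycles_0 null_vectors_def)
    next
      case (Suc j)
      then obtain x where "x \<in> free_module (B (Suc i))" "y = D i x" using A y by (auto simp: cycles_Suc)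
      thus ?thesis using Suc by (auto simp: null_vectors_Suc)
    qed
  qed (fact fin N)+
qed

lemma kernel_image_transfer:
  assumes T: "bij_betw T F C" and T': "bij_betw T' F' C'"
    and \<phi>: "\<And>y. y \<in> F \<Longrightarrow> \<phi> (T y) = \<psi> y"
    and g: "\<And>x. x \<in> F' \<Longrightarrow> g (T' x) = T (h x)" and h: "\<And>x. x \<in> F' \<Longrightarrow> h x \<in> F"
  shows "{v \<in> C. \<phi> v} = g ` C' \<longleftrightarrow> (\<forall>y\<in>F. \<psi> y \<longleftrightarrow> (\<exists>x\<in>F'. y = h x))"
proof -
  have 1: "{v \<in> C. \<phi> v} = T ` {y \<in> F. \<psi> y}"
    using bij_betw_imp_surj_on[OF T] \<phi> by force
  have "g ` C' = g ` T' ` F'" using bij_betw_imp_surj_on[OF T'] by simp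
  also have "\<dots> = (g \<circ> T') ` F'" by (rule image_comp)
  also have "\<dots> = T ` (h ` F')" using g by (auto simp: image_iff)
  finally have 2: "g ` C' = T ` (h ` F')" .
  have "{v \<in> C. \<phi> v} = g ` C' \<longleftrightarrow> {y \<in> F. \<psi> y} = h ` F'"
    unfolding 1 2 using h by (intro inj_on_image_eq_iff[OF bij_betw_imp_inj_on[OF T]]) auto
  thus ?thesis using h by auto
qed

definition coordinates :: "(nat \<Rightarrow> 'b) \<Rightarrow> nat \<Rightarrow> ('b \<Rightarrow> 'r) \<Rightarrow> 'r vec" where
  "coordinates b n x = vec n (\<lambda>k. x (b k))"

lemma bij_coordinates:
  fixes B :: "'b set"
  assumes b: "bij_betw b {..<n} B"
  shows "bij_betw (coordinates b n) (free_module B) (carrier_vec n :: 'r::zero vec set)"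
proof (rule bij_betwI[where g = "\<lambda>v l. if l \<in> B then v $ (inv_into {..<n} b l) else 0"])
  note inv = bij_betw_inv_into_right[OF b] bij_betw_inv_into_left[OF b] bij_betwE[OF b]
  have lt: "inv_into {..<n} b l < n" if "l \<in> B" for l
    using bij_betwE[OF bij_betw_inv_into[OF b]] that by blast
  show "coordinates b n \<in> free_module B \<rightarrow> (carrier_vec n :: 'r vec set)" by (auto simp: coordinates_def)
  show "(\<lambda>v l. if l \<in> B then v $ inv_into {..<n} b l else 0) \<in> (carrier_vec n :: 'r vec set) \<rightarrow> free_module B"
    by (auto simp: free_module_def)
  show "(\<lambda>l. if l \<in> B then coordinates b n x $ inv_into {..<n} b l else 0) = x" if "x \<in> free_module B" for x :: "'b \<Rightarrow> 'r"
    using that lt inv by (auto simp: coordinates_def free_module_def fun_eq_iff)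
  show "coordinates b n (\<lambda>l. if l \<in> B then v $ inv_into {..<n} b l else 0) = v" if "v \<in> carrier_vec n" for v :: "'r vec"
    using that inv by (intro eq_vecI) (auto simp: coordinates_def)
qed

lemma linear_map_coordinates:
  fixes L :: "('b \<Rightarrow> 'r::comm_ring_1) \<Rightarrow> 'c \<Rightarrow> 'r"
  assumes L: "linear_map L" and b: "bij_betw b {..<n} B" and x: "x \<in> free_module B"
  shows "vec n (\<lambda>k. L (basis_vector (b k)) l) \<bullet> coordinates b n x = L x l"
proof -
  have fin: "finite B" using bij_betw_finite[OF b] by simp
  have "L x l = (\<Sum>k\<in>B. x k * L (basis_vector k) l)"
    using linear_map_expand[OF L fin x] by (simp add: sum_fun_apply)
  also have "\<dots> = (\<Sum>k\<in>{..<n}. x (b k) * L (basis_vector (b k)) l)"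
    by (rule sum.reindex_bij_betw[OF b, symmetric])
  also have "\<dots> = vec n (\<lambda>k. L (basis_vector (b k)) l) \<bullet> coordinates b n x"
    by (simp add: scalar_prod_def coordinates_def atLeast0LessThan mult.commute)
  finally show ?thesis by simp
qed

text \<open>Vectors and matrices are the coordinates of functions and linear maps with respect to enumerations
  \<open>b i\<close> of the bases. The equivalence is used in both directions: with \<open>b i\<close> the identity to view given
  matrices as linear maps, and with arbitrary enumerations to produce matrices.\<close>

lemma graded_free_resolution_iff:
  fixes D :: "nat \<Rightarrow> ('b \<Rightarrow> ('v::finite, 'k::comm_ring_1) mpolynomial) \<Rightarrow> 'b \<Rightarrow> ('v, 'k) mpolynomial"
  assumes B0: "B 0 = {r}" "e 0 r = 0" and N: "N = {x \<in> free_module {r}. x r \<in> I}" "graded_submodule (e 0) N"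
    and b: "\<And>i. bij_betw (b i) {..<length (a i)} (B (Suc i))"
    and lin: "\<And>i. linear_map (D i)" and fv: "\<And>i x. x \<in> free_module (B (Suc i)) \<Longrightarrow> D i x \<in> free_module (B i)"
    and a: "\<And>i k. k < length (a i) \<Longrightarrow> a i ! k = e (Suc i) (b i k)"
    and f: "f = vec (length (a 0)) (\<lambda>k. D 0 (basis_vector (b 0 k)) r)"
    and M: "\<And>i. M i = mat (length (a i)) (length (a (Suc i))) (\<lambda>(l, k). D (Suc i) (basis_vector (b (Suc i) k)) (b i l))"
  shows "graded_free_resolution I a f M \<longleftrightarrow> resolution B e N D"
    and "minimal_graded_free_resolution I a f M \<longleftrightarrow> resolution B e N D \<and> minimal_complex B D"
proof -
  have finS: "finite (B (Suc i))" for i using bij_betw_finite[OF b[of i]] by simp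
  have fin: "finite (B i)" for i using finS B0(1) by (cases i) auto
  define T where "T i = (coordinates (b i) (length (a i)) :: ('b \<Rightarrow> ('v, 'k) mpolynomial) \<Rightarrow> _)" for i
  have T: "bij_betw (T i) (free_module (B (Suc i))) (carrier_vec (length (a i)))" for i
    unfolding T_def by (rule bij_coordinates[OF b])
  have fT: "f \<bullet> T 0 x = D 0 x r" if "x \<in> free_module (B (Suc 0))" for x
    unfolding f T_def by (rule linear_map_coordinates[OF lin b that])
  have MT: "M i *\<^sub>v T (Suc i) x = T i (D (Suc i) x)" if x: "x \<in> free_module (B (Suc (Suc i)))" for i x
  proof (rule eq_vecI)
    fix l assume "l < dim_vec (T i (D (Suc i) x))"
    hence l: "l < length (a i)" by (simp add: T_def coordinates_def)
    have "row (M i) l = vec (length (a (Suc i))) (\<lambda>k. D (Suc i) (basis_vector (b (Suc i) k)) (b i l))"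
      using l by (intro eq_vecI) (simp_all add: M)
    hence "(M i *\<^sub>v T (Suc i) x) $ l = D (Suc i) x (b i l)"
      using l linear_map_coordinates[OF lin b x, of "Suc i" "b i l"] by (simp add: T_def M)
    thus "(M i *\<^sub>v T (Suc i) x) $ l = T i (D (Suc i) x) $ l"
      using l by (simp add: T_def coordinates_def)
  qed (simp add: T_def coordinates_def M)
  have b_all: "(\<forall>k<length (a i). Q (b i k)) \<longleftrightarrow> (\<forall>k\<in>B (Suc i). Q k)" for i Q
    using bij_betw_imp_surj_on[OF b[of i]] by (metis image_iff lessThan_iff)
  have b_all2: "(\<forall>l<length (a i). \<forall>k<length (a (Suc i)). Q (b (Suc i) k) (b i l)) \<longleftrightarrow>
    (\<forall>l\<in>B (Suc i). \<forall>k\<in>B (Suc (Suc i)). Q k l)" for i Q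
  proof -
    have "(\<forall>l<length (a i). \<forall>k<length (a (Suc i)). Q (b (Suc i) k) (b i l)) \<longleftrightarrow>
      (\<forall>l\<in>B (Suc i). \<forall>k<length (a (Suc i)). Q (b (Suc i) k) l)"
      by (rule b_all[of i "\<lambda>l. \<forall>k<length (a (Suc i)). Q (b (Suc i) k) l"])
    also have "\<dots> \<longleftrightarrow> (\<forall>l\<in>B (Suc i). \<forall>k\<in>B (Suc (Suc i)). Q k l)"
    proof (rule ball_cong[OF refl])
      fix l
      show "(\<forall>k<length (a (Suc i)). Q (b (Suc i) k) l) \<longleftrightarrow> (\<forall>k\<in>B (Suc (Suc i)). Q k l)"
        by (rule b_all[of "Suc i" "\<lambda>k. Q k l"])
    qed
    finally show ?thesis .
  qed

  have grade: "((\<forall>k<length (a 0). homogeneous (a 0 ! k) (f $ k)) \<and>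
    (\<forall>i. \<forall>l<length (a i). \<forall>k<length (a (Suc i)). homogeneous (a (Suc i) ! k - a i ! l) (M i $$ (l, k)))) \<longleftrightarrow>
    (\<forall>i. graded_map (B (Suc i)) (e (Suc i)) (B i) (e i) (D i))" (is "?A0 \<and> ?AS \<longleftrightarrow> _")
  proof -
    have gm: "graded_map (B (Suc i)) (e (Suc i)) (B i) (e i) (D i) \<longleftrightarrow>
      (\<forall>k\<in>B (Suc i). \<forall>l\<in>B i. homogeneous (e (Suc i) k - e i l) (D i (basis_vector k) l))" for i
      by (rule graded_map_iff[OF lin fv fin])
    have "?A0 \<longleftrightarrow> (\<forall>k<length (a 0). homogeneous (e (Suc 0) (b 0 k) - e 0 r) (D 0 (basis_vector (b 0 k)) r))"
      by (simp add: a f B0)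
    also have "\<dots> \<longleftrightarrow> (\<forall>k\<in>B (Suc 0). homogeneous (e (Suc 0) k - e 0 r) (D 0 (basis_vector k) r))"
      by (rule b_all)
    also have "\<dots> \<longleftrightarrow> graded_map (B (Suc 0)) (e (Suc 0)) (B 0) (e 0) (D 0)"
      unfolding gm by (simp add: B0(1))
    finally have A0: "?A0 \<longleftrightarrow> graded_map (B (Suc 0)) (e (Suc 0)) (B 0) (e 0) (D 0)" .
    have AS: "(\<forall>l<length (a i). \<forall>k<length (a (Suc i)). homogeneous (a (Suc i) ! k - a i ! l) (M i $$ (l, k))) \<longleftrightarrow>
       graded_map (B (Suc (Suc i))) (e (Suc (Suc i))) (B (Suc i)) (e (Suc i)) (D (Suc i))" for i
    proof -
      have "(\<forall>l<length (a i). \<forall>k<length (a (Suc i)). homogeneous (a (Suc i) ! k - a i ! l) (M i $$ (l, k))) \<longleftrightarrow>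
        (\<forall>l<length (a i). \<forall>k<length (a (Suc i)). homogeneous (e (Suc (Suc i)) (b (Suc i) k) - e (Suc i) (b i l))
           (D (Suc i) (basis_vector (b (Suc i) k)) (b i l)))"
        by (simp add: a M)
      also have "\<dots> \<longleftrightarrow> (\<forall>l\<in>B (Suc i). \<forall>k\<in>B (Suc (Suc i)). homogeneous (e (Suc (Suc i)) k - e (Suc i) l) (D (Suc i) (basis_vector k) l))"
        by (rule b_all2[of i "\<lambda>k l. homogeneous (e (Suc (Suc i)) k - e (Suc i) l) (D (Suc i) (basis_vector k) l)"])
      also have "\<dots> \<longleftrightarrow> graded_map (B (Suc (Suc i))) (e (Suc (Suc i))) (B (Suc i)) (e (Suc i)) (D (Suc i))"
        unfolding gm by blast
      finally show ?thesis .
    qed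
    show ?thesis unfolding A0 AS by (metis not0_implies_Suc)
  qed

  have surj: "(\<forall>p. \<exists>x\<in>carrier_vec (length (a 0)). p - f \<bullet> x \<in> I) \<longleftrightarrow>
    (\<forall>y\<in>free_module (B 0). \<exists>x\<in>free_module (B (Suc 0)). y - D 0 x \<in> N)"
  proof -
    have mem: "y - D 0 x \<in> N \<longleftrightarrow> y r - f \<bullet> T 0 x \<in> I" if "y \<in> free_module (B 0)" "x \<in> free_module (B (Suc 0))" for x y
      using free_module_diff[OF that(1) fv[OF that(2)]] by (simp add: N B0(1) fT[OF that(2)])
    have ex: "(\<exists>x\<in>carrier_vec (length (a 0)). p - f \<bullet> x \<in> I) \<longleftrightarrow> (\<exists>x\<in>free_module (B (Suc 0)). p - f \<bullet> T 0 x \<in> I)" for p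
      unfolding bij_betw_imp_surj_on[OF T, symmetric] by blast
    show ?thesis unfolding ex
    proof
      assume L: "\<forall>p. \<exists>x\<in>free_module (B (Suc 0)). p - f \<bullet> T 0 x \<in> I"
      show "\<forall>y\<in>free_module (B 0). \<exists>x\<in>free_module (B (Suc 0)). y - D 0 x \<in> N"
      proof
        fix y :: "'b \<Rightarrow> ('v, 'k) mpolynomial"
        assume y: "y \<in> free_module (B 0)"
        obtain x where "x \<in> free_module (B (Suc 0))" "y r - f \<bullet> T 0 x \<in> I" using L by blast
        thus "\<exists>x\<in>free_module (B (Suc 0)). y - D 0 x \<in> N" using mem[OF y] by blast
      qed
    next
      assume R: "\<forall>y\<in>free_module (B 0). \<exists>x\<in>free_module (B (Suc 0)). y - D 0 x \<in> N"
      show "\<forall>p. \<exists>x\<in>free_module (B (Suc 0)). p - f \<bullet> T 0 x \<in> I"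
      proof
        fix p :: "('v, 'k) mpolynomial"
        let ?y = "\<lambda>l. if l = r then p else 0"
        have y: "?y \<in> free_module (B 0)" by (simp add: free_module_def B0(1))
        obtain x where x: "x \<in> free_module (B (Suc 0))" "?y - D 0 x \<in> N" using R y by blast
        thus "\<exists>x\<in>free_module (B (Suc 0)). p - f \<bullet> T 0 x \<in> I" using mem[OF y x(1)] by auto
      qed
    qed
  qed

  have ker0: "{x \<in> carrier_vec (length (a 0)). f \<bullet> x \<in> I} = (*\<^sub>v) (M 0) ` carrier_vec (length (a 1)) \<longleftrightarrow>
    (\<forall>y\<in>free_module (B (Suc 0)). D 0 y \<in> null_vectors N 0 \<longleftrightarrow> (\<exists>x\<in>free_module (B (Suc (Suc 0))). y = D (Suc 0) x))"
    unfolding One_nat_def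
  proof (rule kernel_image_transfer[OF T T])
    fix y :: "'b \<Rightarrow> ('v, 'k) mpolynomial"
    assume y: "y \<in> free_module (B (Suc 0))"
    show "(f \<bullet> T 0 y \<in> I) = (D 0 y \<in> null_vectors N 0)"
      using fv[OF y] by (simp add: fT[OF y] null_vectors_def N B0(1))
  qed (fact MT fv)+
  have kerS: "{x \<in> carrier_vec (length (a (Suc i))). M i *\<^sub>v x = 0\<^sub>v (length (a i))} =
      (*\<^sub>v) (M (Suc i)) ` carrier_vec (length (a (Suc (Suc i)))) \<longleftrightarrow>
    (\<forall>y\<in>free_module (B (Suc (Suc i))). D (Suc i) y \<in> null_vectors N (Suc i) \<longleftrightarrow>
       (\<exists>x\<in>free_module (B (Suc (Suc (Suc i)))). y = D (Suc (Suc i)) x))" for i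
  proof (rule kernel_image_transfer[OF T T])
    fix y :: "'b \<Rightarrow> ('v, 'k) mpolynomial"
    assume y: "y \<in> free_module (B (Suc (Suc i)))"
    have T0: "T i 0 = 0\<^sub>v (length (a i))" by (intro eq_vecI) (simp_all add: T_def coordinates_def)
    have "M i *\<^sub>v T (Suc i) y = 0\<^sub>v (length (a i)) \<longleftrightarrow> T i (D (Suc i) y) = T i 0"
      by (simp add: MT[OF y] T0)
    also have "\<dots> \<longleftrightarrow> D (Suc i) y = 0"
      by (rule inj_on_eq_iff[OF bij_betw_imp_inj_on[OF T] fv[OF y] free_module_0])
    finally show "(M i *\<^sub>v T (Suc i) y = 0\<^sub>v (length (a i))) = (D (Suc i) y \<in> null_vectors N (Suc i))"
      by (simp add: null_vectors_Suc)
  qed (fact MT fv)+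
  have carr: "f \<in> carrier_vec (length (a 0))" "\<forall>i. M i \<in> carrier_mat (length (a i)) (length (a (Suc i)))"
    by (simp_all add: f M)
  have all_nat: "(\<forall>i. Q i) \<longleftrightarrow> Q 0 \<and> (\<forall>i. Q (Suc i))" for Q :: "nat \<Rightarrow> bool"
    by (metis not0_implies_Suc)
  define E where "E i \<longleftrightarrow> (\<forall>y\<in>free_module (B (Suc i)). D i y \<in> null_vectors N i \<longleftrightarrow>
    (\<exists>x\<in>free_module (B (Suc (Suc i))). y = D (Suc i) x))" for i
  have res: "resolution B e N D \<longleftrightarrow> (\<forall>i. graded_map (B (Suc i)) (e (Suc i)) (B i) (e i) (D i)) \<and>
    (\<forall>y\<in>free_module (B 0). \<exists>x\<in>free_module (B (Suc 0)). y - D 0 x \<in> N) \<and> (\<forall>i. E i)"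
    unfolding E_def by (rule resolution_iff[of B e N D, OF fin N(2) fv])
  note ker = ker0[folded E_def] kerS[folded E_def]
  show iff: "graded_free_resolution I a f M \<longleftrightarrow> resolution B e N D"
    unfolding graded_free_resolution_def res grade[symmetric] surj ker all_nat[of E]
    using carr by blast
  have "(\<forall>l<length (a i). \<forall>k<length (a (Suc i)). M i $$ (l, k) \<in> irrelevant_ideal) \<longleftrightarrow>
    (\<forall>k\<in>B (Suc (Suc i)). \<forall>l\<in>B (Suc i). const_coeff (D (Suc i) (basis_vector k) l) = 0)" for i
  proof -
    have "(\<forall>l<length (a i). \<forall>k<length (a (Suc i)). M i $$ (l, k) \<in> irrelevant_ideal) \<longleftrightarrow>
        (\<forall>l<length (a i). \<forall>k<length (a (Suc i)). const_coeff (D (Suc i) (basis_vector (b (Suc i) k)) (b i l)) = 0)"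
      by (simp add: M irrelevant_ideal_iff)
    also have "\<dots> \<longleftrightarrow> (\<forall>l\<in>B (Suc i). \<forall>k\<in>B (Suc (Suc i)). const_coeff (D (Suc i) (basis_vector k) l) = 0)"
      by (rule b_all2[of i "\<lambda>k l. const_coeff (D (Suc i) (basis_vector k) l) = 0"])
    finally show ?thesis by blast
  qed
  thus "minimal_graded_free_resolution I a f M \<longleftrightarrow> resolution B e N D \<and> minimal_complex B D"
    unfolding minimal_graded_free_resolution_def iff minimal_complex_def by blast
qed

section \<open>Reading off the regularity from a resolution\<close>

text \<open>The ideal \<open>I\<close> as a submodule of the free module with the single basis element \<open>r\<close>.\<close>

definition ideal_vectors :: "'b \<Rightarrow> 'r::zero set \<Rightarrow> ('b \<Rightarrow> 'r) set" where
  "ideal_vectors r I = {x \<in> free_module {r}. x r \<in> I}"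

definition homogeneous_ideal :: "('v, 'k::comm_ring_1) mpolynomial set \<Rightarrow> bool" where
  "homogeneous_ideal I \<longleftrightarrow> ring_module.subspace I \<and> (\<forall>p\<in>I. \<forall>d. component d p \<in> I)"

lemma graded_submodule_ideal_vectors:
  assumes "homogeneous_ideal I" and "e r = 0"
  shows "graded_submodule e (ideal_vectors r I)"
  using assms unfolding graded_submodule_def homogeneous_ideal_def ring_module.subspace_def ideal_vectors_def
  by (auto simp: free_module_add free_module_scale free_module_vector_component vector_component_def free_module_def)

lemma minimal_resolution_as_matrices:
  fixes D :: "nat \<Rightarrow> ('b \<Rightarrow> ('v::finite, 'k::comm_ring_1) mpolynomial) \<Rightarrow> 'b \<Rightarrow> ('v, 'k) mpolynomial"
  assumes B0: "B 0 = {r}" "e 0 r = 0" and res: "resolution B e (ideal_vectors r I) D" and min: "minimal_complex B D"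
  shows "\<exists>a f M. minimal_graded_free_resolution I a f M \<and> (\<forall>i. set (a i) = e (Suc i) ` B (Suc i))"
proof -
  have "\<exists>b. bij_betw b {..<card (B (Suc i))} (B (Suc i))" for i
    using ex_bij_betw_nat_finite[OF resolutionD(1)[OF res, of "Suc i"]] by (simp add: atLeast0LessThan)
  then obtain b where b: "\<And>i. bij_betw (b i) {..<card (B (Suc i))} (B (Suc i))" by metis
  define a where "a i = map (\<lambda>k. e (Suc i) (b i k)) [0..<card (B (Suc i))]" for i
  have b': "bij_betw (b i) {..<length (a i)} (B (Suc i))" for i using b by (simp add: a_def)
  have lin: "linear_map (D i)" for i by (rule graded_mapD(1)[OF resolutionD(3)[OF res]])
  have fv: "D i x \<in> free_module (B i)" if "x \<in> free_module (B (Suc i))" for i x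
    by (rule graded_mapD(2)[OF resolutionD(3)[OF res] that])
  have "minimal_graded_free_resolution I a (vec (length (a 0)) (\<lambda>k. D 0 (basis_vector (b 0 k)) r))
     (\<lambda>i. mat (length (a i)) (length (a (Suc i))) (\<lambda>(l, k). D (Suc i) (basis_vector (b (Suc i) k)) (b i l)))
     \<longleftrightarrow> resolution B e (ideal_vectors r I) D \<and> minimal_complex B D"
  proof (rule graded_free_resolution_iff(2)[where B = B and D = D and e = e and b = b and r = r])
    show "graded_submodule (e 0) (ideal_vectors r I)" by (rule resolutionD(2)[OF res])
  qed (fact B0 b' lin fv ideal_vectors_def | simp add: a_def)+
  moreover have "set (a i) = e (Suc i) ` B (Suc i)" for i
    using bij_betw_imp_surj_on[OF b[of i]] by (simp add: a_def atLeast0LessThan image_image[symmetric])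
  ultimately show ?thesis using res min by blast
qed

lemma minimal_resolution_from_matrices:
  fixes I :: "('v::finite, 'k::comm_ring_1) mpolynomial set"
  assumes I: "homogeneous_ideal I" and min: "minimal_graded_free_resolution I a f M"
  shows "\<exists>B e D. B 0 = {0::nat} \<and> e 0 0 = 0 \<and> resolution B e (ideal_vectors 0 I) D \<and> minimal_complex B D \<and>
    (\<forall>i. B (Suc i) = {..<length (a i)}) \<and> (\<forall>i. e (Suc i) = (!) (a i))"
proof -
  define B where "B i = (case i of 0 \<Rightarrow> {0} | Suc j \<Rightarrow> {..<length (a j)})" for i
  define e where "e i = (case i of 0 \<Rightarrow> (\<lambda>_. 0) | Suc j \<Rightarrow> (!) (a j))" for i
  define c where "c i k l = (case i of 0 \<Rightarrow> if l = 0 then f $ k else 0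
     | Suc j \<Rightarrow> if l < length (a j) then M j $$ (l, k) else 0)" for i k l
  define D where "D i = extend_map (B (Suc i)) (c i)" for i
  have B: "B 0 = {0}" "B (Suc i) = {..<length (a i)}" for i by (simp_all add: B_def)
  have e: "e 0 0 = 0" "e (Suc i) = (!) (a i)" for i by (simp_all add: e_def)
  have f: "f \<in> carrier_vec (length (a 0))" and M: "\<And>i. M i \<in> carrier_mat (length (a i)) (length (a (Suc i)))"
    using min by (auto simp: minimal_graded_free_resolution_def graded_free_resolution_def)
  have c_fv: "c i k \<in> free_module (B i)" for i k
    by (cases i) (auto simp: c_def B_def free_module_def)
  have fv: "D i x \<in> free_module (B i)" for i x
    unfolding D_def extend_map_def by (intro free_module_sum free_module_scale c_fv)
  have lin: "linear_map (D i)" for i unfolding D_def by (rule linear_map_extend_map)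
  have D_unit: "D i (basis_vector k) = c i k" if "k < length (a i)" for i k
    unfolding D_def by (rule extend_map_unit) (use that in \<open>simp_all add: B\<close>)
  have "minimal_graded_free_resolution I a f M \<longleftrightarrow> resolution B e (ideal_vectors 0 I) D \<and> minimal_complex B D"
  proof (rule graded_free_resolution_iff(2)[where B = B and D = D and e = e and r = "0::nat" and b = "\<lambda>_ k. k"])
    show "graded_submodule (e 0) (ideal_vectors 0 I)"
      by (rule graded_submodule_ideal_vectors[OF I]) (rule e)
    show "bij_betw (\<lambda>k. k) {..<length (a i)} (B (Suc i))" for i by (simp add: B bij_betw_def)
    show "f = vec (length (a 0)) (\<lambda>k. D 0 (basis_vector k) 0)"
      using f by (intro eq_vecI) (simp_all add: D_unit c_def)
    show "M i = mat (length (a i)) (length (a (Suc i))) (\<lambda>(l, k). D (Suc i) (basis_vector k) l)" for i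
      using M[of i] by (intro eq_matI) (simp_all add: D_unit c_def)
  qed (simp_all add: B e ideal_vectors_def lin fv)
  thus ?thesis using min B e by blast
qed

lemma graded_map_transport:
  "graded_map {r} (e :: 'b \<Rightarrow> int) {s} (e' :: 'c \<Rightarrow> int)
    (\<lambda>x l. if l = s then x r else (0 :: ('v::finite, 'k::comm_ring_1) mpolynomial))"
  if "e r = e' s"
proof -
  have "linear_map (\<lambda>(x :: 'b \<Rightarrow> ('v, 'k) mpolynomial) l. if l = s then x r else 0)"
    by (rule linear_mapI) simp_all
  moreover have "homogeneous (d - e' s) (x r)" if "homogeneous_vector e d x" for d and x :: "'b \<Rightarrow> ('v, 'k) mpolynomial"
    using that \<open>e r = e' s\<close> unfolding homogeneous_vector_def by metis
  ultimately show ?thesis by (auto simp: graded_map_def free_module_def homogeneous_vector_def[of e'])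
qed

text \<open>Degrees of any minimal resolution occur in the given one, which gives the upper bound. For the
  lower bound, make the given resolution minimal. The generator \<open>k\<close> of degree \<open>r + c\<close> is not cancelled,
  as its partner would have to lie in the next stage, which is empty, or in the previous one, where all
  degrees are smaller than \<open>r + c\<close>.\<close>

theorem regularity_quotient_eqI:
  fixes I :: "('v::finite, 'k::field) mpolynomial set"
    and D :: "nat \<Rightarrow> ('b \<Rightarrow> ('v, 'k) mpolynomial) \<Rightarrow> 'b \<Rightarrow> ('v, 'k) mpolynomial"
  assumes I: "homogeneous_ideal I"
    and B0: "B 0 = {s}" "e 0 s = 0" and res: "resolution B e (ideal_vectors s I) D"
    and len: "\<And>i. i > c \<Longrightarrow> B (Suc i) = {}"
    and bound: "\<And>i k. k \<in> B (Suc i) \<Longrightarrow> e (Suc i) k \<le> r + int i"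
    and k: "k \<in> B (Suc c)" "e (Suc c) k = r + int c"
  shows "regularity_quotient I = ereal (real_of_int r)"
proof (rule antisym)
  have "j - int i \<le> r" if min: "minimal_graded_free_resolution I a f M" and j: "j \<in> set (a i)" for i j a f M
  proof -
    obtain B' e' D' where R': "B' 0 = {0::nat}" "e' 0 0 = 0" "resolution B' e' (ideal_vectors 0 I) D'" "minimal_complex B' D'"
      "\<And>i. B' (Suc i) = {..<length (a i)}" "\<And>i. e' (Suc i) = (!) (a i)"
      using minimal_resolution_from_matrices[OF I min] by blast
    obtain m where m: "m < length (a i)" "a i ! m = j" using j by (auto simp: in_set_conv_nth)
    \<comment> \<open>Both resolutions start with the ring, with different names for its basis element.\<close>
    define F where "F = (\<lambda>(x :: nat \<Rightarrow> ('v, 'k) mpolynomial) l. if l = s then x 0 else 0)"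
    define G where "G = (\<lambda>(x :: 'b \<Rightarrow> ('v, 'k) mpolynomial) l. if l = (0::nat) then x s else 0)"
    have F: "graded_map (B' 0) (e' 0) (B 0) (e 0) F" "F ` ideal_vectors 0 I \<subseteq> ideal_vectors s I"
      unfolding B0(1) R'(1) F_def by (rule graded_map_transport, simp add: B0 R') (auto simp: ideal_vectors_def free_module_def)
    have G: "graded_map (B 0) (e 0) (B' 0) (e' 0) G" "G ` ideal_vectors s I \<subseteq> ideal_vectors 0 I"
      unfolding B0(1) R'(1) G_def by (rule graded_map_transport, simp add: B0 R') (auto simp: ideal_vectors_def free_module_def)
    have GF: "G (F x) = x" if "x \<in> free_module (B' 0)" for x
      using that by (auto simp: F_def G_def R'(1) free_module_def fun_eq_iff)
    have "m \<in> B' (Suc i)" using m(1) R'(5) by simp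
    with minimal_degrees_subset[where f = F and g = G and k = m and i = i, OF R'(3,4) res F G GF]
    obtain l where "l \<in> B (Suc i)" "e (Suc i) l = e' (Suc i) m" by blast
    thus ?thesis using bound[of l i] m(2) R'(6) by simp
  qed
  hence "ereal (real_of_int (j - int i)) \<le> ereal (real_of_int r)"
    if "minimal_graded_free_resolution I a f M" "j \<in> set (a i)" for i j a f M
    using that by (simp only: ereal_less_eq of_int_le_iff)
  thus "regularity_quotient I \<le> ereal (real_of_int r)"
    unfolding regularity_quotient_def by (intro Sup_least) blast
next
  have "B i = {}" if "i > Suc c" for i using that len by (cases i) auto
  with minimal_resolution_exists[OF res, of "Suc c"]
  obtain B' D' where R': "resolution B' e (ideal_vectors s I) D'" "minimal_complex B' D'" "B' 0 = B 0"
    and partner: "\<forall>i. \<forall>k\<in>B i - B' i. \<exists>j>0. (j = Suc i \<or> i = Suc j) \<and> (\<exists>l\<in>B j. e j l = e i k)"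
    by metis
  have "k \<in> B' (Suc c)"
  proof (rule ccontr)
    assume "k \<notin> B' (Suc c)"
    with k(1) have "k \<in> B (Suc c) - B' (Suc c)" by simp
    with partner obtain j l where
      "j > 0" "j = Suc (Suc c) \<or> Suc c = Suc j" "l \<in> B j" "e j l = e (Suc c) k" by meson
    hence j: "j > 0" "j = Suc (Suc c) \<or> c = j" "l \<in> B j" "e j l = r + int c" using k(2) by auto
    have "j \<noteq> Suc (Suc c)" using j(3) len[of "Suc c"] by auto
    with j obtain j' where j': "c = Suc j'" "j = Suc j'" by (cases j) auto
    thus False using bound[of l j'] j by simp
  qed
  moreover have "B' 0 = {s}" using R'(3) B0(1) by simp
  ultimately obtain a f M where "minimal_graded_free_resolution I a f M" "r + int c \<in> set (a c)"
    using minimal_resolution_as_matrices[OF _ B0(2) R'(1,2)] k(2) by (metis imageI)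
  hence "ereal (real_of_int ((r + int c) - int c)) \<le> regularity_quotient I"
    unfolding regularity_quotient_def by (intro Sup_upper) blast
  thus "ereal (real_of_int r) \<le> regularity_quotient I" by simp
qed

section \<open>The mapping cone of multiplication by a variable\<close>

text \<open>Labels for the basis of a mapping cone. A cone is a sum of three modules whose bases are labelled
  again by this type, so that the construction can be iterated within one type. Stage \<open>0\<close> is the ring
  itself, with basis element \<open>Root\<close>.\<close>

datatype basis_label = Root | Scaled basis_label | Plain basis_label | Linking basis_label

definition cone_vector :: "(basis_label \<Rightarrow> 'r) \<Rightarrow> (basis_label \<Rightarrow> 'r) \<Rightarrow> (basis_label \<Rightarrow> 'r) \<Rightarrow> basis_label \<Rightarrow> 'r::zero" where
  "cone_vector p q w l = (case l of Root \<Rightarrow> 0 | Scaled k \<Rightarrow> p k | Plain k \<Rightarrow> q k | Linking k \<Rightarrow> w k)"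

abbreviation scaled_part :: "(basis_label \<Rightarrow> 'r) \<Rightarrow> basis_label \<Rightarrow> 'r" where
  "scaled_part z \<equiv> (\<lambda>k. z (Scaled k))"
abbreviation plain_part :: "(basis_label \<Rightarrow> 'r) \<Rightarrow> basis_label \<Rightarrow> 'r" where
  "plain_part z \<equiv> (\<lambda>k. z (Plain k))"
abbreviation linking_part :: "(basis_label \<Rightarrow> 'r) \<Rightarrow> basis_label \<Rightarrow> 'r" where
  "linking_part z \<equiv> (\<lambda>k. z (Linking k))"

lemma cone_vector_simps [simp]:
  "cone_vector p q w Root = 0" "cone_vector p q w (Scaled k) = p k" "cone_vector p q w (Plain k) = q k" "cone_vector p q w (Linking k) = w k"
  by (simp_all add: cone_vector_def)

lemma cone_vector_eqI:
  assumes "z Root = 0" "scaled_part z = p" "plain_part z = q" "linking_part z = w"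
  shows "z = cone_vector p q w"
proof
  fix l show "z l = cone_vector p q w l" using assms by (cases l) auto
qed

lemma cone_vector_parts_eq_0: "cone_vector 0 0 0 = (0 :: basis_label \<Rightarrow> 'r::ab_group_add)"
  by (rule cone_vector_eqI[symmetric]) (auto simp: fun_eq_iff)

lemma cone_vector_eq_0_iff: "cone_vector p q w = 0 \<longleftrightarrow> p = 0 \<and> q = 0 \<and> w = (0 :: basis_label \<Rightarrow> 'r::ab_group_add)"
  by (metis (no_types, lifting) ext cone_vector_parts_eq_0 cone_vector_simps(2-4))

lemma linear_map_part: "linear_map (\<lambda>z k. z (c k))"
  by (rule linear_mapI) simp_all

lemma linear_map_neg: "linear_map L \<Longrightarrow> linear_map (\<lambda>x. - L x)"
  by (rule linear_mapI) (simp_all add: linear_map_def)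

lemma linear_map_cone_vector:
  assumes "linear_map P" "linear_map Q" "linear_map W"
  shows "linear_map (\<lambda>z. cone_vector (P z) (Q z) (W z))"
proof (rule linear_mapI)
  show "cone_vector (P (x + y)) (Q (x + y)) (W (x + y)) l = cone_vector (P x) (Q x) (W x) l + cone_vector (P y) (Q y) (W y) l" for x y l
    unfolding linear_map_add[OF assms(1)] linear_map_add[OF assms(2)] linear_map_add[OF assms(3)]
    by (cases l) simp_all
  show "cone_vector (P (scale c x)) (Q (scale c x)) (W (scale c x)) l = c * cone_vector (P x) (Q x) (W x) l" for c x l
    unfolding linear_map_scale[OF assms(1)] linear_map_scale[OF assms(2)] linear_map_scale[OF assms(3)]
    by (cases l) simp_all
qed

text \<open>Stage \<open>0\<close> of the complex that is shifted into the cone is left out: there the ring stands for the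
  target of the augmentation and is not a part of the resolution.\<close>

definition above_root :: "(nat \<Rightarrow> 'b set) \<Rightarrow> nat \<Rightarrow> 'b set" where
  "above_root B i = (if i = 0 then {} else B i)"

text \<open>For \<open>i > 0\<close>, stage \<open>i\<close> of the cone is \<open>C\<^sub>i(-1) \<oplus> B\<^sub>i \<oplus> B\<^bsub>i-1\<^esub>(-1)\<close>, where \<open>B\<close> resolves the smaller ideal \<open>I\<^sub>1\<close> and
  \<open>C\<close> the larger ideal \<open>I\<^sub>2\<close>.\<close>

definition cone_basis :: "(nat \<Rightarrow> basis_label set) \<Rightarrow> (nat \<Rightarrow> basis_label set) \<Rightarrow> nat \<Rightarrow> basis_label set" where
  "cone_basis B C i = (case i of 0 \<Rightarrow> {Root}
     | Suc j \<Rightarrow> Scaled ` C (Suc j) \<union> Plain ` B (Suc j) \<union> Linking ` above_root B j)"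

definition cone_degree :: "(nat \<Rightarrow> basis_label \<Rightarrow> int) \<Rightarrow> (nat \<Rightarrow> basis_label \<Rightarrow> int) \<Rightarrow> nat \<Rightarrow> basis_label \<Rightarrow> int" where
  "cone_degree e g i l = (case l of Root \<Rightarrow> 0 | Scaled k \<Rightarrow> g i k + 1 | Plain k \<Rightarrow> e i k | Linking k \<Rightarrow> e (i - 1) k + 1)"

lemma free_module_cone_basis:
  "z \<in> free_module (cone_basis B C (Suc i)) \<longleftrightarrow> z Root = 0 \<and> scaled_part z \<in> free_module (C (Suc i)) \<and>
    plain_part z \<in> free_module (B (Suc i)) \<and> linking_part z \<in> free_module (above_root B i)"
proof
  assume z: "z \<in> free_module (cone_basis B C (Suc i))"
  thus "z Root = 0 \<and> scaled_part z \<in> free_module (C (Suc i)) \<and>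
    plain_part z \<in> free_module (B (Suc i)) \<and> linking_part z \<in> free_module (above_root B i)"
    by (auto simp: free_module_def cone_basis_def)
next
  assume z: "z Root = 0 \<and> scaled_part z \<in> free_module (C (Suc i)) \<and>
    plain_part z \<in> free_module (B (Suc i)) \<and> linking_part z \<in> free_module (above_root B i)"
  show "z \<in> free_module (cone_basis B C (Suc i))"
    unfolding free_module_def
  proof (intro CollectI allI impI)
    fix l assume "l \<notin> cone_basis B C (Suc i)"
    thus "z l = 0" using z by (cases l) (auto simp: free_module_def cone_basis_def)
  qed
qed

lemma homogeneous_vector_cone_degree:
  "homogeneous_vector (cone_degree e g i) d z \<longleftrightarrow> homogeneous d (z Root) \<and> homogeneous_vector (g i) (d - 1) (scaled_part z) \<and>
    homogeneous_vector (e i) d (plain_part z) \<and> homogeneous_vector (e (i - 1)) (d - 1) (linking_part z)"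
proof
  assume z: "homogeneous_vector (cone_degree e g i) d z"
  have "homogeneous (d - cone_degree e g i l) (z l)" for l using z by (simp add: homogeneous_vector_def)
  from this[of Root] this[of "Scaled _"] this[of "Plain _"] this[of "Linking _"]
  show "homogeneous d (z Root) \<and> homogeneous_vector (g i) (d - 1) (scaled_part z) \<and>
    homogeneous_vector (e i) d (plain_part z) \<and> homogeneous_vector (e (i - 1)) (d - 1) (linking_part z)"
    by (simp add: homogeneous_vector_def cone_degree_def diff_diff_eq add.commute)
next
  assume z: "homogeneous d (z Root) \<and> homogeneous_vector (g i) (d - 1) (scaled_part z) \<and>
    homogeneous_vector (e i) d (plain_part z) \<and> homogeneous_vector (e (i - 1)) (d - 1) (linking_part z)"
  show "homogeneous_vector (cone_degree e g i) d z"
    unfolding homogeneous_vector_def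
  proof
    fix l show "homogeneous (d - cone_degree e g i l) (z l)"
      using z by (cases l) (simp_all add: homogeneous_vector_def cone_degree_def diff_diff_eq add.commute)
  qed
qed

text \<open>Exactness of \<open>0 \<rightarrow> R/I\<^sub>1(-1) \<rightarrow> R/I\<^sub>2(-1) \<oplus> R/I\<^sub>1 \<rightarrow> R/J \<rightarrow> 0\<close>, carried out on resolutions. Let \<open>\<alpha>\<close> lift the
  projection \<open>R/I\<^sub>1 \<rightarrow> R/I\<^sub>2\<close>. The first map of the sequence lifts to \<open>w \<mapsto> (\<alpha> w, - x w)\<close>, and the cone of this
  lift has the differential \<open>(c, b, w) \<mapsto> (E c + \<alpha> w, D b - x w, - D w)\<close>; its augmentation is
  \<open>(c, b) \<mapsto> x c + b\<close>. That \<open>x\<close> is a nonzerodivisor modulo \<open>I\<^sub>1\<close> gives exactness at stage \<open>2\<close>.\<close>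

lemma cone_resolution:
  fixes x :: "('v::finite, 'k::comm_ring_1) mpolynomial"
  assumes x: "homogeneous 1 x" and I12: "I1 \<subseteq> I2" and nzd: "\<And>p. x * p \<in> I1 \<Longrightarrow> p \<in> I1"
    and J: "J = {x * s + t | s t. s \<in> I2 \<and> t \<in> I1}"
    and id: "homogeneous_ideal I1" "homogeneous_ideal I2" "homogeneous_ideal J"
    and B: "B 0 = {Root}" "e 0 Root = 0" "resolution B e (ideal_vectors Root I1) D"
    and C: "C 0 = {Root}" "g 0 Root = 0" "resolution C g (ideal_vectors Root I2) E"
  shows "\<exists>F. resolution (cone_basis B C) (cone_degree e g) (ideal_vectors Root J) F"
proof -
  have sub1: "ring_module.subspace I1" and sub2: "ring_module.subspace I2"
    using id by (auto simp: homogeneous_ideal_def)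
  have gD: "graded_map (B (Suc i)) (e (Suc i)) (B i) (e i) (D i)" for i by (rule resolutionD(3)[OF B(3)])
  have gE: "graded_map (C (Suc i)) (g (Suc i)) (C i) (g i) (E i)" for i by (rule resolutionD(3)[OF C(3)])
  have linD: "linear_map (D i)" for i by (rule graded_mapD(1)[OF gD])
  have linE: "linear_map (E i)" for i by (rule graded_mapD(1)[OF gE])
  note fvD = graded_mapD(2)[OF gD] and fvE = graded_mapD(2)[OF gE]
  have "resolution B e (ideal_vectors Root I1) D \<longleftrightarrow> (\<forall>i. graded_map (B (Suc i)) (e (Suc i)) (B i) (e i) (D i)) \<and>
      (\<forall>y\<in>free_module (B 0). \<exists>x\<in>free_module (B (Suc 0)). y - D 0 x \<in> ideal_vectors Root I1) \<and>
      (\<forall>i. \<forall>y\<in>free_module (B (Suc i)). D i y \<in> null_vectors (ideal_vectors Root I1) i \<longleftrightarrow> (\<exists>x\<in>free_module (B (Suc (Suc i))). y = D (Suc i) x))"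
    by (rule resolution_iff[of B e "ideal_vectors Root I1" D, OF resolutionD(1,2)[OF B(3)] fvD])
  hence D: "\<And>y. y \<in> free_module (B 0) \<Longrightarrow> \<exists>x\<in>free_module (B (Suc 0)). y - D 0 x \<in> ideal_vectors Root I1"
    "\<And>i y. y \<in> free_module (B (Suc i)) \<Longrightarrow> D i y \<in> null_vectors (ideal_vectors Root I1) i \<longleftrightarrow> (\<exists>x\<in>free_module (B (Suc (Suc i))). y = D (Suc i) x)"
    using B(3) by blast+
  have "resolution C g (ideal_vectors Root I2) E \<longleftrightarrow> (\<forall>i. graded_map (C (Suc i)) (g (Suc i)) (C i) (g i) (E i)) \<and>
      (\<forall>y\<in>free_module (C 0). \<exists>x\<in>free_module (C (Suc 0)). y - E 0 x \<in> ideal_vectors Root I2) \<and>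
      (\<forall>i. \<forall>y\<in>free_module (C (Suc i)). E i y \<in> null_vectors (ideal_vectors Root I2) i \<longleftrightarrow> (\<exists>x\<in>free_module (C (Suc (Suc i))). y = E (Suc i) x))"
    by (rule resolution_iff[of C g "ideal_vectors Root I2" E, OF resolutionD(1,2)[OF C(3)] fvE])
  hence E: "\<And>i y. y \<in> free_module (C (Suc i)) \<Longrightarrow> E i y \<in> null_vectors (ideal_vectors Root I2) i \<longleftrightarrow> (\<exists>x\<in>free_module (C (Suc (Suc i))). y = E (Suc i) x)"
    using C(3) by blast
  have D0: "D 0 y Root \<in> I1 \<longleftrightarrow> (\<exists>x\<in>free_module (B (Suc (Suc 0))). y = D (Suc 0) x)" if "y \<in> free_module (B (Suc 0))" for y
    using D(2)[OF that] fvD[OF that] B(1) by (simp add: null_vectors_def ideal_vectors_def)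
  have DS: "D (Suc i) y = 0 \<longleftrightarrow> (\<exists>x\<in>free_module (B (Suc (Suc (Suc i)))). y = D (Suc (Suc i)) x)" if "y \<in> free_module (B (Suc (Suc i)))" for i y
    using D(2)[OF that] by (simp add: null_vectors_Suc)
  have E0: "E 0 y Root \<in> I2 \<longleftrightarrow> (\<exists>x\<in>free_module (C (Suc (Suc 0))). y = E (Suc 0) x)" if "y \<in> free_module (C (Suc 0))" for y
    using E[OF that] fvE[OF that] C(1) by (simp add: null_vectors_def ideal_vectors_def)
  have ES: "E (Suc i) y = 0 \<longleftrightarrow> (\<exists>x\<in>free_module (C (Suc (Suc (Suc i)))). y = E (Suc (Suc i)) x)" if "y \<in> free_module (C (Suc (Suc i)))" for i y
    using E[OF that] by (simp add: null_vectors_Suc)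
  have surj: "\<exists>w\<in>free_module (B (Suc 0)). p - D 0 w Root \<in> I1" for p
  proof -
    have "(\<lambda>l. if l = Root then p else 0) \<in> free_module (B 0)" by (simp add: free_module_def B(1))
    from D(1)[OF this] show ?thesis by (auto simp: ideal_vectors_def)
  qed

  have deg: "homogeneous (d - g 0 l) (y l)"
    if "y \<in> free_module {Root}" "homogeneous_vector (e 0) d y" for d l and y :: "basis_label \<Rightarrow> ('v, 'k) mpolynomial"
  proof (cases "l = Root")
    case True
    thus ?thesis using that(2) B(2) C(2) unfolding homogeneous_vector_def by metis
  next
    case False
    thus ?thesis using that(1) by (simp add: free_module_def)
  qed
  have gid: "graded_map (B 0) (e 0) (C 0) (g 0) (\<lambda>y :: basis_label \<Rightarrow> ('v, 'k) mpolynomial. y)"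
    unfolding B(1) C(1) graded_map_def homogeneous_vector_def[of "g 0"]
    by (intro conjI linear_map_id allI ballI impI) (assumption, rule deg, assumption+)
  have Nid: "(\<lambda>y :: basis_label \<Rightarrow> ('v, 'k) mpolynomial. y) ` ideal_vectors Root I1 \<subseteq> ideal_vectors Root I2"
    using I12 by (auto simp: ideal_vectors_def)
  obtain \<alpha> where \<alpha>: "\<alpha> 0 = (\<lambda>y. y)" "\<And>i. graded_map (B i) (e i) (C i) (g i) (\<alpha> i)"
    "\<And>i y. y \<in> free_module (B (Suc i)) \<Longrightarrow> \<alpha> i (D i y) - E i (\<alpha> (Suc i) y) \<in> null_vectors (ideal_vectors Root I2) i"
    using comparison_map[OF B(3) C(3) gid Nid] by blast
  have lin\<alpha>: "linear_map (\<alpha> i)" for i by (rule graded_mapD(1)[OF \<alpha>(2)])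
  note fv\<alpha> = graded_mapD(2)[OF \<alpha>(2)]
  have \<alpha>0: "D 0 y Root - E 0 (\<alpha> (Suc 0) y) Root \<in> I2" if "y \<in> free_module (B (Suc 0))" for y
    using \<alpha>(3)[OF that] by (simp add: \<alpha>(1) null_vectors_def ideal_vectors_def)
  have \<alpha>S: "E (Suc i) (\<alpha> (Suc (Suc i)) y) = \<alpha> (Suc i) (D (Suc i) y)" if "y \<in> free_module (B (Suc (Suc i)))" for i y
    using \<alpha>(3)[OF that] by (simp add: null_vectors_Suc)

  define F where "F i z = (case i of
      0 \<Rightarrow> (\<lambda>l. if l = Root then x * E 0 (scaled_part z) Root + D 0 (plain_part z) Root else 0)
    | Suc j \<Rightarrow> cone_vector (E (Suc j) (scaled_part z) + \<alpha> (Suc j) (linking_part z))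
        (D (Suc j) (plain_part z) - scale x (linking_part z)) (if j = 0 then 0 else - D j (linking_part z)))" for i z
  have F0: "F 0 z = (\<lambda>l. if l = Root then x * E 0 (scaled_part z) Root + D 0 (plain_part z) Root else 0)" for z
    by (simp add: F_def)
  have FS: "F (Suc j) z = cone_vector (E (Suc j) (scaled_part z) + \<alpha> (Suc j) (linking_part z))
        (D (Suc j) (plain_part z) - scale x (linking_part z)) (if j = 0 then 0 else - D j (linking_part z))" for j z
    by (simp add: F_def)
  let ?G = "cone_basis B C" and ?h = "cone_degree e g"
  have G0: "?G 0 = {Root}" by (simp add: cone_basis_def)
  have finG: "finite (?G i)" for i
    using resolutionD(1)[OF B(3)] resolutionD(1)[OF C(3)]
    by (cases i) (simp_all add: cone_basis_def above_root_def)
  have above: "above_root B 0 = {}" "above_root B (Suc i) = B (Suc i)" for i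
    by (simp_all add: above_root_def)
  have parts: "scaled_part z \<in> free_module (C (Suc i))" "plain_part z \<in> free_module (B (Suc i))"
    "linking_part z \<in> free_module (above_root B i)" "z Root = 0" if "z \<in> free_module (?G (Suc i))" for z i
    using that by (simp_all add: free_module_cone_basis)
  have link0: "linking_part z = 0" if "z \<in> free_module (?G (Suc 0))" for z
    using parts(3)[OF that] by (auto simp: above free_module_def fun_eq_iff)

  have linF: "linear_map (F i)" for i
  proof (cases i)
    case 0
    have "linear_map (\<lambda>z. F 0 z)"
    proof (rule linear_mapI)
      note a = linear_map_comp[OF linE linear_map_part[of Scaled]] linear_map_comp[OF linD linear_map_part[of Plain]]
      show "F 0 (y + z) l = F 0 y l + F 0 z l" for y z l
        using linear_map_add[OF a(1)[of 0], of y z] linear_map_add[OF a(2)[of 0], of y z]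
        unfolding F0 by (simp add: distrib_left)
      show "F 0 (scale c z) l = c * F 0 z l" for c z l
        using linear_map_scale[OF a(1)[of 0], of c z] linear_map_scale[OF a(2)[of 0], of c z]
        unfolding F0 by (simp add: distrib_left mult.left_commute)
    qed
    thus ?thesis using 0 by simp
  next
    case (Suc j)
    have W: "linear_map (\<lambda>z. if j = 0 then 0 else - D j (linking_part z))"
    proof (cases "j = 0")
      case True
      show ?thesis unfolding True if_P[OF refl] by (rule linear_map_zero)
    next
      case False
      show ?thesis unfolding if_not_P[OF False]
        by (rule linear_map_neg[OF linear_map_comp[OF linD linear_map_part[of Linking]]])
    qed
    have "linear_map (\<lambda>z. cone_vector (E (Suc j) (scaled_part z) + \<alpha> (Suc j) (linking_part z))
        (D (Suc j) (plain_part z) - scale x (linking_part z)) (if j = 0 then 0 else - D j (linking_part z)))"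
      by (rule linear_map_cone_vector[OF linear_map_plus[OF linear_map_comp[OF linE linear_map_part] linear_map_comp[OF lin\<alpha> linear_map_part]]
            linear_map_minus[OF linear_map_comp[OF linD linear_map_part] linear_map_scaled[OF linear_map_part]] W])
    thus ?thesis unfolding Suc by (simp add: FS[abs_def])
  qed
  have fvF: "F i z \<in> free_module (?G i)" if z: "z \<in> free_module (?G (Suc i))" for i z
  proof (cases i)
    case 0
    thus ?thesis by (simp add: F0 G0 free_module_def)
  next
    case (Suc j)
    have L: "linking_part z \<in> free_module (B (Suc j))" using parts(3)[OF z] by (simp add: Suc above)
    have "E (Suc j) (scaled_part z) + \<alpha> (Suc j) (linking_part z) \<in> free_module (C (Suc j))"
      using parts(1)[OF z] fvE fv\<alpha> L unfolding Suc by (intro free_module_add) blast+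
    moreover have "D (Suc j) (plain_part z) - scale x (linking_part z) \<in> free_module (B (Suc j))"
      using parts(2)[OF z] fvD L unfolding Suc by (intro free_module_diff free_module_scale) blast+
    moreover have "(if j = 0 then 0 else - D j (linking_part z)) \<in> free_module (above_root B j)"
      using fvD[OF L] by (cases j) (simp_all add: above free_module_uminus)
    ultimately show ?thesis unfolding Suc FS free_module_cone_basis cone_vector_simps by blast
  qed
  have hF: "homogeneous_vector (?h i) d (F i z)" if z: "z \<in> free_module (?G (Suc i))" and h: "homogeneous_vector (?h (Suc i)) d z" for i z d
  proof -
    have hz: "homogeneous_vector (g (Suc i)) (d - 1) (scaled_part z)" "homogeneous_vector (e (Suc i)) d (plain_part z)"
      "homogeneous_vector (e i) (d - 1) (linking_part z)" using h by (simp_all add: homogeneous_vector_cone_degree)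
    have hE: "homogeneous_vector (g i) (d - 1) (E i (scaled_part z))" by (rule graded_mapD(3)[OF gE parts(1)[OF z] hz(1)])
    have hD: "homogeneous_vector (e i) d (D i (plain_part z))" by (rule graded_mapD(3)[OF gD parts(2)[OF z] hz(2)])
    show ?thesis
    proof (cases i)
      case 0
      have "homogeneous (d - 1) (E 0 (scaled_part z) Root)" "homogeneous d (D 0 (plain_part z) Root)"
        using hE hD unfolding 0 homogeneous_vector_def by (metis C(2) diff_zero, metis B(2) diff_zero)
      from homogeneous_add[OF homogeneous_mult[OF x this(1), simplified] this(2)]
      have "homogeneous d (F 0 z Root)" by (simp add: F0)
      moreover have "F 0 z l = 0" if "l \<noteq> Root" for l using that by (simp add: F0)
      ultimately have "homogeneous (d - ?h 0 l) (F 0 z l)" for l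
        by (cases "l = Root") (simp_all add: cone_degree_def)
      thus ?thesis unfolding 0 homogeneous_vector_def by blast
    next
      case (Suc j)
      have L: "linking_part z \<in> free_module (B (Suc j))" using parts(3)[OF z] by (simp add: Suc above)
      have "homogeneous_vector (g (Suc j)) (d - 1) (E (Suc j) (scaled_part z) + \<alpha> (Suc j) (linking_part z))"
        using hE graded_mapD(3)[OF \<alpha>(2) L] hz(3) unfolding Suc by (intro homogeneous_vector_add) blast+
      moreover have "homogeneous_vector (e (Suc j)) d (D (Suc j) (plain_part z) - scale x (linking_part z))"
        using hD hz(3) unfolding Suc by (intro homogeneous_vector_diff homogeneous_vector_scale[OF x]) auto
      moreover have "homogeneous_vector (e j) (d - 1) (if j = 0 then 0 else - D j (linking_part z))"
        using graded_mapD(3)[OF gD L] hz(3) unfolding Suc by (simp add: homogeneous_vector_uminus)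
      ultimately show ?thesis unfolding Suc FS homogeneous_vector_cone_degree cone_vector_simps diff_Suc_1
        using homogeneous_0 by blast
    qed
  qed
  have gF: "graded_map (?G (Suc i)) (?h (Suc i)) (?G i) (?h i) (F i)" for i
    unfolding graded_map_def using linF fvF hF by blast

  have surjF: "\<exists>z\<in>free_module (?G (Suc 0)). y - F 0 z \<in> ideal_vectors Root J" if y: "y \<in> free_module (?G 0)" for y
  proof -
    obtain w where w: "w \<in> free_module (B (Suc 0))" "y Root - D 0 w Root \<in> I1" using surj by blast
    let ?z = "cone_vector 0 w 0"
    have z: "?z \<in> free_module (?G (Suc 0))" unfolding free_module_cone_basis cone_vector_simps using w(1) free_module_0 by blast
    have "x * 0 + (y Root - D 0 w Root) \<in> J"
      unfolding J using w(2) ring_module.subspace_0[OF sub2] by blast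
    moreover have "F 0 ?z Root = D 0 w Root"
      unfolding F0 cone_vector_simps using linear_map_0[OF linE[of 0]] by simp
    ultimately have "y - F 0 ?z \<in> ideal_vectors Root J"
      using free_module_diff[OF y fvF[OF z]] G0 by (simp add: ideal_vectors_def)
    with z show ?thesis by blast
  qed

  have exF: "F i y \<in> null_vectors (ideal_vectors Root J) i \<longleftrightarrow> (\<exists>z\<in>free_module (?G (Suc (Suc i))). y = F (Suc i) z)"
    if y: "y \<in> free_module (?G (Suc i))" for i y
  proof (cases i)
    case 0
    note p = parts[OF y[unfolded 0]]
    let ?c = "scaled_part y" and ?b = "plain_part y"
    have mem: "F 0 y \<in> null_vectors (ideal_vectors Root J) 0 \<longleftrightarrow> x * E 0 ?c Root + D 0 ?b Root \<in> J"
      using fvF[OF y[unfolded 0]] G0 by (simp add: null_vectors_def ideal_vectors_def F0)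
    show ?thesis unfolding 0 mem
    proof
      assume "x * E 0 ?c Root + D 0 ?b Root \<in> J"
      then obtain s t where st: "s \<in> I2" "t \<in> I1" "x * E 0 ?c Root + D 0 ?b Root = x * s + t"
        unfolding J by blast
      \<comment> \<open>Modulo \<open>I\<^sub>1\<close>, \<open>w\<close> represents \<open>E c - s\<close>; then \<open>b + x w\<close> is a cycle for \<open>I\<^sub>1\<close> and \<open>c - \<alpha> w\<close> is
        one for \<open>I\<^sub>2\<close>.\<close>
      obtain w where w: "w \<in> free_module (B (Suc 0))" "(E 0 ?c Root - s) - D 0 w Root \<in> I1" using surj by blast
      have "D 0 (?b + scale x w) Root = D 0 ?b Root + x * D 0 w Root"
        by (simp add: linear_map_add[OF linD] linear_map_scale[OF linD])
      also have "D 0 ?b Root = t - x * (E 0 ?c Root - s)"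
        using st(3) by (simp add: algebra_simps)
      also have "t - x * (E 0 ?c Root - s) + x * D 0 w Root = t - x * ((E 0 ?c Root - s) - D 0 w Root)"
        by (simp add: algebra_simps)
      also have "\<dots> \<in> I1"
        by (rule ring_module.subspace_diff[OF sub1 st(2) ring_module.subspace_scale[OF sub1 w(2)]])
      finally obtain b' where b': "b' \<in> free_module (B (Suc (Suc 0)))" "?b + scale x w = D (Suc 0) b'"
        using D0[of "?b + scale x w"] free_module_add[OF p(2) free_module_scale[OF w(1)]] by blast
      have "E 0 (?c - \<alpha> (Suc 0) w) Root = E 0 ?c Root - E 0 (\<alpha> (Suc 0) w) Root"
        by (simp add: linear_map_diff[OF linE])
      also have "\<dots> = ((E 0 ?c Root - s) - D 0 w Root) + s + (D 0 w Root - E 0 (\<alpha> (Suc 0) w) Root)" by simp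
      also have "\<dots> \<in> I2"
        using w(2) I12 st(1) \<alpha>0[OF w(1)] by (intro ring_module.subspace_add[OF sub2]) blast+
      finally obtain c' where c': "c' \<in> free_module (C (Suc (Suc 0)))" "?c - \<alpha> (Suc 0) w = E (Suc 0) c'"
        using E0[of "?c - \<alpha> (Suc 0) w"] free_module_diff[OF p(1) fv\<alpha>[OF w(1)]] by blast
      let ?z = "cone_vector c' b' w"
      have z: "?z \<in> free_module (?G (Suc (Suc 0)))" unfolding free_module_cone_basis above cone_vector_simps using c' b' w by blast
      have r1: "E (Suc 0) c' + \<alpha> (Suc 0) w = ?c" using c'(2) by (metis diff_add_cancel)
      have r2: "D (Suc 0) b' - scale x w = ?b" using b'(2) by (metis add_diff_cancel_right')
      have "F (Suc 0) ?z = cone_vector ?c ?b 0" unfolding FS cone_vector_simps r1 r2 by simp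
      also have "\<dots> = y" by (rule cone_vector_eqI[symmetric]) (rule p(4) refl link0[OF y[unfolded 0]])+
      finally show "\<exists>z\<in>free_module (?G (Suc (Suc 0))). y = F (Suc 0) z" using z by metis
    next
      assume "\<exists>z\<in>free_module (?G (Suc (Suc 0))). y = F (Suc 0) z"
      then obtain z where z: "z \<in> free_module (?G (Suc (Suc 0)))" "y = F (Suc 0) z" by blast
      note q = parts[OF z(1)]
      let ?c' = "scaled_part z" and ?b' = "plain_part z" and ?w = "linking_part z"
      have w: "?w \<in> free_module (B (Suc 0))" using q(3) by (simp add: above)
      have cb: "?c = E (Suc 0) ?c' + \<alpha> (Suc 0) ?w" "?b = D (Suc 0) ?b' - scale x ?w"
        unfolding z(2) FS cone_vector_simps by (rule refl)+
      have "E 0 (E (Suc 0) ?c') Root \<in> I2" using E0[OF fvE[OF q(1)]] q(1) by blast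
      moreover note \<alpha>0[OF w]
      ultimately have "E 0 (E (Suc 0) ?c') Root - (D 0 ?w Root - E 0 (\<alpha> (Suc 0) ?w) Root) \<in> I2"
        by (rule ring_module.subspace_diff[OF sub2])
      moreover have "D 0 (D (Suc 0) ?b') Root \<in> I1" using D0[OF fvD[OF q(2)]] q(2) by blast
      ultimately have "x * (E 0 (E (Suc 0) ?c') Root - (D 0 ?w Root - E 0 (\<alpha> (Suc 0) ?w) Root)) + D 0 (D (Suc 0) ?b') Root \<in> J"
        unfolding J by blast
      also have "x * (E 0 (E (Suc 0) ?c') Root - (D 0 ?w Root - E 0 (\<alpha> (Suc 0) ?w) Root)) + D 0 (D (Suc 0) ?b') Root
         = x * E 0 ?c Root + D 0 ?b Root"
        unfolding cb by (simp add: linear_map_add[OF linE] linear_map_diff[OF linD] linear_map_scale[OF linD] algebra_simps)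
      finally show "x * E 0 ?c Root + D 0 ?b Root \<in> J" .
    qed
  next
    case (Suc j)
    note y = y[unfolded Suc]
    note p = parts[OF y]
    let ?c = "scaled_part y" and ?b = "plain_part y" and ?w = "linking_part y"
    have w: "?w \<in> free_module (B (Suc j))" using p(3) by (simp add: above)
    have mem: "F (Suc j) y \<in> null_vectors (ideal_vectors Root J) (Suc j) \<longleftrightarrow>
       E (Suc j) ?c + \<alpha> (Suc j) ?w = 0 \<and> D (Suc j) ?b - scale x ?w = 0 \<and> (j \<noteq> 0 \<longrightarrow> D j ?w = 0)"
      by (simp add: null_vectors_Suc FS cone_vector_eq_0_iff)
    show ?thesis unfolding Suc mem
    proof (intro iffI; (elim conjE)?)
      assume a: "E (Suc j) ?c + \<alpha> (Suc j) ?w = 0" "D (Suc j) ?b - scale x ?w = 0" "j \<noteq> 0 \<longrightarrow> D j ?w = 0"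
      \<comment> \<open>The third component is a cycle; at the lowest stage this follows from \<open>x w = D b\<close>, because \<open>x\<close> is a
        nonzerodivisor modulo \<open>I\<^sub>1\<close>.\<close>
      have "\<exists>w'\<in>free_module (B (Suc (Suc j))). ?w = D (Suc j) w'"
      proof (cases j)
        case 0
        have "x * D 0 ?w Root = D 0 (scale x ?w) Root" by (simp add: linear_map_scale[OF linD])
        also have "scale x ?w = D (Suc 0) ?b" using a(2) 0 by simp
        also have "D 0 (D (Suc 0) ?b) Root \<in> I1"
          using D0[OF fvD[OF p(2)[unfolded 0]]] p(2)[unfolded 0] by blast
        finally have "D 0 ?w Root \<in> I1" by (rule nzd)
        thus ?thesis using D0[OF w[unfolded 0]] unfolding 0 by blast
      next
        case (Suc j')
        thus ?thesis using a(3) DS[OF w[unfolded Suc]] by blast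
      qed
      then obtain w' where w': "w' \<in> free_module (B (Suc (Suc j)))" "?w = D (Suc j) w'" by blast
      have "E (Suc j) (?c + \<alpha> (Suc (Suc j)) w') = 0"
        using a(1) unfolding linear_map_add[OF linE] \<alpha>S[OF w'(1)] w'(2) .
      then obtain c' where c': "c' \<in> free_module (C (Suc (Suc (Suc j))))" "?c + \<alpha> (Suc (Suc j)) w' = E (Suc (Suc j)) c'"
        using ES[of "?c + \<alpha> (Suc (Suc j)) w'"] free_module_add[OF p(1) fv\<alpha>[OF w'(1)]] by blast
      have "D (Suc j) (?b - scale x w') = 0"
        using a(2) unfolding linear_map_diff[OF linD] linear_map_scale[OF linD] w'(2) .
      then obtain b' where b': "b' \<in> free_module (B (Suc (Suc (Suc j))))" "?b - scale x w' = D (Suc (Suc j)) b'"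
        using DS[of "?b - scale x w'"] free_module_diff[OF p(2) free_module_scale[OF w'(1)]] by blast
      let ?z = "cone_vector c' b' (- w')"
      have z: "?z \<in> free_module (?G (Suc (Suc (Suc j))))"
        unfolding free_module_cone_basis above cone_vector_simps using c' b' free_module_uminus[OF w'(1)] by blast
      have r1: "E (Suc (Suc j)) c' + \<alpha> (Suc (Suc j)) (- w') = ?c"
        unfolding c'(2)[symmetric] linear_map_uminus[OF lin\<alpha>] by simp
      have r2: "D (Suc (Suc j)) b' - scale x (- w') = ?b"
        unfolding b'(2)[symmetric] by (rule ext) simp
      have r3: "- D (Suc j) (- w') = ?w" unfolding w'(2) linear_map_uminus[OF linD] by simp
      have "F (Suc (Suc j)) ?z = cone_vector ?c ?b ?w" unfolding FS cone_vector_simps r1 r2 r3 by simp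
      also have "\<dots> = y" by (rule cone_vector_eqI[symmetric]) (rule p(4) refl)+
      finally show "\<exists>z\<in>free_module (?G (Suc (Suc (Suc j)))). y = F (Suc (Suc j)) z" using z by metis
    next
      assume "\<exists>z\<in>free_module (?G (Suc (Suc (Suc j)))). y = F (Suc (Suc j)) z"
      then obtain z where z: "z \<in> free_module (?G (Suc (Suc (Suc j))))" "y = F (Suc (Suc j)) z" by blast
      note q = parts[OF z(1)]
      let ?c' = "scaled_part z" and ?b' = "plain_part z" and ?w' = "linking_part z"
      have w': "?w' \<in> free_module (B (Suc (Suc j)))" using q(3) by (simp add: above)
      have cbw: "?c = E (Suc (Suc j)) ?c' + \<alpha> (Suc (Suc j)) ?w'"
        "?b = D (Suc (Suc j)) ?b' - scale x ?w'" "?w = - D (Suc j) ?w'"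
        unfolding z(2) FS cone_vector_simps by (rule refl, rule refl, rule ext, simp)
      have "E (Suc j) (E (Suc (Suc j)) ?c') = 0" using ES[OF fvE[OF q(1)]] q(1) by blast
      hence "E (Suc j) ?c + \<alpha> (Suc j) ?w = 0"
        unfolding cbw linear_map_add[OF linE] \<alpha>S[OF w'] linear_map_uminus[OF lin\<alpha>] by simp
      moreover have "D (Suc j) (D (Suc (Suc j)) ?b') = 0" using DS[OF fvD[OF q(2)]] q(2) by blast
      hence "D (Suc j) ?b - scale x ?w = 0"
        unfolding cbw linear_map_diff[OF linD] linear_map_scale[OF linD] by (intro ext) simp
      moreover have "j \<noteq> 0 \<longrightarrow> D j ?w = 0"
      proof
        assume "j \<noteq> 0"
        then obtain j' where j': "j = Suc j'" by (cases j) auto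
        have "D j (D (Suc j) ?w') = 0"
          using DS[OF fvD[OF w'[unfolded j']]] w' unfolding j' by blast
        thus "D j ?w = 0" unfolding cbw linear_map_uminus[OF linD] by simp
      qed
      ultimately show "E (Suc j) ?c + \<alpha> (Suc j) ?w = 0 \<and> D (Suc j) ?b - scale x ?w = 0 \<and> (j \<noteq> 0 \<longrightarrow> D j ?w = 0)"
        by blast
    qed
  qed
  have N: "graded_submodule (?h 0) (ideal_vectors Root J)"
    by (rule graded_submodule_ideal_vectors[OF id(3)]) (simp add: cone_degree_def)
  have "resolution ?G ?h (ideal_vectors Root J) F \<longleftrightarrow> (\<forall>i. graded_map (?G (Suc i)) (?h (Suc i)) (?G i) (?h i) (F i)) \<and>
    (\<forall>y\<in>free_module (?G 0). \<exists>z\<in>free_module (?G (Suc 0)). y - F 0 z \<in> ideal_vectors Root J) \<and>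
    (\<forall>i. \<forall>y\<in>free_module (?G (Suc i)). F i y \<in> null_vectors (ideal_vectors Root J) i \<longleftrightarrow> (\<exists>z\<in>free_module (?G (Suc (Suc i))). y = F (Suc i) z))"
    by (rule resolution_iff[of ?G ?h "ideal_vectors Root J" F, OF finG N fvF])
  thus ?thesis using gF surjF exF by blast
qed

section \<open>Resolutions whose last step is extremal\<close>

text \<open>Step \<open>i\<close> of the resolution is stage \<open>Suc i\<close>. The resolution need not be minimal, so the property is
  easy to pass on to mapping cones.\<close>

definition has_extremal_resolution :: "('v, 'k::comm_ring_1) mpolynomial set \<Rightarrow> nat \<Rightarrow> int \<Rightarrow> bool" where
  "has_extremal_resolution I c r \<longleftrightarrow> (\<exists>B e D. B 0 = {Root} \<and> e 0 Root = 0 \<and>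
     resolution B e (ideal_vectors Root I) D \<and> (\<forall>i>c. B (Suc i) = {}) \<and>
     (\<forall>i. \<forall>k\<in>B (Suc i). e (Suc i) k \<le> r + int i) \<and> (\<exists>k\<in>B (Suc c). e (Suc c) k = r + int c))"

lemma regularity_quotient_extremal:
  fixes I :: "('v::finite, 'k::field) mpolynomial set"
  assumes "homogeneous_ideal I" and "has_extremal_resolution I c r"
  shows "regularity_quotient I = ereal (real_of_int r)"
proof -
  obtain B e D k where *: "B 0 = {Root}" "e 0 Root = 0" "resolution B e (ideal_vectors Root I) D"
    "\<forall>i>c. B (Suc i) = {}" "\<forall>i. \<forall>k\<in>B (Suc i). e (Suc i) k \<le> r + int i"
    "k \<in> B (Suc c)" "e (Suc c) k = r + int c"
    using assms(2) unfolding has_extremal_resolution_def by blast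
  show ?thesis
    by (rule regularity_quotient_eqI[OF assms(1) *(1-3) _ _ *(6,7)]) (use *(4,5) in blast)+
qed

text \<open>The last step \<open>Suc c\<close> of the cone contains the shifted last steps of both resolutions. It suffices
  that one of them attains the bound \<open>r\<close>, so the zero resolution of \<open>R/R\<close> may serve as \<open>C\<close>.\<close>

lemma cone_extremal:
  fixes x :: "('v::finite, 'k::comm_ring_1) mpolynomial"
  assumes x: "homogeneous 1 x" "I1 \<subseteq> I2" "\<And>p. x * p \<in> I1 \<Longrightarrow> p \<in> I1"
    "J = {x * s + t | s t. s \<in> I2 \<and> t \<in> I1}"
    and id: "homogeneous_ideal I1" "homogeneous_ideal I2" "homogeneous_ideal J"
    and I1: "has_extremal_resolution I1 c r1"
    and C: "C 0 = {Root}" "g 0 Root = 0" "resolution C g (ideal_vectors Root I2) E"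
    and len: "\<And>i. i > Suc c \<Longrightarrow> C (Suc i) = {}"
    and bound: "\<And>i k. k \<in> C (Suc i) \<Longrightarrow> g (Suc i) k + 1 \<le> r + int i" "r1 \<le> r"
    and att: "r = r1 \<or> (\<exists>k\<in>C (Suc (Suc c)). g (Suc (Suc c)) k + 1 = r + int (Suc c))"
  shows "has_extremal_resolution J (Suc c) r"
proof -
  obtain B e D k where B: "B 0 = {Root}" "e 0 Root = 0" "resolution B e (ideal_vectors Root I1) D"
    and lenB: "\<forall>i>c. B (Suc i) = {}" and boundB: "\<forall>i. \<forall>k\<in>B (Suc i). e (Suc i) k \<le> r1 + int i"
    and k: "k \<in> B (Suc c)" "e (Suc c) k = r1 + int c"
    using I1 unfolding has_extremal_resolution_def by blast
  let ?G = "cone_basis B C" and ?h = "cone_degree e g"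
  obtain F where F: "resolution ?G ?h (ideal_vectors Root J) F"
    using cone_resolution[OF x id B C] by blast
  have G: "?G (Suc i) = Scaled ` C (Suc i) \<union> Plain ` B (Suc i) \<union> Linking ` above_root B i" for i
    by (simp add: cone_basis_def)
  have "?G 0 = {Root}" "?h 0 Root = 0" by (simp_all add: cone_basis_def cone_degree_def)
  moreover have "?G (Suc i) = {}" if "i > Suc c" for i
    using that len lenB by (cases i) (simp_all add: G above_root_def)
  moreover have "?h (Suc i) l \<le> r + int i" if l: "l \<in> ?G (Suc i)" for i l
  proof -
    from l consider m where "m \<in> C (Suc i)" "l = Scaled m" | m where "m \<in> B (Suc i)" "l = Plain m"
      | m j where "i = Suc j" "m \<in> B (Suc j)" "l = Linking m"
      unfolding G above_root_def by (cases i) auto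
    thus ?thesis
    proof cases
      case 1
      thus ?thesis using bound(1) by (simp add: cone_degree_def)
    next
      case 2
      hence "e (Suc i) m \<le> r1 + int i" using boundB by blast
      thus ?thesis using 2 bound(2) by (simp add: cone_degree_def)
    next
      case 3
      hence "e (Suc j) m \<le> r1 + int j" using boundB by blast
      thus ?thesis using 3 bound(2) by (simp add: cone_degree_def)
    qed
  qed
  moreover have "\<exists>l\<in>?G (Suc (Suc c)). ?h (Suc (Suc c)) l = r + int (Suc c)"
    using att
  proof
    assume "r = r1"
    thus ?thesis using k by (intro bexI[of _ "Linking k"]) (auto simp: cone_degree_def G above_root_def)
  next
    assume "\<exists>k\<in>C (Suc (Suc c)). g (Suc (Suc c)) k + 1 = r + int (Suc c)"
    then obtain m where "m \<in> C (Suc (Suc c))" "g (Suc (Suc c)) m + 1 = r + int (Suc c)" by blast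
    thus ?thesis by (intro bexI[of _ "Scaled m"]) (auto simp: cone_degree_def G)
  qed
  ultimately show ?thesis
    unfolding has_extremal_resolution_def using F by (intro exI[of _ ?G] exI[of _ ?h] exI[of _ F]) blast
qed

lemma homogeneous_ideal_UNIV: "homogeneous_ideal UNIV"
  by (simp add: homogeneous_ideal_def)

text \<open>The case \<open>I\<^sub>2 = R\<close> of the cone, where the resolution of \<open>R / I\<^sub>2\<close> is zero: the cone is then the
  cone of multiplication by \<open>x\<close> on the resolution of \<open>R / I\<close>.\<close>

lemma extremal_adjoin:
  fixes x :: "('v::finite, 'k::comm_ring_1) mpolynomial"
  assumes x: "homogeneous 1 x" "\<And>p. x * p \<in> I \<Longrightarrow> p \<in> I" "J = {x * s + t | s t. s \<in> UNIV \<and> t \<in> I}"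
    and id: "homogeneous_ideal I" "homogeneous_ideal J" and I: "has_extremal_resolution I c r"
  shows "has_extremal_resolution J (Suc c) r"
proof -
  define C :: "nat \<Rightarrow> basis_label set" where "C i = (if i = 0 then {Root} else {})" for i
  have "ideal_vectors Root (UNIV :: ('v, 'k) mpolynomial set) = free_module {Root}"
    by (simp add: ideal_vectors_def)
  moreover have "graded_submodule (\<lambda>_. 0) (ideal_vectors Root (UNIV :: ('v, 'k) mpolynomial set))"
    by (rule graded_submodule_ideal_vectors[OF homogeneous_ideal_UNIV]) simp
  moreover have "y = 0" if "y \<in> free_module {}" for y :: "basis_label \<Rightarrow> ('v, 'k) mpolynomial"
    using that by (auto simp: free_module_def fun_eq_iff)
  ultimately have res: "resolution C (\<lambda>_ _. 0) (ideal_vectors Root (UNIV :: ('v, 'k) mpolynomial set)) (\<lambda>_ _. 0)"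
    by (auto simp: resolution_def C_def graded_map_zero cycles_def null_vectors_def intro: exI[of _ 0])
  show ?thesis
    by (rule cone_extremal[OF x(1) subset_UNIV x(2,3) id(1) homogeneous_ideal_UNIV id(2) I _ _ res])
       (simp_all add: C_def)
qed

lemma extremal_cone:
  fixes x :: "('v::finite, 'k::comm_ring_1) mpolynomial"
  assumes x: "homogeneous 1 x" "I1 \<subseteq> I2" "\<And>p. x * p \<in> I1 \<Longrightarrow> p \<in> I1"
    "J = {x * s + t | s t. s \<in> I2 \<and> t \<in> I1}"
    and id: "homogeneous_ideal I1" "homogeneous_ideal I2" "homogeneous_ideal J"
    and I1: "has_extremal_resolution I1 c r1" and I2: "has_extremal_resolution I2 (Suc c) r2"
  shows "has_extremal_resolution J (Suc c) (max r1 (r2 + 1))"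
proof -
  obtain C g E k where C: "C 0 = {Root}" "g 0 Root = 0" "resolution C g (ideal_vectors Root I2) E"
    and len: "\<forall>i>Suc c. C (Suc i) = {}" and bound: "\<forall>i. \<forall>k\<in>C (Suc i). g (Suc i) k \<le> r2 + int i"
    and k: "k \<in> C (Suc (Suc c))" "g (Suc (Suc c)) k = r2 + int (Suc c)"
    using I2 unfolding has_extremal_resolution_def by blast
  show ?thesis
  proof (rule cone_extremal[OF x id I1 C])
    show "C (Suc i) = {}" if "i > Suc c" for i using len that by blast
    show "g (Suc i) k + 1 \<le> max r1 (r2 + 1) + int i" if "k \<in> C (Suc i)" for i k
      using bound that by fastforce
    show "max r1 (r2 + 1) = r1 \<or> (\<exists>k\<in>C (Suc (Suc c)). g (Suc (Suc c)) k + 1 = max r1 (r2 + 1) + int (Suc c))"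
    proof (cases "r2 + 1 \<le> r1")
      case False
      thus ?thesis using k by (intro disjI2 bexI[of _ k]) simp_all
    qed simp
  qed (assumption | rule max.cobounded1)+
qed

text \<open>Stage \<open>0\<close> and stage \<open>1\<close> are both \<open>R\<close>, with the identity as augmentation.\<close>

lemma extremal_zero_ideal: "has_extremal_resolution ({0} :: ('v::finite, 'k::comm_ring_1) mpolynomial set) 0 0"
proof -
  define B :: "nat \<Rightarrow> basis_label set" where "B i = (if i < 2 then {Root} else {})" for i
  define D :: "nat \<Rightarrow> (basis_label \<Rightarrow> ('v, 'k) mpolynomial) \<Rightarrow> basis_label \<Rightarrow> ('v, 'k) mpolynomial"
    where "D i = (if i = 0 then (\<lambda>y. y) else (\<lambda>y. 0))" for i
  have "homogeneous_ideal ({0} :: ('v, 'k) mpolynomial set)" by (simp add: homogeneous_ideal_def)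
  hence N: "graded_submodule (\<lambda>_. 0) (ideal_vectors Root ({0} :: ('v, 'k) mpolynomial set))"
    by (rule graded_submodule_ideal_vectors) simp
  have N0: "ideal_vectors Root ({0} :: ('v, 'k) mpolynomial set) = {0}"
    by (auto simp: ideal_vectors_def free_module_def fun_eq_iff) metis
  have "resolution B (\<lambda>_ _. 0) (ideal_vectors Root {0}) D"
    unfolding resolution_def
  proof (intro conjI allI ballI)
    fix i
    have bd: "null_vectors {0 :: basis_label \<Rightarrow> ('v, 'k) mpolynomial} i = {0}" for i by (simp add: null_vectors_def)
    show "finite (B i)" by (simp add: B_def)
    show "graded_map (B (Suc i)) (\<lambda>_. 0) (B i) (\<lambda>_. 0) (D i)"
      by (cases i) (simp_all add: B_def D_def graded_map_id graded_map_zero)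
    show "D i y \<in> cycles B (ideal_vectors Root {0}) D i" if "y \<in> free_module (B (Suc i))" for y
      using that unfolding N0 by (cases i) (simp_all add: cycles_0 cycles_Suc bd B_def D_def)
    show "\<exists>z\<in>free_module (B (Suc i)). y - D i z \<in> null_vectors (ideal_vectors Root {0}) i"
      if y: "y \<in> cycles B (ideal_vectors Root {0}) D i" for y
    proof (cases i)
      case 0
      thus ?thesis using y unfolding N0 bd by (intro bexI[of _ y]) (simp_all add: cycles_0 B_def D_def)
    next
      case (Suc j)
      have "y = 0"
      proof (cases j)
        case 0
        thus ?thesis using y unfolding N0 Suc cycles_Suc bd by (simp add: D_def)
      next
        case (Suc j')
        hence "y \<in> free_module {}" using y cycles_subset[of B] \<open>i = Suc j\<close> by (fastforce simp: B_def)
        thus ?thesis by (auto simp: free_module_def fun_eq_iff)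
      qed
      thus ?thesis unfolding N0 bd using Suc by (intro bexI[of _ 0]) (simp_all add: D_def)
    qed
  qed (rule N)
  thus ?thesis unfolding has_extremal_resolution_def
    by (intro exI[of _ B] exI[of _ "\<lambda>_ _. 0"] exI[of _ D]) (simp add: B_def)
qed

section \<open>Ideals of nonfaces\<close>

text \<open>The ideal generated by the squarefree monomials on nonfaces contained in \<open>W\<close>, described by the
  monomials in it: as faces are closed under subsets, a monomial is divisible by one of the generators
  iff its support within \<open>W\<close> is a nonface. The variables outside \<open>W\<close> are nonzerodivisors modulo this ideal, in
  contrast to the Stanley--Reisner ideal, which contains the variables of vertices missing in \<open>\<Gamma>\<close>.\<close>

definition nonface_ideal :: "'v set \<Rightarrow> 'v set set \<Rightarrow> ('v, 'k::comm_ring_1) mpolynomial set" where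
  "nonface_ideal W \<Gamma> = {p. \<forall>m\<in>Poly_Mapping.keys p. Poly_Mapping.keys m \<inter> W \<notin> \<Gamma>}"

lemma keys_add_nat: "Poly_Mapping.keys (a + b) = Poly_Mapping.keys a \<union> Poly_Mapping.keys (b :: 'v \<Rightarrow>\<^sub>0 nat)"
  by (auto simp: in_keys_iff lookup_add)

lemma homogeneous_ideal_nonface_ideal:
  assumes "simplicial_complex \<Gamma>"
  shows "homogeneous_ideal (nonface_ideal W \<Gamma> :: ('v::finite, 'k::comm_ring_1) mpolynomial set)"
proof -
  let ?I = "nonface_ideal W \<Gamma> :: ('v, 'k) mpolynomial set"
  have mul: "c * p \<in> ?I" if p: "p \<in> ?I" for c p
    unfolding nonface_ideal_def
  proof (intro CollectI ballI)
    fix m assume "m \<in> Poly_Mapping.keys (c * p)"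
    then obtain a b where "b \<in> Poly_Mapping.keys p" "m = a + b" using keys_mult[of c p] by blast
    moreover from this have "Poly_Mapping.keys b \<inter> W \<notin> \<Gamma>" using p by (simp add: nonface_ideal_def)
    moreover have "Poly_Mapping.keys b \<inter> W \<subseteq> Poly_Mapping.keys m \<inter> W"
      using \<open>m = a + b\<close> by (auto simp: keys_add_nat)
    ultimately show "Poly_Mapping.keys m \<inter> W \<notin> \<Gamma>" using assms unfolding simplicial_complex_def by blast
  qed
  have add: "p + q \<in> ?I" if "p \<in> ?I" "q \<in> ?I" for p q
    using that Poly_Mapping.keys_add[of p q] unfolding nonface_ideal_def by blast
  have zero: "0 \<in> ?I" by (simp add: nonface_ideal_def)
  have "ring_module.subspace ?I"
    by (rule ring_module.subspaceI) (use zero add mul in blast)+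
  thus ?thesis by (simp add: homogeneous_ideal_def nonface_ideal_def keys_component)
qed

lemma monomial_in_nonface_ideal: "Poly_Mapping.keys m \<inter> W \<notin> \<Gamma> \<Longrightarrow> Poly_Mapping.single m c \<in> nonface_ideal W \<Gamma>"
  by (simp add: nonface_ideal_def)

definition squarefree_exponent :: "'v::finite set \<Rightarrow> 'v \<Rightarrow>\<^sub>0 nat" where
  "squarefree_exponent F = (\<Sum>v\<in>F. Poly_Mapping.single v 1)"

lemma prod_variable:
  "(\<Prod>v\<in>F. variable v :: ('v::finite, 'k::comm_ring_1) mpolynomial) = Poly_Mapping.single (squarefree_exponent F) 1"
  unfolding squarefree_exponent_def
  using finite[of F] by (induction F rule: finite_induct) (simp_all add: variable_def mult_single)

lemma lookup_squarefree_exponent: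
  "Poly_Mapping.lookup (squarefree_exponent F) u = (if u \<in> F then 1 else 0)"
  by (simp add: squarefree_exponent_def lookup_sum lookup_single when_def)

lemma keys_squarefree_exponent: "Poly_Mapping.keys (squarefree_exponent F) = F"
  by (auto simp: in_keys_iff lookup_squarefree_exponent split: if_splits)

lemma stanley_reisner_ideal_eq:
  assumes "simplicial_complex \<Gamma>"
  shows "stanley_reisner_ideal \<Gamma> = (nonface_ideal UNIV \<Gamma> :: ('v::finite, 'k::comm_ring_1) mpolynomial set)"
proof
  let ?S = "{(\<Prod>v\<in>F. variable v) | F. F \<notin> \<Gamma>} :: ('v, 'k) mpolynomial set"
  have "?S \<subseteq> nonface_ideal UNIV \<Gamma>"
    unfolding prod_variable by (auto intro!: monomial_in_nonface_ideal simp: keys_squarefree_exponent)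
  thus "stanley_reisner_ideal \<Gamma> \<subseteq> (nonface_ideal UNIV \<Gamma> :: ('v, 'k) mpolynomial set)"
    unfolding stanley_reisner_ideal_def ideal_generated_def
    using homogeneous_ideal_nonface_ideal[OF assms] by (intro ring_module.span_minimal) (auto simp: homogeneous_ideal_def)
  show "(nonface_ideal UNIV \<Gamma> :: ('v, 'k) mpolynomial set) \<subseteq> stanley_reisner_ideal \<Gamma>"
  proof
    fix p :: "('v, 'k) mpolynomial" assume p: "p \<in> nonface_ideal UNIV \<Gamma>"
    show "p \<in> stanley_reisner_ideal \<Gamma>"
      unfolding stanley_reisner_ideal_def ideal_generated_def
    proof (rule in_subspace_by_terms)
      fix m assume m: "m \<in> Poly_Mapping.keys p"
      let ?F = "Poly_Mapping.keys m"
      let ?n = "squarefree_exponent ?F"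
      have "?F \<notin> \<Gamma>" using p m by (simp add: nonface_ideal_def)
      hence "(\<Prod>v\<in>?F. variable v) \<in> ?S" by blast
      moreover have "m = (m - ?n) + ?n"
        by (intro poly_mapping_eqI) (auto simp: lookup_add lookup_minus lookup_squarefree_exponent in_keys_iff)
      hence "Poly_Mapping.single m 1 = Poly_Mapping.single (m - ?n) 1 * (\<Prod>v\<in>?F. variable v :: ('v, 'k) mpolynomial)"
        unfolding prod_variable by (metis mult_1 mult_single)
      ultimately show "Poly_Mapping.single m 1 \<in> ring_module.span ?S"
        by (metis (no_types, lifting) ring_module.span_base ring_module.span_scale)
    qed (rule ring_module.subspace_span)
  qed
qed

lemma keys_variable_mult:
  fixes p :: "('v, 'k::comm_ring_1) mpolynomial"
  assumes "m \<in> Poly_Mapping.keys p"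
  shows "Poly_Mapping.single v 1 + m \<in> Poly_Mapping.keys (variable v * p)"
proof -
  have "variable v * p = (\<Sum>n\<in>Poly_Mapping.keys p. Poly_Mapping.single (Poly_Mapping.single v 1 + n) (Poly_Mapping.lookup p n))"
    by (subst poly_mapping_sum_single[of p]) (simp add: sum_distrib_left variable_def mult_single)
  hence "Poly_Mapping.lookup (variable v * p) (Poly_Mapping.single v 1 + m) =
     (\<Sum>n\<in>Poly_Mapping.keys p. if n = m then Poly_Mapping.lookup p n else 0)"
    by (simp add: lookup_sum lookup_single when_def)
  thus ?thesis using assms by (simp add: in_keys_iff)
qed

lemma variable_nonzerodivisor:
  assumes "v \<notin> W" and "variable v * p \<in> nonface_ideal W \<Gamma>"
  shows "p \<in> nonface_ideal W \<Gamma>"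
  unfolding nonface_ideal_def
proof (intro CollectI ballI)
  fix m assume "m \<in> Poly_Mapping.keys p"
  hence "Poly_Mapping.keys (Poly_Mapping.single v 1 + m) \<inter> W \<notin> \<Gamma>"
    using assms(2) keys_variable_mult[of m p v] unfolding nonface_ideal_def by blast
  moreover have "Poly_Mapping.keys (Poly_Mapping.single v 1 + m) \<inter> W = Poly_Mapping.keys m \<inter> W"
    using assms(1) by (auto simp: keys_add_nat)
  ultimately show "Poly_Mapping.keys m \<inter> W \<notin> \<Gamma>" by simp
qed

lemma simplicial_complex_deletion: "simplicial_complex \<Delta> \<Longrightarrow> simplicial_complex (deletion \<Delta> v)"
  unfolding simplicial_complex_def deletion_def by blast

lemma simplicial_complex_link: "simplicial_complex \<Delta> \<Longrightarrow> simplicial_complex (link \<Delta> v)"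
  unfolding simplicial_complex_def link_def by (smt (verit) insert_mono mem_Collect_eq subset_iff)

text \<open>Split a polynomial into the terms divisible by \<open>x\<^sub>v\<close> and the others. The support of a monomial
  \<open>x\<^sub>v m'\<close> is a face iff the support of \<open>m'\<close> without \<open>v\<close> is a face of the link, and a set without \<open>v\<close>
  is a face iff it is one of the deletion.\<close>

lemma nonface_ideal_link_deletion:
  assumes \<Delta>: "simplicial_complex \<Delta>" and v: "v \<in> W"
  shows "(nonface_ideal W \<Delta> :: ('v::finite, 'k::comm_ring_1) mpolynomial set) =
    {variable v * s + t | s t. s \<in> nonface_ideal (W - {v}) (link \<Delta> v) \<and> t \<in> nonface_ideal (W - {v}) (deletion \<Delta> v)}"
    (is "?J = ?K")
proof
  let ?W = "W - {v}"
  let ?ev = "Poly_Mapping.single v (1::nat)"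
  have sub: "ring_module.subspace (nonface_ideal U \<Gamma> :: ('v, 'k) mpolynomial set)" if "simplicial_complex \<Gamma>" for U \<Gamma>
    using homogeneous_ideal_nonface_ideal[OF that] by (auto simp: homogeneous_ideal_def)
  show "?K \<subseteq> ?J"
  proof
    fix p assume "p \<in> ?K"
    then obtain s t where p: "p = variable v * s + t" and s: "s \<in> nonface_ideal ?W (link \<Delta> v)"
      and t: "t \<in> nonface_ideal ?W (deletion \<Delta> v)" by blast
    have "variable v * s \<in> ?J"
      unfolding nonface_ideal_def
    proof (intro CollectI ballI notI)
      fix m assume "m \<in> Poly_Mapping.keys (variable v * s)" and m: "Poly_Mapping.keys m \<inter> W \<in> \<Delta>"
      then obtain b where b: "b \<in> Poly_Mapping.keys s" "m = ?ev + b"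
        using keys_mult[of "variable v" s] by (auto simp: variable_def)
      have "Poly_Mapping.keys m \<inter> W = insert v (Poly_Mapping.keys b \<inter> ?W)"
        using v by (auto simp: b(2) keys_add_nat)
      moreover from this m have "Poly_Mapping.keys b \<inter> ?W \<in> \<Delta>"
        using \<Delta> unfolding simplicial_complex_def by (metis subset_insertI)
      ultimately have "Poly_Mapping.keys b \<inter> ?W \<in> link \<Delta> v" using m by (auto simp: link_def)
      thus False using s b(1) by (auto simp: nonface_ideal_def)
    qed
    moreover have "t \<in> ?J"
      unfolding nonface_ideal_def
    proof (intro CollectI ballI notI)
      fix m assume m: "m \<in> Poly_Mapping.keys t" "Poly_Mapping.keys m \<inter> W \<in> \<Delta>"
      have "Poly_Mapping.keys m \<inter> ?W \<subseteq> Poly_Mapping.keys m \<inter> W" by blast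
      with m \<Delta> have "Poly_Mapping.keys m \<inter> ?W \<in> \<Delta>" unfolding simplicial_complex_def by blast
      hence "Poly_Mapping.keys m \<inter> ?W \<in> deletion \<Delta> v" by (auto simp: deletion_def)
      thus False using t m(1) by (auto simp: nonface_ideal_def)
    qed
    ultimately show "p \<in> ?J" unfolding p by (rule ring_module.subspace_add[OF sub[OF \<Delta>]])
  qed
  show "?J \<subseteq> ?K"
  proof
    fix p assume p: "p \<in> ?J"
    let ?A = "{m \<in> Poly_Mapping.keys p. v \<in> Poly_Mapping.keys m}"
    let ?B = "{m \<in> Poly_Mapping.keys p. v \<notin> Poly_Mapping.keys m}"
    define s where "s = (\<Sum>m\<in>?A. Poly_Mapping.single (m - ?ev) (Poly_Mapping.lookup p m))"
    define t where "t = (\<Sum>m\<in>?B. Poly_Mapping.single m (Poly_Mapping.lookup p m))"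
    have split: "?ev + (m - ?ev) = m" if "v \<in> Poly_Mapping.keys m" for m :: "'v \<Rightarrow>\<^sub>0 nat"
      using that by (intro poly_mapping_eqI) (auto simp: lookup_add lookup_minus lookup_single when_def in_keys_iff)
    have "variable v * s = (\<Sum>m\<in>?A. Poly_Mapping.single m (Poly_Mapping.lookup p m))"
      unfolding s_def sum_distrib_left by (rule sum.cong) (auto simp: variable_def mult_single split[unfolded One_nat_def])
    moreover have "p = (\<Sum>m\<in>?A \<union> ?B. Poly_Mapping.single m (Poly_Mapping.lookup p m))"
      by (subst poly_mapping_sum_single) (rule sum.cong, auto)
    hence "p = (\<Sum>m\<in>?A. Poly_Mapping.single m (Poly_Mapping.lookup p m)) + t"
      unfolding t_def by (subst (asm) sum.union_disjoint) auto
    ultimately have "p = variable v * s + t" by simp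
    moreover have "s \<in> nonface_ideal ?W (link \<Delta> v)"
      unfolding s_def
    proof (intro ring_module.subspace_sum[OF sub[OF simplicial_complex_link[OF \<Delta>]]] monomial_in_nonface_ideal notI)
      fix m assume m: "m \<in> ?A" and l: "Poly_Mapping.keys (m - ?ev) \<inter> ?W \<in> link \<Delta> v"
      have "Poly_Mapping.keys m = insert v (Poly_Mapping.keys (m - ?ev))"
        using keys_add_nat[of ?ev "m - ?ev"] split m by auto
      hence "Poly_Mapping.keys m \<inter> W = insert v (Poly_Mapping.keys (m - ?ev) \<inter> ?W)" using v by blast
      hence "Poly_Mapping.keys m \<inter> W \<in> \<Delta>" using l by (simp add: link_def)
      thus False using p m by (simp add: nonface_ideal_def)
    qed
    moreover have "t \<in> nonface_ideal ?W (deletion \<Delta> v)"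
      unfolding t_def
    proof (intro ring_module.subspace_sum[OF sub[OF simplicial_complex_deletion[OF \<Delta>]]] monomial_in_nonface_ideal notI)
      fix m assume m: "m \<in> ?B" and l: "Poly_Mapping.keys m \<inter> ?W \<in> deletion \<Delta> v"
      have "Poly_Mapping.keys m \<inter> W = Poly_Mapping.keys m \<inter> ?W" using m by auto
      thus False using p m l unfolding nonface_ideal_def deletion_def by force
    qed
    ultimately show "p \<in> ?K" by blast
  qed
qed

lemma nonface_ideal_antimono: "\<Gamma> \<subseteq> \<Delta> \<Longrightarrow> nonface_ideal W \<Delta> \<subseteq> nonface_ideal W \<Gamma>"
  by (auto simp: nonface_ideal_def)

text \<open>Enlarging \<open>W\<close> by a vertex that is not in the complex adjoins a variable to the ideal. This keeps
  \<open>r\<close>, so the regularity may be computed in either ring.\<close>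

lemma extremal_add_vertex:
  assumes \<Gamma>: "simplicial_complex \<Gamma>" "\<Union>\<Gamma> \<subseteq> W" and v: "v \<notin> W"
    and ext: "has_extremal_resolution (nonface_ideal W \<Gamma> :: ('v::finite, 'k::comm_ring_1) mpolynomial set) c r"
  shows "has_extremal_resolution (nonface_ideal (insert v W) \<Gamma> :: ('v, 'k) mpolynomial set) (Suc c) r"
proof (rule extremal_adjoin[OF homogeneous_variable[of v] variable_nonzerodivisor[OF v] _
      homogeneous_ideal_nonface_ideal[OF \<Gamma>(1)] homogeneous_ideal_nonface_ideal[OF \<Gamma>(1)] ext])
  have e1: "link \<Gamma> v = {}" "deletion \<Gamma> v = \<Gamma>" using \<Gamma>(2) v by (auto simp: link_def deletion_def)
  have e2: "insert v W - {v} = W" using v by blast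
  have e3: "nonface_ideal W {} = (UNIV :: ('v, 'k) mpolynomial set)" by (simp add: nonface_ideal_def)
  show "nonface_ideal (insert v W) \<Gamma> =
      {variable v * s + t | s t. s \<in> UNIV \<and> t \<in> (nonface_ideal W \<Gamma> :: ('v, 'k) mpolynomial set)}"
    using nonface_ideal_link_deletion[where ?'k = 'k, OF \<Gamma>(1) insertI1[of v W]] unfolding e1 e2 e3 .
qed

text \<open>The difference of one in the lengths makes both resolutions contribute to the last step of the cone.\<close>

lemma extremal_link_deletion:
  assumes \<Delta>: "simplicial_complex \<Delta>" and v: "v \<in> W"
    and del: "has_extremal_resolution (nonface_ideal (W - {v}) (deletion \<Delta> v) :: ('v::finite, 'k::comm_ring_1) mpolynomial set) c r1"
    and lk: "has_extremal_resolution (nonface_ideal (W - {v}) (link \<Delta> v) :: ('v, 'k) mpolynomial set) (Suc c) r2"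
  shows "has_extremal_resolution (nonface_ideal W \<Delta> :: ('v, 'k) mpolynomial set) (Suc c) (max r1 (r2 + 1))"
proof (rule extremal_cone[OF homogeneous_variable[of v] _ _ nonface_ideal_link_deletion[OF \<Delta> v] _ _ _ del lk])
  show "nonface_ideal (W - {v}) (deletion \<Delta> v) \<subseteq> (nonface_ideal (W - {v}) (link \<Delta> v) :: ('v, 'k) mpolynomial set)"
    by (rule nonface_ideal_antimono) (auto simp: link_def deletion_def)
  show "p \<in> nonface_ideal (W - {v}) (deletion \<Delta> v)" if "variable v * p \<in> nonface_ideal (W - {v}) (deletion \<Delta> v)"
    for p :: "('v, 'k) mpolynomial"
    by (rule variable_nonzerodivisor[OF _ that]) simp
qed (intro homogeneous_ideal_nonface_ideal simplicial_complex_deletion simplicial_complex_link \<Delta>)+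

lemma extremal_simplex:
  "has_extremal_resolution (nonface_ideal (F \<union> U) (Pow F) :: ('v::finite, 'k::comm_ring_1) mpolynomial set) (card (U - F)) 0"
  using finite[of U]
proof (induction U rule: finite_induct)
  case empty
  have "nonface_ideal F (Pow F) = ({0} :: ('v, 'k) mpolynomial set)"
    by (auto simp: nonface_ideal_def)
  thus ?case using extremal_zero_ideal by simp
next
  case (insert u U)
  show ?case
  proof (cases "u \<in> F")
    case True
    hence "F \<union> insert u U = F \<union> U" "insert u U - F = U - F" by auto
    thus ?thesis using insert.IH by simp
  next
    case False
    hence "card (insert u U - F) = Suc (card (U - F))" using insert.hyps by (simp add: insert_Diff_if)
    moreover have "has_extremal_resolution (nonface_ideal (insert u (F \<union> U)) (Pow F) :: ('v, 'k) mpolynomial set) (Suc (card (U - F))) 0"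
      using insert False by (intro extremal_add_vertex) (auto simp: simplicial_complex_def)
    ultimately show ?thesis by simp
  qed
qed

section \<open>Vertex decomposable complexes\<close>

text \<open>For a nonempty complex, this is the Krull dimension of its Stanley--Reisner ring.\<close>

definition face_size :: "'v::finite set set \<Rightarrow> nat" where
  "face_size \<Delta> = Max (card ` \<Delta>)"

lemma complex_dim_face_size: "complex_dim \<Delta> = int (face_size \<Delta>) - 1"
  by (simp add: complex_dim_def face_size_def)

lemma face_size_le:
  assumes "\<Delta> \<noteq> {}" "\<Union>\<Delta> \<subseteq> W"
  shows "face_size \<Delta> \<le> card (W :: 'v::finite set)"
  unfolding face_size_def using assms by (auto intro!: card_mono)

lemma face_size_Pow: "face_size (Pow F) = card (F :: 'v::finite set)"
  unfolding face_size_def by (rule Max_eqI) (auto intro: card_mono)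

text \<open>The length of the resolution is the codimension, as for a Cohen--Macaulay ring. All vertex sets
  containing the complex are considered at once because passing to a deletion or link removes a vertex
  from \<open>W\<close>. The argument of type \<open>itself\<close> fixes the coefficients.\<close>

definition extremal_over_all_vertex_sets :: "'k::comm_ring_1 itself \<Rightarrow> 'v::finite set set \<Rightarrow> bool" where
  "extremal_over_all_vertex_sets _ \<Delta> \<longleftrightarrow> (\<forall>W. \<Union>\<Delta> \<subseteq> W \<longrightarrow>
     (\<exists>r. has_extremal_resolution (nonface_ideal W \<Delta> :: ('v, 'k) mpolynomial set) (card W - face_size \<Delta>) r))"

lemma extremal_over_all_vertex_setsD:
  assumes "extremal_over_all_vertex_sets TYPE('k::comm_ring_1) \<Delta>" and "\<Union>\<Delta> \<subseteq> W"
  shows "\<exists>r. has_extremal_resolution (nonface_ideal W \<Delta> :: ('v::finite, 'k) mpolynomial set) (card W - face_size \<Delta>) r"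
  using assms unfolding extremal_over_all_vertex_sets_def by simp

text \<open>Over \<open>W\<close> without \<open>v\<close>, the codimension of the link exceeds that of the deletion by one, by the dimension
  condition on a shedding vertex.\<close>

lemma shedding_step:
  assumes \<Delta>: "simplicial_complex \<Delta>" and v: "{v} \<in> \<Delta>"
    and dims: "complex_dim (deletion \<Delta> v) = complex_dim \<Delta>" "complex_dim \<Delta> = complex_dim (link \<Delta> v) + 1"
    and W: "\<Union>\<Delta> \<subseteq> W"
    and del: "has_extremal_resolution (nonface_ideal (W - {v}) (deletion \<Delta> v) :: ('v::finite, 'k::comm_ring_1) mpolynomial set)
      (card (W - {v}) - face_size (deletion \<Delta> v)) r1"
    and lk: "has_extremal_resolution (nonface_ideal (W - {v}) (link \<Delta> v) :: ('v, 'k) mpolynomial set)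
      (card (W - {v}) - face_size (link \<Delta> v)) r2"
  shows "has_extremal_resolution (nonface_ideal W \<Delta> :: ('v, 'k) mpolynomial set) (card W - face_size \<Delta>) (max r1 (r2 + 1))"
proof -
  have vW: "v \<in> W" using v W by blast
  have "deletion \<Delta> v \<noteq> {}" using \<Delta> v unfolding simplicial_complex_def deletion_def by blast
  moreover have "\<Union>(deletion \<Delta> v) \<subseteq> W - {v}" using W by (auto simp: deletion_def)
  ultimately have le: "face_size (deletion \<Delta> v) \<le> card (W - {v})" by (rule face_size_le)
  have fs: "face_size (deletion \<Delta> v) = face_size \<Delta>" "face_size \<Delta> = Suc (face_size (link \<Delta> v))"
    using dims by (simp_all add: complex_dim_face_size)
  let ?c = "card (W - {v}) - face_size (deletion \<Delta> v)"
  have cW: "card W = Suc (card (W - {v}))" by (rule card_Suc_Diff1[OF finite vW, symmetric])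
  have c: "card (W - {v}) - face_size (link \<Delta> v) = Suc ?c" "card W - face_size \<Delta> = Suc ?c"
    using le fs cW by auto
  show ?thesis using extremal_link_deletion[OF \<Delta> vW del lk[unfolded c(1)]] unfolding c(2) .
qed

lemma extremal_of_vertex_decomposable:
  shows "vertex_decomposable \<Delta> \<Longrightarrow> simplicial_complex \<Delta> \<Longrightarrow> \<Delta> \<noteq> {} \<Longrightarrow>
      extremal_over_all_vertex_sets TYPE('k::comm_ring_1) \<Delta>"
    and "shedding_vertex \<Delta> v \<Longrightarrow> simplicial_complex \<Delta> \<Longrightarrow> extremal_over_all_vertex_sets TYPE('k) \<Delta>"
proof (induction rule: vertex_decomposable_shedding_vertex.inducts)
  case empty
  thus ?case by simp
next
  case (simplex F)
  show ?case unfolding extremal_over_all_vertex_sets_def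
  proof (intro allI impI)
    fix W :: "'a set" assume "\<Union>(Pow F) \<subseteq> W"
    hence "F \<subseteq> W" by simp
    hence "F \<union> W = W" "card (W - F) = card W - face_size (Pow F)"
      by (auto simp: face_size_Pow card_Diff_subset)
    thus "\<exists>r. has_extremal_resolution (nonface_ideal W (Pow F) :: ('a, 'k) mpolynomial set) (card W - face_size (Pow F)) r"
      using extremal_simplex[of F W] by metis
  qed
next
  case (shed \<Delta> v)
  thus ?case by simp
next
  case (shedding v \<Delta>)
  note \<Delta> = shedding.prems
  have "{} \<in> deletion \<Delta> v" "{} \<in> link \<Delta> v"
    using \<Delta> shedding.hyps(1) unfolding simplicial_complex_def deletion_def link_def by auto
  hence IH: "extremal_over_all_vertex_sets TYPE('k) (deletion \<Delta> v)" "extremal_over_all_vertex_sets TYPE('k) (link \<Delta> v)"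
    using shedding.IH simplicial_complex_deletion[OF \<Delta>] simplicial_complex_link[OF \<Delta>] by blast+
  show ?case unfolding extremal_over_all_vertex_sets_def
  proof (intro allI impI)
    fix W assume W: "\<Union>\<Delta> \<subseteq> W"
    have U: "\<Union>(deletion \<Delta> v) \<subseteq> W - {v}" "\<Union>(link \<Delta> v) \<subseteq> W - {v}"
      using W by (auto simp: deletion_def link_def)
    obtain r1 where r1: "has_extremal_resolution (nonface_ideal (W - {v}) (deletion \<Delta> v) :: ('a, 'k) mpolynomial set)
        (card (W - {v}) - face_size (deletion \<Delta> v)) r1"
      using extremal_over_all_vertex_setsD[OF IH(1) U(1)] ..
    obtain r2 where r2: "has_extremal_resolution (nonface_ideal (W - {v}) (link \<Delta> v) :: ('a, 'k) mpolynomial set)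
        (card (W - {v}) - face_size (link \<Delta> v)) r2"
      using extremal_over_all_vertex_setsD[OF IH(2) U(2)] ..
    show "\<exists>r. has_extremal_resolution (nonface_ideal W \<Delta> :: ('a, 'k) mpolynomial set) (card W - face_size \<Delta>) r"
      by (rule exI, rule shedding_step[OF \<Delta> shedding.hyps(1) _ _ W r1 r2]) (rule shedding.hyps)+
  qed
qed

text \<open>The resolutions of deletion and link over the vertex set without \<open>v\<close> determine all three
  regularities: \<open>shedding_step\<close> gives the left-hand side, and \<open>extremal_add_vertex\<close> restores the variable
  \<open>x\<^sub>v\<close> in the ideals on the right-hand side.\<close>

theorem corollary3p3:
  fixes \<Delta> :: "'v::finite set set" and v :: 'v
  assumes "simplicial_complex \<Delta>" and "pure \<Delta>" and "vertex_decomposable \<Delta>"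
    and "shedding_vertex \<Delta> v"
  shows "regularity_quotient
      (stanley_reisner_ideal \<Delta> :: ('v, 'k::{alg_closed_field, field_char_0}) mpolynomial set) =
    max (regularity_quotient
          (stanley_reisner_ideal (deletion \<Delta> v) :: ('v, 'k) mpolynomial set))
        (regularity_quotient
          (stanley_reisner_ideal (link \<Delta> v) :: ('v, 'k) mpolynomial set) + 1)"
proof -
  let ?del = "deletion \<Delta> v" and ?lk = "link \<Delta> v" and ?W = "UNIV - {v}"
  note \<Delta> = assms(1)
  note del = simplicial_complex_deletion[OF \<Delta>, of v] and lk = simplicial_complex_link[OF \<Delta>, of v]
  from assms(4) have sh: "{v} \<in> \<Delta>" "vertex_decomposable ?del" "vertex_decomposable ?lk"
    "complex_dim ?del = complex_dim \<Delta>" "complex_dim \<Delta> = complex_dim ?lk + 1"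
    by (auto elim: shedding_vertex.cases)
  have ne: "?del \<noteq> {}" "?lk \<noteq> {}"
    using \<Delta> sh(1) unfolding simplicial_complex_def deletion_def link_def by blast+
  have W: "\<Union>?del \<subseteq> ?W" "\<Union>?lk \<subseteq> ?W" by (auto simp: deletion_def link_def)
  obtain r1 where r1: "has_extremal_resolution (nonface_ideal ?W ?del :: ('v, 'k) mpolynomial set) (card ?W - face_size ?del) r1"
    using extremal_over_all_vertex_setsD[where ?'k = 'k, OF extremal_of_vertex_decomposable(1)[OF sh(2) del ne(1)] W(1)] ..
  obtain r2 where r2: "has_extremal_resolution (nonface_ideal ?W ?lk :: ('v, 'k) mpolynomial set) (card ?W - face_size ?lk) r2"
    using extremal_over_all_vertex_setsD[where ?'k = 'k, OF extremal_of_vertex_decomposable(1)[OF sh(3) lk ne(2)] W(2)] ..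
  have eq: "regularity_quotient (stanley_reisner_ideal \<Gamma> :: ('v, 'k) mpolynomial set) = ereal (real_of_int r)"
    if "simplicial_complex \<Gamma>" "has_extremal_resolution (nonface_ideal UNIV \<Gamma> :: ('v, 'k) mpolynomial set) c r" for \<Gamma> c r
    unfolding stanley_reisner_ideal_eq[OF that(1)]
    by (rule regularity_quotient_extremal[OF homogeneous_ideal_nonface_ideal[OF that(1)] that(2)])
  have ins: "insert v ?W = UNIV" by blast
  have "regularity_quotient (stanley_reisner_ideal \<Delta> :: ('v, 'k) mpolynomial set) = ereal (real_of_int (max r1 (r2 + 1)))"
    by (rule eq[OF \<Delta> shedding_step[OF \<Delta> sh(1,4,5) subset_UNIV r1 r2]])
  moreover have "regularity_quotient (stanley_reisner_ideal ?del :: ('v, 'k) mpolynomial set) = ereal (real_of_int r1)"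
    by (rule eq[OF del extremal_add_vertex[OF del W(1) _ r1, of v, unfolded ins]]) simp
  moreover have "regularity_quotient (stanley_reisner_ideal ?lk :: ('v, 'k) mpolynomial set) = ereal (real_of_int r2)"
    by (rule eq[OF lk extremal_add_vertex[OF lk W(2) _ r2, of v, unfolded ins]]) simp
  ultimately show ?thesis by (simp add: max_def)
qed

end
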